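(* There exist universal constants $\bar c_1,\bar c_2,\bar c_3>0$ such that the following holds. Let $n,d$ be positive integers and let $L,\Delta,\varepsilon,\sigma^2,\tau_{\mathrm s},\tau_{\mathrm w},h>0$ be any numbers such that $$\bar c_1\,\varepsilon\log^4(n+1)<L\Delta\qquad\text{and}\qquad d\ \ge\ \bar c_3\,\frac{L\Delta}{\log^3(n+1)\,\varepsilon}.$$ Consider the distributed protocol described in the context. Assume that for all $i\in[n]$ and $k\ge 0$ the server-to-worker compressor $\mathcal C_i^k$ selects and transmits $P_i^k$ uniformly random coordinates (out of $[d]$) without replacement, scaled by any constants, where $P_i^k\in\{0,\dots,d\}$ may vary across each compressor. Then for any zero-respecting algorithm $A\in\mathcal A_{\mathrm{zr}}$ there exist (i) a function $f:\mathbb R^d\to\mathbb R$ that is $L$-smooth, i.e. $\|\nabla f(x)-\nabla f(y)\|\le L\|x-y\|$ for all $x,y\in\mathbb R^d$, and satisfies $f(0)-\inf_{x\in\mathbb R^d}f(x)\le\Delta$; and (ii) a stochastic gradient oracle $\nabla f(x;\xi)$, $\xi\sim\mathcal D_\xi$ (the same for all workers), with $\mathbb E_\xi[\nabla f(x;\xi)]=\nabla f(x)$ and $\mathbb E_\xi[\|\nabla f(x;\xi)-\nabla f(x)\|^2]\le\sigma^2$ for all $x\in\mathbb R^d$, such that $$\mathbb E\Big[\inf_{y\in S_t}\|\nabla f(y)\|^2\Big]>\varepsilon$$ for all $$t\ \le\ \bar c_2\left(\frac{1}{\log^3(n+1)}\cdot\frac{L\Delta}{\varepsilon}\right)\min\left\{\frac{1}{\log(n+1)}\,\tau_{\mathrm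 s}d,\ \max\left\{h,\ \frac{1}{\log^3(n+1)}\cdot\frac{h\sigma^2}{\varepsilon}\right\}\right\},$$ where $S_t$ is the set of all possible points that can be constructed by $A$ up to time $t$ based on the information sets $I$ and $\{I_i\}_{i\in[n]}$.
   Context: Notation: $[n]=\{1,\dots,n\}$; $\|\cdot\|$ is the Euclidean norm; $\mathrm{supp}(v)=\{j\in[d]:v_j\ne0\}$ for $v\in\mathbb R^d$. Setup. There are one server and $n$ workers. All workers access the same function $f:\mathbb R^d\to\mathbb R$ through the same stochastic gradient oracle $\nabla f(x;\xi)$, $\xi\sim\mathcal D_\xi$. Time is measured in seconds: $h$ is the time of one stochastic gradient computation, $\tau_{\mathrm s}$ the time to send one coordinate from the server to a worker, and $\tau_{\mathrm w}$ the time to send one coordinate from a worker to the server. Protocol (taking an algorithm $A$ as input). The server keeps a set of vectors $I$ (all information available on the server) and each worker $i$ keeps a set of vectors $I_i$ (all information available on worker $i$); initially $I=\emptyset$ and $I_i=\emptyset$. The following loops run in parallel, for all $i\in[n]$: 1. (Computation on worker $i$.) For $k=0,1,2,\dots$: $A$ chooses, based on the local information $I_i$, a point $x\in\mathbb R^d$ with $\mathrm{supp}(x)\subseteq\bigcup_{y\in I_i}\mathrm{supp}(y)$ (0 seconds); worker $i$ computes one stochastic gradient $\nabla f(x;\xi)$ with $\xi\sim\mathcal D_\xi$ (all draws of $\xi$ are i.i.d.), taking $h$ seconds; $\nabla f(x;\xi)$ is added to $I_i$ (0 seconds). 2. (Worker $i$ to server.) For $k=0,1,2,\dots$: $A$ chooses,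 based on $I_i$, a point $\bar s_i^k\in\mathbb R^d$ with $\mathrm{supp}(\bar s_i^k)\subseteq\bigcup_{y\in I_i}\mathrm{supp}(y)$ (0 seconds); worker $i$ sends $\bar{\mathcal C}_i^k(\bar s_i^k)$ to the server, which takes $\tau_{\mathrm w}\bar P_i^k$ seconds, where $\bar{\mathcal C}_i^k$ is a compressor that retains (possibly rescaled) $\bar P_i^k$ coordinates of its input and zeroes out the others; $\bar{\mathcal C}_i^k(\bar s_i^k)$ is then added to $I$ (0 seconds). 3. (Server to worker $i$.) For $k=0,1,2,\dots$: $A$ chooses, based on $I$, a point $s_i^k\in\mathbb R^d$ with $\mathrm{supp}(s_i^k)\subseteq\bigcup_{y\in I}\mathrm{supp}(y)$ (0 seconds); it is compressed to $\mathcal C_i^k(s_i^k)$ (0 seconds); the server sends $\mathcal C_i^k(s_i^k)$ to worker $i$, which takes $\tau_{\mathrm s}P_i^k$ seconds, where $P_i^k$ is the number of coordinates retained by $\mathcal C_i^k$; $\mathcal C_i^k(s_i^k)$ is then added to $I_i$ (0 seconds). An empty union of supports is empty, so initially only the zero vector can be chosen. If a vector is added to $I$ or $I_i$ at the same time as $A$ calculates a new point, the vector is added first. Random coordinates: a compressor that selects $P$ uniformly random coordinates without replacement outputs a vector whose coordinates in a uniformly random subset $R\subseteq[d]$ with $|R|=P$ are those of the input multiplied by constants, and whose other coordinates are $0$. The subsets are drawn afresh: each worker's subset is uniformly distributed conditionally on all randomness generated earlier in the run (no independence is required between subsets drawn jointly at the same moment for different workers). Zero-respecting algorithms: an algorithm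 following the protocol is zero-respecting if it does not explore or assign non-zero values to any coordinate unless at least one of the available local vectors contains a non-zero value in that coordinate; the family of such algorithms is $\mathcal A_{\mathrm{zr}}$. Accordingly, a point that can be constructed up to time $t$ based on $I$ and $\{I_i\}$ is a vector whose support is contained in $\bigcup_{y\in I}\mathrm{supp}(y)$, or in $\bigcup_{y\in I_i}\mathrm{supp}(y)$ for some $i\in[n]$, with $I$ and $I_i$ the information available up to time $t$. "Universal constant" means an absolute positive constant independent of all parameters and of the algorithm. *)

theory Defs
  imports "HOL-Probability.Probability"
begin

text \<open>
  The constants of the theorem must not depend on the dimension, so \<open>d\<close> is a natural number
  rather than an index type. Vectors of \<open>\<real>\<^sup>d\<close> are functions on \<^typ>\<open>nat\<close> that vanish
  from index \<open>d\<close> on (the carrier of \<^const>\<open>Euclidean_space\<close>); coordinates are numbered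
  \<open>0, \<dots>, d - 1\<close> and workers \<open>0, \<dots>, n - 1\<close>.
\<close>

type_synonym point = "nat \<Rightarrow> real"

definition Rd :: "nat \<Rightarrow> point set" where
  "Rd d = {x. \<forall>j\<ge>d. x j = 0}"

definition supp :: "point \<Rightarrow> nat set" where
  "supp x = {j. x j \<noteq> 0}"

definition enorm :: "nat \<Rightarrow> point \<Rightarrow> real" where
  "enorm d x = L2_set x {..<d}"

definition has_gradient :: "nat \<Rightarrow> (point \<Rightarrow> real) \<Rightarrow> point \<Rightarrow> point \<Rightarrow> bool" where
  "has_gradient d f g x \<longleftrightarrow>
     (\<forall>e>0. \<exists>r>0. \<forall>y\<in>Rd d. enorm d (\<lambda>j. y j - x j) < r \<longrightarrow>
        \<bar>f y - f x - (\<Sum>j<d. g j * (y j - x j))\<bar> \<le> e * enorm d (\<lambda>j. y j - x j))"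

definition grad :: "nat \<Rightarrow> (point \<Rightarrow> real) \<Rightarrow> point \<Rightarrow> point" where
  "grad d f x = (THE g. g \<in> Rd d \<and> has_gradient d f g x)"

definition smooth :: "nat \<Rightarrow> real \<Rightarrow> (point \<Rightarrow> real) \<Rightarrow> bool" where
  "smooth d L f \<longleftrightarrow>
     (\<forall>x\<in>Rd d. \<exists>g. has_gradient d f g x) \<and>
     (\<forall>x\<in>Rd d. \<forall>y\<in>Rd d.
        enorm d (\<lambda>j. grad d f x j - grad d f y j) \<le> L * enorm d (\<lambda>j. x j - y j))"

definition gap_le :: "nat \<Rightarrow> (point \<Rightarrow> real) \<Rightarrow> real \<Rightarrow> bool" where
  "gap_le d f \<Delta> \<longleftrightarrow> bdd_below (f ` Rd d) \<and> f (\<lambda>_. 0) - (INF x\<in>Rd d. f x) \<le> \<Delta>"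

text \<open>\<open>G x z\<close> is the stochastic gradient at \<open>x\<close> for the draw \<open>z\<close>, whose law is \<open>D\<close>.\<close>

definition gradient_oracle ::
  "nat \<Rightarrow> (point \<Rightarrow> real) \<Rightarrow> real \<Rightarrow> real measure \<Rightarrow> (point \<Rightarrow> real \<Rightarrow> point) \<Rightarrow> bool" where
  "gradient_oracle d f v D G \<longleftrightarrow>
     prob_space D \<and> sets D = sets borel \<and>
     (\<forall>x\<in>Rd d.
        (\<forall>z. G x z \<in> Rd d) \<and>
        (\<forall>j<d. integrable D (\<lambda>z. G x z j) \<and> (\<integral>z. G x z j \<partial>D) = grad d f x j) \<and>
        integrable D (\<lambda>z. (enorm d (\<lambda>j. G x z j - grad d f x j))\<^sup>2) \<and>
        (\<integral>z. (enorm d (\<lambda>j. G x z j - grad d f x j))\<^sup>2 \<partial>D) \<le> v)"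

text \<open>
  A seed is drawn before the run. It carries the internal randomness, if any, of the algorithm and
  of the worker-to-server compressors.
\<close>

type_synonym seed = "nat \<Rightarrow> real"

record protocol =
  workers :: nat
  dim :: nat
  grad_time :: real
  down_coord_time :: real  \<comment> \<open>server to worker\<close>
  up_coord_time :: real  \<comment> \<open>worker to server\<close>
  down_size :: "nat \<Rightarrow> nat \<Rightarrow> nat"
  down_scale :: "nat \<Rightarrow> nat \<Rightarrow> nat \<Rightarrow> real"
  up_size :: "nat \<Rightarrow> nat \<Rightarrow> nat"
  up_comp :: "nat \<Rightarrow> nat \<Rightarrow> seed \<times> point \<Rightarrow> point"
  seed_law :: "seed measure"

definition valid_protocol :: "protocol \<Rightarrow> bool" where
  "valid_protocol p \<longleftrightarrow>
     (\<forall>i<workers p. \<forall>k. down_size p i k \<le> dim p) \<and>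
     (\<forall>i<workers p. \<forall>k. up_comp p i k \<in> borel_measurable borel \<and>
        (\<forall>u. \<forall>x\<in>Rd (dim p). \<exists>B a. B \<subseteq> {..<dim p} \<and> card B = up_size p i k \<and>
           up_comp p i k (u, x) = (\<lambda>j. if j \<in> B then a j * x j else 0))) \<and>
     prob_space (seed_law p) \<and> sets (seed_law p) = sets borel"

text \<open>
  What a node can base its choices on is the history of the vectors in its information set,
  indexed by origin. Vectors not yet available are replaced by \<open>0\<close>, which does not affect any
  support; since all transmission times are fixed by the protocol, the algorithm knows which
  entries these are. The two components of a worker's view are its own stochastic gradients and
  the vectors received from the server; the server's view is indexed by worker and round.
\<close>

type_synonym worker_view = "(nat \<Rightarrow> point) \<times> (nat \<Rightarrow> point)"
type_synonym server_view = "nat \<Rightarrow> nat \<Rightarrow> point"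

record algorithm =
  query :: "nat \<Rightarrow> nat \<Rightarrow> seed \<times> worker_view \<Rightarrow> point"
  to_server :: "nat \<Rightarrow> nat \<Rightarrow> seed \<times> worker_view \<Rightarrow> point"
  to_worker :: "nat \<Rightarrow> nat \<Rightarrow> seed \<times> server_view \<Rightarrow> point"

definition measurable_algorithm :: "algorithm \<Rightarrow> bool" where
  "measurable_algorithm A \<longleftrightarrow>
     (\<forall>i k. query A i k \<in> borel_measurable borel \<and>
            to_server A i k \<in> borel_measurable borel \<and>
            to_worker A i k \<in> borel_measurable borel)"

definition zero_respecting :: "algorithm \<Rightarrow> bool" where
  "zero_respecting A \<longleftrightarrow>
     (\<forall>i k u V W. supp (query A i k (u, V, W)) \<subseteq> (\<Union>l. supp (V l)) \<union> (\<Union>l. supp (W l))) \<and>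
     (\<forall>i k u V W. supp (to_server A i k (u, V, W)) \<subseteq> (\<Union>l. supp (V l)) \<union> (\<Union>l. supp (W l))) \<and>
     (\<forall>i k u V. supp (to_worker A i k (u, V)) \<subseteq> (\<Union>i' l. supp (V i' l)))"

text \<open>
  Message \<open>k\<close> to or from worker \<open>i\<close> is sent from time \<open>down_time p i k\<close>, respectively
  \<open>up_time p i k\<close>, to the same time for \<open>Suc k\<close>.
\<close>

definition down_time :: "protocol \<Rightarrow> nat \<Rightarrow> nat \<Rightarrow> real" where
  "down_time p i k = down_coord_time p * real (\<Sum>l<k. down_size p i l)"

definition up_time :: "protocol \<Rightarrow> nat \<Rightarrow> nat \<Rightarrow> real" where
  "up_time p i k = up_coord_time p * real (\<Sum>l<k. up_size p i l)"

text \<open>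
  The vectors added to the information sets: stochastic gradients, vectors as received by the
  server, and vectors as received by the workers (worker first, then round).
\<close>

record transcript =
  grads :: "nat \<Rightarrow> nat \<Rightarrow> point"
  ups :: "nat \<Rightarrow> nat \<Rightarrow> point"
  downs :: "nat \<Rightarrow> nat \<Rightarrow> point"

definition worker_info :: "protocol \<Rightarrow> transcript \<Rightarrow> nat \<Rightarrow> real \<Rightarrow> point set" where
  "worker_info p T i t =
     {grads T i k | k. real (Suc k) * grad_time p \<le> t} \<union>
     {downs T i k | k. down_time p i (Suc k) \<le> t}"

definition server_info :: "protocol \<Rightarrow> transcript \<Rightarrow> real \<Rightarrow> point set" where
  "server_info p T t = {ups T i k | i k. i < workers p \<and> up_time p i (Suc k) \<le> t}"

definition worker_view :: "protocol \<Rightarrow> transcript \<Rightarrow> nat \<Rightarrow> real \<Rightarrow> worker_view" where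
  "worker_view p T i t =
     (\<lambda>k. if real (Suc k) * grad_time p \<le> t then grads T i k else (\<lambda>_. 0),
      \<lambda>k. if down_time p i (Suc k) \<le> t then downs T i k else (\<lambda>_. 0))"

definition server_view :: "protocol \<Rightarrow> transcript \<Rightarrow> real \<Rightarrow> server_view" where
  "server_view p T t =
     (\<lambda>i k. if i < workers p \<and> up_time p i (Suc k) \<le> t then ups T i k else (\<lambda>_. 0))"

text \<open>
  An outcome consists of the seed, the oracle draws and the coordinate subsets of the
  server-to-worker compressors, the latter two indexed by worker and round.

  The equations below determine the transcript (for \<open>i < workers p\<close>): a message of positive
  duration depends only on vectors available when it is started, and a message that retains no
  coordinate is the zero vector whatever its input.
\<close>

type_synonym outcome = "seed \<times> (nat \<times> nat \<Rightarrow> real) \<times> (nat \<times> nat \<Rightarrow> nat set)"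

fun is_run ::
  "protocol \<Rightarrow> algorithm \<Rightarrow> (point \<Rightarrow> real \<Rightarrow> point) \<Rightarrow> outcome \<Rightarrow> transcript \<Rightarrow> bool" where
  "is_run p A G (u, \<xi>, R) T \<longleftrightarrow>
     (\<forall>i<workers p. \<forall>k.
        grads T i k =
          G (query A i k (u, worker_view p T i (real k * grad_time p))) (\<xi> (i, k)) \<and>
        ups T i k =
          up_comp p i k (u, to_server A i k (u, worker_view p T i (up_time p i k))) \<and>
        downs T i k =
          (\<lambda>j. if j \<in> R (i, k)
               then down_scale p i k j *
                    to_worker A i k (u, server_view p T (down_time p i k)) j
               else 0))"

definition constructible :: "protocol \<Rightarrow> transcript \<Rightarrow> real \<Rightarrow> point set" where
  "constructible p T t =
     {x \<in> Rd (dim p). supp x \<subseteq> (\<Union>y\<in>server_info p T t. supp y) \<or>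
        (\<exists>i<workers p. supp x \<subseteq> (\<Union>y\<in>worker_info p T i t. supp y))}"

definition size_subsets :: "nat \<Rightarrow> nat \<Rightarrow> nat set set" where
  "size_subsets d m = {B. B \<subseteq> {..<d} \<and> card B = m}"

text \<open>
  Outcomes restricted to the oracle draws in \<open>X\<close> and the coordinate subsets in \<open>Y\<close>.
\<close>

definition draw_space :: "protocol \<Rightarrow> (nat \<times> nat) set \<Rightarrow> (nat \<times> nat) set \<Rightarrow> outcome measure" where
  "draw_space p X Y =
     borel \<Otimes>\<^sub>M (PiM X (\<lambda>_. borel) \<Otimes>\<^sub>M
       PiM Y (\<lambda>(i, k). count_space (size_subsets (dim p) (down_size p i k))))"

fun revealed :: "(nat \<times> nat) set \<Rightarrow> (nat \<times> nat) set \<Rightarrow> outcome \<Rightarrow> outcome" where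
  "revealed X Y (u, \<xi>, R) = (u, restrict \<xi> X, restrict R Y)"

definition draw_index :: "protocol \<Rightarrow> (nat \<times> nat) set" where
  "draw_index p = {..<workers p} \<times> UNIV"

text \<open>\<open>X\<close> has law \<open>N\<close> and is independent of \<open>Y\<close>.\<close>

definition fresh_draw ::
  "'a measure \<Rightarrow> 'b measure \<Rightarrow> ('a \<Rightarrow> 'b) \<Rightarrow> 'c measure \<Rightarrow> ('a \<Rightarrow> 'c) \<Rightarrow> bool" where
  "fresh_draw M N X S Y \<longleftrightarrow>
     distr M (N \<Otimes>\<^sub>M S) (\<lambda>\<omega>. (X \<omega>, Y \<omega>)) = N \<Otimes>\<^sub>M distr M S Y"

text \<open>
  \<open>run_law p D M\<close>: \<open>M\<close> is a possible law of the outcome when the oracle draws have law \<open>D\<close>. The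
  oracle draw \<open>(i, k)\<close> is made when the computation starts, and is independent of the seed and of
  all other draws made up to and including that time (so the oracle draws are i.i.d.).
  The subset \<open>(i, k)\<close> is drawn when the message is started, and is uniform conditionally on the
  seed and all draws made strictly before; the joint law of subsets drawn at the same time
  for different workers is left open.
\<close>

definition run_law :: "protocol \<Rightarrow> real measure \<Rightarrow> outcome measure \<Rightarrow> bool" where
  "run_law p D M \<longleftrightarrow>
     prob_space M \<and>
     sets M = sets (draw_space p (draw_index p) (draw_index p)) \<and>
     distr M borel fst = seed_law p \<and>
     (\<forall>i<workers p. \<forall>k.
        let t = real k * grad_time p;
            X = {(i', k') \<in> draw_index p. real k' * grad_time p \<le> t} - {(i, k)};
            Y = {(i', k') \<in> draw_index p. down_time p i' k' \<le> t}
        in fresh_draw M D (\<lambda>(u, \<xi>, R). \<xi> (i, k)) (draw_space p X Y) (revealed X Y)) \<and>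
     (\<forall>i<workers p. \<forall>k.
        let t = down_time p i k;
            X = {(i', k') \<in> draw_index p. real k' * grad_time p < t};
            Y = {(i', k') \<in> draw_index p. down_time p i' k' < t}
        in fresh_draw M (uniform_count_measure (size_subsets (dim p) (down_size p i k)))
             (\<lambda>(u, \<xi>, R). R (i, k)) (draw_space p X Y) (revealed X Y))"

end

theory Submission
  imports Defs
begin

text \<open>
  The hard function is a chain in which the partial derivative at a new coordinate vanishes
  unless the \<open>K\<close> preceding coordinates are nonzero, where \<open>K\<close> is of order \<open>log (n + 1)\<close>, and whose
  gradient is large as long as the last coordinate is zero. The oracle reveals the next coordinate
  only with probability \<open>q\<close>, of order \<open>1 / (1 + \<sigma>\<^sup>2 / \<epsilon>)\<close>.

  To get past a block of \<open>K\<close> coordinates some worker has to know all of them. It finds each of them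
  either by a successful draw of its own, or in a random subset sent by the server. Within a time of
  order \<open>min (\<tau>\<^sub>s d) (K h / q)\<close> each of these accounts for \<open>K / 2\<close> coordinates with a probability
  exponentially small in \<open>K\<close>, which beats the number of workers. An exponential potential, summed
  over the workers so that nothing is needed about the joint law of simultaneous draws, turns this
  into a bound on the number of blocks passed.
\<close>

section \<open>The chain function\<close>

text \<open>The obstacle is the number of workers. If one nonzero predecessor were enough to open a
  coordinate, the luckiest of \<open>n\<close> workers would set the pace: among \<open>n\<close>
  parallel draws or random subsets one hits the next coordinate long before a typical one does. A
  count of order \<open>log (n + 1)\<close> finds at a single worker is so concentrated that the
  fastest of \<open>n\<close> workers gains only a constant factor. Hence windows of length
  \<open>8 * Q\<close> with \<open>workers p \<le> 2 ^ Q\<close>. The price is a Lipschitz constant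
  of order \<open>K\<^sup>2\<close> for the gradient, which limits the length of the chain.

  The server may hold everything that any worker has found, but it computes no gradients, and a
  worker profits from it only through a random subset. So a small message is charged with all
  coordinates of the current block in its subset, whether or not the server knows them, and the
  knowledge of the server need not be followed.\<close>

definition psq :: "real \<Rightarrow> real" where
  "psq x = (max 0 x)\<^sup>2"

text \<open>Lets \<open>psq\<close> be differentiated at the kink of \<open>max 0 x\<close> without
  one-sided derivatives.\<close>

lemma DERIV_of_quadratic_bound:
  fixes f :: "real \<Rightarrow> real"
  assumes "\<And>y. \<bar>f y - f x - D * (y - x)\<bar> \<le> C * (y - x)\<^sup>2"
  shows "(f has_real_derivative D) (at x)"
proof -
  have "((\<lambda>y. (f y - f x) / (y - x) - D) \<longlongrightarrow> 0) (at x)"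
  proof (rule Lim_null_comparison)
    show "\<forall>\<^sub>F y in at x. norm ((f y - f x) / (y - x) - D) \<le> C * \<bar>y - x\<bar>"
    proof (rule eventually_at_filter[THEN iffD2, OF always_eventually], intro allI impI)
      fix y assume "y \<noteq> x"
      then have "(f y - f x) / (y - x) - D = (f y - f x - D * (y - x)) / (y - x)"
        by (simp add: field_simps)
      also have "\<bar>\<dots>\<bar> \<le> C * (y - x)\<^sup>2 / \<bar>y - x\<bar>"
        using assms[of y] by (simp add: abs_divide divide_right_mono)
      also have "\<dots> = C * \<bar>y - x\<bar>"
        using \<open>y \<noteq> x\<close> by (simp add: power2_eq_square field_simps abs_if)
      finally show "norm ((f y - f x) / (y - x) - D) \<le> C * \<bar>y - x\<bar>" by simp
    qed
    show "((\<lambda>y. C * \<bar>y - x\<bar>) \<longlongrightarrow> 0) (at x)"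
      by (rule tendsto_eq_intros refl | simp)+
  qed
  then have "((\<lambda>y. (f y - f x) / (y - x)) \<longlongrightarrow> D) (at x)"
    by (simp add: LIM_zero_iff)
  then show ?thesis by (simp add: has_field_derivative_iff)
qed

lemma psq_DERIV: "(psq has_real_derivative 2 * max 0 x) (at x)"
proof (rule DERIV_of_quadratic_bound[where C = 1])
  fix y :: real
  consider "x \<ge> 0" "y \<ge> 0" | "x \<ge> 0" "y < 0" | "x < 0" "y \<ge> 0" | "x < 0" "y < 0" by linarith
  then show "\<bar>psq y - psq x - 2 * max 0 x * (y - x)\<bar> \<le> 1 * (y - x)\<^sup>2"
  proof cases
    case 1
    then have "psq y - psq x - 2 * max 0 x * (y - x) = (y - x)\<^sup>2"
      by (simp add: psq_def power2_eq_square algebra_simps)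
    then show ?thesis by simp
  next
    case 2
    then have "x * y \<le> 0" by (simp add: mult_nonneg_nonpos)
    moreover have "psq y - psq x - 2 * max 0 x * (y - x) = x\<^sup>2 - 2 * (x * y)"
      using 2 by (simp add: psq_def power2_eq_square algebra_simps)
    moreover have "(y - x)\<^sup>2 = x\<^sup>2 + y\<^sup>2 - 2 * (x * y)"
      by (simp add: power2_eq_square algebra_simps)
    ultimately show ?thesis
      using zero_le_power2[of x] zero_le_power2[of y] by linarith
  next
    case 3
    then have "x * y \<le> 0" by (simp add: mult_nonpos_nonneg)
    then show ?thesis using 3 by (simp add: psq_def power2_eq_square algebra_simps)
  next
    case 4
    then show ?thesis by (simp add: psq_def)
  qed
qed

text \<open>Climbs from 0 at the origin to 1 at 1 and is constant outside, with a Lipschitz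
  derivative. Since value and derivative vanish at 0, a zero coordinate closes every later window
  through it and contributes to no partial derivative of its own by way of these windows.\<close>

definition gate :: "real \<Rightarrow> real" where
  "gate x = 1 - psq (1 - psq x)"

definition gate' :: "real \<Rightarrow> real" where
  "gate' x = 4 * max 0 (1 - psq x) * max 0 x"

text \<open>The reward for raising a coordinate. It is bounded, so each coordinate lowers the
  objective by at most 4, and its slope is at least 1/2 on the interval from -1 to 1.\<close>

definition gain :: "real \<Rightarrow> real" where
  "gain x = arctan x + pi / 2"

definition gain' :: "real \<Rightarrow> real" where
  "gain' x = 1 / (1 + x\<^sup>2)"

text \<open>The slope of \<open>gain\<close> dies out far to the left; this penalty keeps the
  gradient large there.\<close>

definition pen :: "real \<Rightarrow> real" where
  "pen x = psq (- x) / 2"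

lemma gate_DERIV [derivative_intros]:
  "(f has_real_derivative D) (at x within S) \<Longrightarrow>
   ((\<lambda>x. gate (f x)) has_real_derivative gate' (f x) * D) (at x within S)"
  unfolding gate_def
  by (rule derivative_eq_intros DERIV_chain2[OF psq_DERIV] refl | assumption)+
     (simp add: gate'_def)

lemma gain_DERIV [derivative_intros]:
  "(f has_real_derivative D) (at x within S) \<Longrightarrow>
   ((\<lambda>x. gain (f x)) has_real_derivative gain' (f x) * D) (at x within S)"
  unfolding gain_def
  by (rule derivative_eq_intros refl | assumption)+
     (simp add: gain'_def divide_inverse)

lemma pen_DERIV [derivative_intros]:
  "(f has_real_derivative D) (at x within S) \<Longrightarrow>
   ((\<lambda>x. pen (f x)) has_real_derivative min 0 (f x) * D) (at x within S)"
  unfolding pen_def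
  by (rule derivative_eq_intros DERIV_chain2[OF psq_DERIV] refl | assumption)+
     (auto simp: max_def min_def)

lemma gate_range: "0 \<le> gate x" "gate x \<le> 1"
proof -
  have "max 0 (1 - psq x) \<le> 1" by (simp add: psq_def)
  then show "0 \<le> gate x" unfolding gate_def psq_def[of "1 - psq x"]
    by (simp add: power_le_one)
  show "gate x \<le> 1" unfolding gate_def by (simp add: psq_def)
qed

lemma gate_zero [simp]: "gate 0 = 0" and gate'_zero [simp]: "gate' 0 = 0"
  by (simp_all add: gate_def gate'_def psq_def)

lemma gate_one: "x \<ge> 1 \<Longrightarrow> gate x = 1"
  by (simp add: gate_def psq_def)

lemma gain_range: "0 \<le> gain x" "gain x \<le> 4"
  using arctan_bounded[of x] pi_less_4 by (simp_all add: gain_def)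

lemma gain'_range: "0 \<le> gain' x" "gain' x \<le> 1"
  by (simp_all add: gain'_def divide_le_eq add_pos_nonneg)

lemma gain'_ge_half:
  assumes "\<bar>x\<bar> \<le> 1" shows "gain' x \<ge> 1 / 2"
proof -
  have "x\<^sup>2 \<le> 1" using assms by (simp add: abs_square_le_1)
  moreover have "x\<^sup>2 + 1 > 0" by (simp add: add_nonneg_pos)
  ultimately show ?thesis by (simp add: gain'_def field_simps)
qed

lemma pen_nonneg: "0 \<le> pen x"
  by (simp add: pen_def psq_def)

lemma pen_zero [simp]: "pen 0 = 0"
  by (simp add: pen_def psq_def)

text \<open>After clamping to the unit interval, \<open>gate'\<close> is a cubic polynomial.
  Clamping does not increase distances, so range and Lipschitz constant can be read off the
  cubic.\<close>

lemma gate'_alt: "gate' x = (let c = max 0 (min 1 x) in 4 * (c * (1 - c\<^sup>2)))"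
proof -
  consider "x \<le> 0" | "0 < x" "x \<le> 1" | "x > 1" by linarith
  then show ?thesis
  proof cases
    case 2
    then have "x\<^sup>2 \<le> 1" by (simp add: power_le_one)
    then show ?thesis using 2 by (simp add: gate'_def psq_def Let_def)
  next
    case 3
    then have "x\<^sup>2 > 1" by (simp add: one_less_power)
    then show ?thesis using 3 by (simp add: gate'_def psq_def Let_def)
  qed (simp add: gate'_def psq_def Let_def)
qed

lemma cubic_lipschitz:
  fixes c e :: real
  assumes "0 \<le> c" "c \<le> 1" "0 \<le> e" "e \<le> 1"
  shows "\<bar>4 * (c * (1 - c\<^sup>2)) - 4 * (e * (1 - e\<^sup>2))\<bar> \<le> 8 * \<bar>c - e\<bar>"
proof -
  have *: "c * (1 - c\<^sup>2) - e * (1 - e\<^sup>2) = (c - e) * (1 - (c\<^sup>2 + c * e + e\<^sup>2))"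
    by (simp add: power2_eq_square algebra_simps)
  have "c\<^sup>2 \<le> 1" "e\<^sup>2 \<le> 1" "c * e \<le> 1"
    using assms by (simp_all add: power_le_one mult_le_one)
  moreover have "0 \<le> c\<^sup>2 + c * e + e\<^sup>2" using assms by simp
  ultimately have "\<bar>1 - (c\<^sup>2 + c * e + e\<^sup>2)\<bar> \<le> 2" by linarith
  then have "\<bar>(c - e) * (1 - (c\<^sup>2 + c * e + e\<^sup>2))\<bar> \<le> \<bar>c - e\<bar> * 2"
    unfolding abs_mult by (intro mult_left_mono) auto
  then show ?thesis using * by (simp add: right_diff_distrib[symmetric] abs_mult)
qed

lemma gate'_range: "0 \<le> gate' x" "gate' x \<le> 2"
proof -
  show "0 \<le> gate' x" by (simp add: gate'_def)
  define c where "c = max 0 (min 1 x)"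
  have c: "0 \<le> c" "c \<le> 1" by (auto simp: c_def)
  \<comment> \<open>A certificate for \<open>4 * (c * (1 - c\<^sup>2)) \<le> 2\<close>: the
    difference is a sum of terms that are nonnegative on the unit interval.\<close>
  have "0 \<le> (2 * c - 1)\<^sup>2 * (c + 1) + (1 - c)" using c by simp
  also have "\<dots> = 2 - 4 * (c * (1 - c\<^sup>2)) " 
    by (simp add: power2_eq_square algebra_simps)
  finally show "gate' x \<le> 2" by (simp add: gate'_alt Let_def flip: c_def)
qed

lemma gate'_lipschitz: "\<bar>gate' x - gate' y\<bar> \<le> 8 * \<bar>x - y\<bar>"
proof -
  have "\<bar>gate' x - gate' y\<bar> \<le> 8 * \<bar>max 0 (min 1 x) - max 0 (min 1 y)\<bar>"
    unfolding gate'_alt Let_def by (rule cubic_lipschitz) auto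
  also have "\<dots> \<le> 8 * \<bar>x - y\<bar>" by auto
  finally show ?thesis .
qed

lemma lipschitz_of_DERIV:
  fixes f :: "real \<Rightarrow> real"
  assumes "\<And>x. (f has_real_derivative f' x) (at x)" and "\<And>x. \<bar>f' x\<bar> \<le> C"
  shows "\<bar>f x - f y\<bar> \<le> C * \<bar>x - y\<bar>"
proof -
  have *: "\<bar>f x - f y\<bar> \<le> C * \<bar>x - y\<bar>" if less: "y < x" for x y
  proof -
    obtain z where "f x - f y = (x - y) * f' z"
      using MVT2[OF less assms(1)] by blast
    then show ?thesis using assms(2)[of z] less
      by (simp add: abs_mult mult.commute mult_right_mono)
  qed
  show ?thesis
    using *[of x y] *[of y x] by (cases x y rule: linorder_cases) (auto simp: abs_minus_commute)
qed

lemma gate_lipschitz: "\<bar>gate x - gate y\<bar> \<le> 2 * \<bar>x - y\<bar>"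
  using gate_DERIV[OF DERIV_ident] gate'_range
  by (intro lipschitz_of_DERIV[where f' = gate']) auto

lemma gain_lipschitz: "\<bar>gain x - gain y\<bar> \<le> \<bar>x - y\<bar>"
proof -
  have "\<bar>gain x - gain y\<bar> \<le> 1 * \<bar>x - y\<bar>"
    using gain_DERIV[OF DERIV_ident] gain'_range
    by (intro lipschitz_of_DERIV[where f' = gain']) auto
  then show ?thesis by simp
qed

lemma gain'_lipschitz: "\<bar>gain' x - gain' y\<bar> \<le> \<bar>x - y\<bar>"
proof -
  have pos: "1 + x\<^sup>2 > 0" "1 + y\<^sup>2 > 0" by (simp_all add: add_pos_nonneg)
  have "2 * \<bar>x\<bar> \<le> 1 + x\<^sup>2" "2 * \<bar>y\<bar> \<le> 1 + y\<^sup>2"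
    using zero_le_power2[of "\<bar>x\<bar> - 1"] zero_le_power2[of "\<bar>y\<bar> - 1"]
    by (simp_all add: power2_eq_square algebra_simps)
  moreover have "1 + x\<^sup>2 + (1 + y\<^sup>2) \<le> 2 * ((1 + x\<^sup>2) * (1 + y\<^sup>2))"
    by (simp add: algebra_simps)
  ultimately have "\<bar>x + y\<bar> \<le> (1 + x\<^sup>2) * (1 + y\<^sup>2)" by linarith
  then have "\<bar>x + y\<bar> / ((1 + x\<^sup>2) * (1 + y\<^sup>2)) \<le> 1" using pos by simp
  moreover have "gain' x - gain' y = (y - x) * ((x + y) / ((1 + x\<^sup>2) * (1 + y\<^sup>2)))"
    using pos by (simp add: gain'_def field_simps power2_eq_square)
  then have "\<bar>gain' x - gain' y\<bar> = \<bar>x - y\<bar> * (\<bar>x + y\<bar> / ((1 + x\<^sup>2) * (1 + y\<^sup>2)))"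
    using pos by (simp add: abs_mult abs_divide abs_minus_commute)
  ultimately show ?thesis
    by (metis abs_ge_zero mult.right_neutral mult_left_mono)
qed

lemma min_zero_lipschitz: "\<bar>min 0 x - min 0 y\<bar> \<le> \<bar>x - y\<bar>" for x y :: real
  by auto


text \<open>Subtraction truncates: the windows of the first \<open>K\<close> coordinates are
  shorter, and that of coordinate 0 is empty. So the chain can be entered from the zero
  vector.\<close>

definition chain :: "nat \<Rightarrow> nat \<Rightarrow> point \<Rightarrow> real" where
  "chain K T x = (\<Sum>j<T. pen (x j) - gain (x j) * (\<Prod>i\<in>{j-K..<j}. gate (x i)))"

definition chain_grad :: "nat \<Rightarrow> nat \<Rightarrow> point \<Rightarrow> point" where
  "chain_grad K T x j = (if j < T then
     min 0 (x j) - gain' (x j) * (\<Prod>i\<in>{j-K..<j}. gate (x i)) -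
     gate' (x j) * (\<Sum>i | i < T \<and> j \<in> {i-K..<i}. gain (x i) * (\<Prod>l\<in>{i-K..<i}-{j}. gate (x l)))
   else 0)"

text \<open>Derivatives along lines are all that \<open>has_gradient_of_lipschitz\<close> asks for,
  so one-variable calculus suffices. The product rule yields a double sum over windows and their
  members; exchanging it collects, for each coordinate, the later windows through it.\<close>

lemma chain_line_DERIV:
  "((\<lambda>s. chain K T (\<lambda>j. x j + s * v j)) has_real_derivative
    (\<Sum>j<T. chain_grad K T (\<lambda>j. x j + s * v j) j * v j)) (at s)"
proof -
  define y where "y = (\<lambda>j. x j + s * v j)"
  have "((\<lambda>s. chain K T (\<lambda>j. x j + s * v j)) has_real_derivative
     (\<Sum>j<T. min 0 (y j) * v j - (gain' (y j) * v j * (\<Prod>i\<in>{j-K..<j}. gate (y i)) +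
       (\<Sum>i\<in>{j-K..<j}. gate' (y i) * v i * (\<Prod>l\<in>{j-K..<j}-{i}. gate (y l))) * gain (y j)))) (at s)"
    unfolding chain_def y_def
    by (auto intro!: derivative_eq_intros has_field_derivative_prod sum.cong)
  also have "(\<Sum>j<T. min 0 (y j) * v j - (gain' (y j) * v j * (\<Prod>i\<in>{j-K..<j}. gate (y i)) +
       (\<Sum>i\<in>{j-K..<j}. gate' (y i) * v i * (\<Prod>l\<in>{j-K..<j}-{i}. gate (y l))) * gain (y j)))
     = (\<Sum>j<T. min 0 (y j) * v j - gain' (y j) * v j * (\<Prod>i\<in>{j-K..<j}. gate (y i))) -
       (\<Sum>j<T. \<Sum>i | i \<in> {..<T} \<and> i \<in> {j-K..<j}.
          gate' (y i) * v i * (\<Prod>l\<in>{j-K..<j}-{i}. gate (y l)) * gain (y j))"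
    unfolding sum_subtractf[symmetric]
    by (intro sum.cong refl) (auto simp: sum_distrib_right intro!: sum.cong)
  also have "(\<Sum>j<T. \<Sum>i | i \<in> {..<T} \<and> i \<in> {j-K..<j}.
          gate' (y i) * v i * (\<Prod>l\<in>{j-K..<j}-{i}. gate (y l)) * gain (y j))
     = (\<Sum>i<T. \<Sum>j | j \<in> {..<T} \<and> i \<in> {j-K..<j}.
          gate' (y i) * v i * (\<Prod>l\<in>{j-K..<j}-{i}. gate (y l)) * gain (y j))"
    by (rule sum.swap_restrict) auto
  also have "(\<Sum>j<T. min 0 (y j) * v j - gain' (y j) * v j * (\<Prod>i\<in>{j-K..<j}. gate (y i))) - \<dots>
     = (\<Sum>j<T. chain_grad K T y j * v j)"
    unfolding sum_subtractf[symmetric]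
    by (intro sum.cong refl)
       (auto simp: chain_grad_def sum_distrib_left sum_distrib_right algebra_simps intro!: sum.cong)
  finally show ?thesis by (simp add: y_def)
qed

section \<open>The Lipschitz constant of the gradient of the chain\<close>

lemma abs_mult_diff_le:
  fixes a b c e :: real
  assumes "\<bar>a - b\<bar> \<le> A" "\<bar>c - e\<bar> \<le> C" "\<bar>c\<bar> \<le> M" "\<bar>b\<bar> \<le> N"
  shows "\<bar>a * c - b * e\<bar> \<le> M * A + N * C"
proof -
  have "a * c - b * e = (a - b) * c + b * (c - e)" by (simp add: algebra_simps)
  also have "\<bar>\<dots>\<bar> \<le> \<bar>a - b\<bar> * \<bar>c\<bar> + \<bar>b\<bar> * \<bar>c - e\<bar>"
    by (metis abs_mult abs_triangle_ineq)
  also have "\<dots> \<le> A * M + N * C"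
    using assms abs_ge_zero order_trans by (intro add_mono mult_mono) (blast+)
  finally show ?thesis by (simp add: mult.commute)
qed

lemma gate_prod_range: "0 \<le> (\<Prod>i\<in>I. gate (x i))" "(\<Prod>i\<in>I. gate (x i)) \<le> 1"
  by (auto intro: prod_nonneg prod_le_1 simp: gate_range)

lemma gate_prod_lipschitz:
  "\<bar>(\<Prod>i\<in>I. gate (x i)) - (\<Prod>i\<in>I. gate (y i))\<bar> \<le> 2 * (\<Sum>i\<in>I. \<bar>x i - y i\<bar>)"
proof -
  have "\<bar>(\<Prod>i\<in>I. gate (x i)) - (\<Prod>i\<in>I. gate (y i))\<bar> \<le> (\<Sum>i\<in>I. \<bar>gate (x i) - gate (y i)\<bar>)"
    using norm_prod_diff[of I "\<lambda>i. gate (x i)" "\<lambda>i. gate (y i)"] gate_range by simp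
  also have "\<dots> \<le> (\<Sum>i\<in>I. 2 * \<bar>x i - y i\<bar>)" by (intro sum_mono gate_lipschitz)
  finally show ?thesis by (simp add: sum_distrib_left)
qed

text \<open>At most \<open>K\<close> later windows contain \<open>j\<close>, and each contributes a
  product of bounded Lipschitz factors; this is the factor \<open>K\<close>. A product of gates is
  no worse than the sum of its factors, as gates lie between 0 and 1. All coordinates involved are
  within \<open>K\<close> of \<open>j\<close>.\<close>

lemma chain_grad_component_lipschitz:
  assumes "K \<ge> 1"
  shows "\<bar>chain_grad K T x j - chain_grad K T y j\<bar> \<le> 61 * real K * (\<Sum>l\<in>{j-K..j+K}. \<bar>x l - y l\<bar>)"
proof (cases "j < T")
  case True
  define R where "R = (\<Sum>l\<in>{j-K..j+K}. \<bar>x l - y l\<bar>)"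
  have sub: "(\<Sum>l\<in>I. \<bar>x l - y l\<bar>) \<le> R" if "I \<subseteq> {j-K..j+K}" for I
    unfolding R_def using that by (intro sum_mono2) auto
  have single: "\<bar>x i - y i\<bar> \<le> R" if "i \<in> {j-K..j+K}" for i
    using sub[of "{i}"] that by simp
  have R0: "R \<ge> 0" unfolding R_def by (simp add: sum_nonneg)
  define I where "I = {i. i < T \<and> j \<in> {i-K..<i}}"
  have finI: "finite I" by (simp add: I_def)
  have "I \<subseteq> {j<..j+K}" by (auto simp: I_def)
  then have "card I \<le> card {j<..j+K}" by (intro card_mono) auto
  then have cardI: "card I \<le> K" by simp
  define S where "S = (\<lambda>x. \<Sum>i\<in>I. gain (x i) * (\<Prod>l\<in>{i-K..<i}-{j}. gate (x l)))"
  have term_range: "\<bar>gain (x i) * (\<Prod>l\<in>{i-K..<i}-{j}. gate (x l))\<bar> \<le> 4" for x :: point and i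
  proof -
    have "gain (x i) * (\<Prod>l\<in>{i-K..<i}-{j}. gate (x l)) \<le> 4 * 1"
      by (intro mult_mono gain_range gate_prod_range) simp
    then show ?thesis by (simp add: abs_mult gain_range gate_prod_range)
  qed
  have S_range: "\<bar>S x\<bar> \<le> 4 * K" for x
  proof -
    have "\<bar>S x\<bar> \<le> (\<Sum>i\<in>I. 4)" unfolding S_def
      by (rule order_trans[OF sum_abs]) (intro sum_mono term_range)
    also have "\<dots> \<le> 4 * K" using cardI by simp
    finally show ?thesis .
  qed
  have S_lip: "\<bar>S x - S y\<bar> \<le> 9 * R * K"
  proof -
    have "\<bar>gain (x i) * (\<Prod>l\<in>{i-K..<i}-{j}. gate (x l)) - gain (y i) * (\<Prod>l\<in>{i-K..<i}-{j}. gate (y l))\<bar> \<le> 9 * R"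
      if "i \<in> I" for i
    proof -
      have "\<bar>gain (x i) - gain (y i)\<bar> \<le> R"
      proof -
        have "i \<in> {j-K..j+K}" using that by (auto simp: I_def)
        from order_trans[OF gain_lipschitz single[OF this]] show ?thesis .
      qed
      moreover have "\<bar>(\<Prod>l\<in>{i-K..<i}-{j}. gate (x l)) - (\<Prod>l\<in>{i-K..<i}-{j}. gate (y l))\<bar> \<le> 2 * R"
      proof -
        have "{i-K..<i}-{j} \<subseteq> {j-K..j+K}" using that by (auto simp: I_def)
        from sub[OF this] show ?thesis
          using gate_prod_lipschitz[of x "{i-K..<i}-{j}" y] by linarith
      qed
      moreover have "\<bar>\<Prod>l\<in>{i-K..<i}-{j}. gate (x l)\<bar> \<le> 1" "\<bar>gain (y i)\<bar> \<le> 4"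
        by (simp_all add: gate_prod_range gain_range)
      ultimately have "\<bar>gain (x i) * (\<Prod>l\<in>{i-K..<i}-{j}. gate (x l)) -
          gain (y i) * (\<Prod>l\<in>{i-K..<i}-{j}. gate (y l))\<bar> \<le> 1 * R + 4 * (2 * R)"
        by (intro abs_mult_diff_le)
      then show ?thesis by simp
    qed
    then have "\<bar>S x - S y\<bar> \<le> (\<Sum>i\<in>I. 9 * R)"
      unfolding S_def sum_subtractf[symmetric]
      by (intro order_trans[OF sum_abs] sum_mono)
    also have "\<dots> \<le> 9 * R * K" using cardI R0 by (simp add: mult.commute mult_left_mono)
    finally show ?thesis .
  qed
  have "\<bar>gate' (x j) * S x - gate' (y j) * S y\<bar> \<le> (4 * real K) * (8 * R) + 2 * (9 * R * K)"
  proof (intro abs_mult_diff_le)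
    show "\<bar>gate' (x j) - gate' (y j)\<bar> \<le> 8 * R"
      using gate'_lipschitz[of "x j" "y j"] single[of j] by simp
  qed (use S_lip S_range[of x] in \<open>simp_all add: gate'_range\<close>)
  moreover have "\<bar>gain' (x j) * (\<Prod>i\<in>{j-K..<j}. gate (x i)) - gain' (y j) * (\<Prod>i\<in>{j-K..<j}. gate (y i))\<bar>
      \<le> 1 * R + 1 * (2 * R)"
  proof (intro abs_mult_diff_le)
    show "\<bar>gain' (x j) - gain' (y j)\<bar> \<le> R"
      using gain'_lipschitz[of "x j" "y j"] single[of j] by simp
    have "{j-K..<j} \<subseteq> {j-K..j+K}" by auto
    from sub[OF this] show "\<bar>(\<Prod>i\<in>{j-K..<j}. gate (x i)) - (\<Prod>i\<in>{j-K..<j}. gate (y i))\<bar> \<le> 2 * R"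
      using gate_prod_lipschitz[of x "{j-K..<j}" y] by linarith
  qed (simp_all add: gate_prod_range gain'_range)
  moreover have "\<bar>min 0 (x j) - min 0 (y j)\<bar> \<le> R"
    using min_zero_lipschitz[of "x j" "y j"] single[of j] by simp
  moreover have "R \<le> R * K" using assms R0 by (simp add: mult_le_cancel_left1)
  moreover have "chain_grad K T x j - chain_grad K T y j =
      (min 0 (x j) - min 0 (y j)) -
      (gain' (x j) * (\<Prod>i\<in>{j-K..<j}. gate (x i)) - gain' (y j) * (\<Prod>i\<in>{j-K..<j}. gate (y i))) -
      (gate' (x j) * S x - gate' (y j) * S y)"
    using True by (simp add: chain_grad_def S_def I_def)
  ultimately have "\<bar>chain_grad K T x j - chain_grad K T y j\<bar> \<le>
      R + 3 * R + ((4 * real K) * (8 * R) + 2 * (9 * R * K))" by linarith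
  also have "\<dots> = 4 * R + 50 * (R * K)" by (simp add: algebra_simps)
  also have "\<dots> \<le> 61 * (R * K)" using \<open>R \<le> R * K\<close> R0 by linarith
  finally have "\<bar>chain_grad K T x j - chain_grad K T y j\<bar> \<le> 61 * (R * K)" .
  then show ?thesis by (simp add: R_def mult.commute mult.left_commute)
qed (simp add: chain_grad_def sum_nonneg)

lemma square_sum_le_card_sum_squares:
  fixes f :: "'a \<Rightarrow> real"
  shows "(\<Sum>i\<in>I. f i)\<^sup>2 \<le> card I * (\<Sum>i\<in>I. (f i)\<^sup>2)"
  using Cauchy_Schwarz_ineq_sum[of "\<lambda>_. 1" f I] by simp

lemma enorm_sq: "(enorm d x)\<^sup>2 = (\<Sum>j<d. (x j)\<^sup>2)"
  by (simp add: enorm_def L2_set_def sum_nonneg)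

lemma enorm_nonneg [simp]: "0 \<le> enorm d x"
  by (simp add: enorm_def)

text \<open>The Schur test for a band matrix: the Cauchy-Schwarz inequality uses that a row of the
  band has at most \<open>2 * K + 1\<close> entries, the exchange of sums that a column has.\<close>

lemma enorm_banded_le:
  assumes v: "\<And>j. j \<ge> d \<Longrightarrow> v j = 0" and C: "C \<ge> 0"
    and u: "\<And>j. j < d \<Longrightarrow> \<bar>u j\<bar> \<le> C * (\<Sum>l\<in>{j-K..j+K}. \<bar>v l\<bar>)"
  shows "enorm d u \<le> C * (2 * K + 1) * enorm d v"
proof (rule power2_le_imp_le)
  have card: "card {j-K..j+K} \<le> 2 * K + 1" for j by simp
  have "(enorm d u)\<^sup>2 = (\<Sum>j<d. (u j)\<^sup>2)" by (rule enorm_sq)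
  also have "\<dots> \<le> (\<Sum>j<d. C\<^sup>2 * ((2 * K + 1) * (\<Sum>l\<in>{j-K..j+K}. (v l)\<^sup>2)))"
  proof (intro sum_mono)
    fix j assume "j \<in> {..<d}"
    then have "\<bar>u j\<bar>\<^sup>2 \<le> (C * (\<Sum>l\<in>{j-K..j+K}. \<bar>v l\<bar>))\<^sup>2" using u by (intro power_mono) auto
    also have "\<dots> \<le> C\<^sup>2 * (card {j-K..j+K} * (\<Sum>l\<in>{j-K..j+K}. \<bar>v l\<bar>\<^sup>2))"
      unfolding power_mult_distrib
      by (intro mult_left_mono square_sum_le_card_sum_squares) simp
    also have "\<dots> \<le> C\<^sup>2 * ((2 * K + 1) * (\<Sum>l\<in>{j-K..j+K}. \<bar>v l\<bar>\<^sup>2))"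
      using card[of j] by (intro mult_left_mono mult_right_mono of_nat_mono) (auto simp: sum_nonneg)
    finally show "(u j)\<^sup>2 \<le> C\<^sup>2 * ((2 * K + 1) * (\<Sum>l\<in>{j-K..j+K}. (v l)\<^sup>2))" by simp
  qed
  also have "\<dots> = C\<^sup>2 * (2 * K + 1) * (\<Sum>j<d. \<Sum>l\<in>{j-K..j+K}. (v l)\<^sup>2)"
    by (simp add: sum_distrib_left mult.assoc)
  also have "(\<Sum>j<d. \<Sum>l\<in>{j-K..j+K}. (v l)\<^sup>2) = (\<Sum>j<d. \<Sum>l | l \<in> {..<d} \<and> l \<in> {j-K..j+K}. (v l)\<^sup>2)"
  proof (intro sum.cong[OF refl] sum.mono_neutral_right ballI)
    fix j l assume "l \<in> {j-K..j+K} - {l \<in> {..<d}. l \<in> {j-K..j+K}}"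
    then show "(v l)\<^sup>2 = 0" using v[of l] by auto
  qed auto
  also have "\<dots> = (\<Sum>l<d. \<Sum>j | j \<in> {..<d} \<and> l \<in> {j-K..j+K}. (v l)\<^sup>2)"
    by (rule sum.swap_restrict) auto
  also have "\<dots> \<le> (\<Sum>l<d. (2 * K + 1) * (v l)\<^sup>2)"
  proof (intro sum_mono)
    fix l
    have "card {j \<in> {..<d}. l \<in> {j-K..j+K}} \<le> card {l-K..l+K}" by (intro card_mono) auto
    then have "card {j \<in> {..<d}. l \<in> {j-K..j+K}} \<le> 2 * K + 1" using card order_trans by blast
    then show "(\<Sum>j | j \<in> {..<d} \<and> l \<in> {j-K..j+K}. (v l)\<^sup>2) \<le> (2 * K + 1) * (v l)\<^sup>2"
      by (simp only: sum_constant) (intro mult_right_mono of_nat_mono, auto)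
  qed
  also have "(\<Sum>l<d. (2 * K + 1) * (v l)\<^sup>2) = (2 * K + 1) * (enorm d v)\<^sup>2"
    by (simp add: enorm_sq sum_distrib_left)
  finally have "(enorm d u)\<^sup>2 \<le> C\<^sup>2 * (2 * K + 1) * ((2 * K + 1) * (enorm d v)\<^sup>2)"
    by (simp add: mult_left_mono)
  also have "\<dots> = (C * (2 * K + 1) * enorm d v)\<^sup>2"
    by (simp add: power2_eq_square algebra_simps)
  finally show "(enorm d u)\<^sup>2 \<le> (C * (2 * K + 1) * enorm d v)\<^sup>2" .
qed (use C in simp)

text \<open>One factor \<open>K\<close> comes from the windows through a coordinate, the other from
  the width of the band; \<open>183 = 61 * 3\<close> as
  \<open>2 * K + 1 \<le> 3 * K\<close>.\<close>

lemma chain_grad_lipschitz: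
  assumes "K \<ge> 1" "x \<in> Rd d" "y \<in> Rd d"
  shows "enorm d (\<lambda>j. chain_grad K T x j - chain_grad K T y j)
    \<le> 183 * (real K)\<^sup>2 * enorm d (\<lambda>j. x j - y j)"
proof -
  have "enorm d (\<lambda>j. chain_grad K T x j - chain_grad K T y j)
      \<le> (61 * real K) * (2 * K + 1) * enorm d (\<lambda>j. x j - y j)"
    using assms by (intro enorm_banded_le chain_grad_component_lipschitz) (auto simp: Rd_def)
  also have "\<dots> \<le> 183 * (real K)\<^sup>2 * enorm d (\<lambda>j. x j - y j)"
  proof (intro mult_right_mono)
    have "real (2 * K + 1) \<le> 3 * K" using assms by simp
    then have "61 * real K * real (2 * K + 1) \<le> 61 * real K * (3 * K)" by (intro mult_left_mono) auto
    then show "61 * real K * real (2 * K + 1) \<le> 183 * (real K)\<^sup>2"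
      by (simp add: power2_eq_square algebra_simps)
  qed simp
  finally show ?thesis .
qed


text \<open>At a zero coordinate the penalty slope and \<open>gate'\<close> vanish, which leaves
  only the product over its own window.\<close>

lemma chain_grad_support:
  assumes "chain_grad K T x j \<noteq> 0"
  shows "j < T" "x j \<noteq> 0 \<or> {j-K..<j} \<subseteq> supp x"
proof -
  show "j < T" using assms by (auto simp: chain_grad_def split: if_splits)
  show "x j \<noteq> 0 \<or> {j-K..<j} \<subseteq> supp x"
  proof (cases "x j = 0")
    case True
    then have "(\<Prod>i\<in>{j-K..<j}. gate (x i)) \<noteq> 0"
      using assms by (auto simp: chain_grad_def split: if_splits)
    then have "gate (x i) \<noteq> 0" if "i \<in> {j-K..<j}" for i
      using that by (metis finite_atLeastLessThan prod_zero)
    then have "x i \<noteq> 0" if "i \<in> {j-K..<j}" for i using that by fastforce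
    then show ?thesis by (auto simp: supp_def)
  qed simp
qed

text \<open>Bounds the one component that the oracle makes noisy, and with it the variance.\<close>

lemma chain_grad_fresh_le_one:
  assumes "x j = 0" shows "\<bar>chain_grad K T x j\<bar> \<le> 1"
proof -
  have "gain' 0 * (\<Prod>i\<in>{j-K..<j}. gate (x i)) \<le> 1 * 1"
    by (intro mult_mono gain'_range gate_prod_range) simp
  then show ?thesis using assms
    by (simp add: chain_grad_def abs_mult gain'_range gate_prod_range)
qed

text \<open>At the first coordinate below 1 all terms of the partial derivative are nonpositive.\<close>

lemma chain_grad_large:
  assumes "j0 < T" "x j0 < 1"
  shows "\<exists>j<T. chain_grad K T x j \<le> - 1 / 2"
proof -
  define j where "j = (LEAST j. x j < 1)"
  have j: "x j < 1" unfolding j_def using assms(2) by (rule LeastI)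
  have "j \<le> j0" unfolding j_def using assms(2) by (rule Least_le)
  then have jT: "j < T" using assms(1) by simp
  have "x i \<ge> 1" if "i < j" for i using not_less_Least[OF that[unfolded j_def]] by simp
  then have prod1: "(\<Prod>i\<in>{j-K..<j}. gate (x i)) = 1" by (intro prod.neutral) (auto intro: gate_one)
  have "0 \<le> gate' (x j) * (\<Sum>i | i < T \<and> j \<in> {i-K..<i}. gain (x i) * (\<Prod>l\<in>{i-K..<i}-{j}. gate (x l)))"
    by (intro mult_nonneg_nonneg sum_nonneg gate'_range gain_range gate_prod_range)
  moreover have "min 0 (x j) - gain' (x j) \<le> - 1 / 2"
  proof (cases "x j < - 1")
    case True
    then show ?thesis using gain'_range(1)[of "x j"] by simp
  next
    case False
    then have "gain' (x j) \<ge> 1 / 2" using j by (intro gain'_ge_half) simp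
    then show ?thesis by (simp add: min_def)
  qed
  ultimately show ?thesis using jT by (intro exI[of _ j]) (simp add: chain_grad_def prod1)
qed

lemma chain_zero_le: "chain K T (\<lambda>_. 0) \<le> 0"
  unfolding chain_def by (intro sum_nonpos) (simp add: gain_range gate_prod_range)

lemma chain_ge: "chain K T x \<ge> - 4 * real T"
proof -
  have "gain (x j) * (\<Prod>i\<in>{j-K..<j}. gate (x i)) \<le> 4 * 1" for j
    by (intro mult_mono gain_range gate_prod_range) simp
  then have "(\<Sum>j<T. - 4) \<le> chain K T x"
    unfolding chain_def
    by (intro sum_mono) (smt (verit) pen_nonneg)
  then show ?thesis by simp
qed

section \<open>Gradients of functions on \<open>Rd d\<close>\<close>

lemma Rd_zero [simp]: "(\<lambda>_. 0) \<in> Rd d"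
  by (simp add: Rd_def)

lemma Rd_line: "x \<in> Rd d \<Longrightarrow> v \<in> Rd d \<Longrightarrow> (\<lambda>j. x j + s * v j) \<in> Rd d"
  by (simp add: Rd_def)

lemma enorm_cmult: "enorm d (\<lambda>j. c * x j) = \<bar>c\<bar> * enorm d x"
proof -
  have "enorm d (\<lambda>j. c * x j) = sqrt (c\<^sup>2 * (\<Sum>j<d. (x j)\<^sup>2))"
    by (simp add: enorm_def L2_set_def power_mult_distrib sum_distrib_left)
  then show ?thesis by (simp add: enorm_def L2_set_def real_sqrt_mult)
qed

lemma inner_le_enorm: "\<bar>\<Sum>j<d. x j * y j\<bar> \<le> enorm d x * enorm d y"
proof -
  have "\<bar>\<Sum>j<d. x j * y j\<bar> \<le> (\<Sum>j<d. \<bar>x j\<bar> * \<bar>y j\<bar>)"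
    by (rule order_trans[OF sum_abs]) (simp add: abs_mult)
  then show ?thesis unfolding enorm_def using L2_set_mult_ineq[of x y "{..<d}"] by linarith
qed

text \<open>By the mean value theorem on the segment, \<open>f y - f x\<close> is the directional
  derivative at an intermediate point, where \<open>g\<close> differs from \<open>g x\<close> by at
  most \<open>C\<close> times the distance.\<close>

lemma has_gradient_of_lipschitz:
  assumes x: "x \<in> Rd d" and C: "C \<ge> 0"
    and deriv: "\<And>v s. v \<in> Rd d \<Longrightarrow> ((\<lambda>s. f (\<lambda>j. x j + s * v j)) has_real_derivative
       (\<Sum>j<d. g (\<lambda>j. x j + s * v j) j * v j)) (at s)"
    and lip: "\<And>y. y \<in> Rd d \<Longrightarrow>
       enorm d (\<lambda>j. g y j - g x j) \<le> C * enorm d (\<lambda>j. y j - x j)"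
  shows "has_gradient d f (g x) x"
  unfolding has_gradient_def
proof (intro allI impI)
  fix e :: real assume e: "e > 0"
  show "\<exists>r>0. \<forall>y\<in>Rd d. enorm d (\<lambda>j. y j - x j) < r \<longrightarrow>
        \<bar>f y - f x - (\<Sum>j<d. g x j * (y j - x j))\<bar> \<le> e * enorm d (\<lambda>j. y j - x j)"
  proof (intro exI[of _ "e / (C + 1)"] conjI ballI impI)
    show "0 < e / (C + 1)" using e C by simp
    fix y assume y: "y \<in> Rd d" and r: "enorm d (\<lambda>j. y j - x j) < e / (C + 1)"
    define v where "v = (\<lambda>j. y j - x j)"
    have v: "v \<in> Rd d" using x y by (simp add: v_def Rd_def)
    define h where "h = (\<lambda>s. f (\<lambda>j. x j + s * v j))"
    have "\<exists>z>0. z < 1 \<and> h 1 - h 0 = (1 - 0) * (\<Sum>j<d. g (\<lambda>j. x j + z * v j) j * v j)"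
      unfolding h_def by (rule MVT2) (auto intro: deriv[OF v])
    then obtain z where z: "0 < z" "z < 1"
      and hz: "h 1 - h 0 = (\<Sum>j<d. g (\<lambda>j. x j + z * v j) j * v j)" by auto
    define w where "w = (\<lambda>j. x j + z * v j)"
    have w: "w \<in> Rd d" unfolding w_def by (rule Rd_line[OF x v])
    have "f y - f x = h 1 - h 0" by (simp add: h_def v_def)
    then have "f y - f x - (\<Sum>j<d. g x j * v j) = (\<Sum>j<d. (g w j - g x j) * v j)"
      by (simp add: hz w_def left_diff_distrib sum_subtractf)
    then have "\<bar>f y - f x - (\<Sum>j<d. g x j * v j)\<bar> \<le> enorm d (\<lambda>j. g w j - g x j) * enorm d v"
      by (simp add: inner_le_enorm)
    also have "\<dots> \<le> (C * (z * enorm d v)) * enorm d v"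
      using lip[OF w] enorm_cmult[of d z v] z
      by (intro mult_right_mono) (auto simp: w_def)
    also have "\<dots> \<le> e * enorm d v"
    proof (intro mult_right_mono)
      have "z * enorm d v \<le> enorm d v" using z by (simp add: mult_left_le_one_le)
      then have "C * (z * enorm d v) \<le> (C + 1) * enorm d v"
        using C z by (intro mult_mono) auto
      also have "\<dots> \<le> e" using r C by (simp add: v_def pos_less_divide_eq mult.commute)
      finally show "C * (z * enorm d v) \<le> e" .
    qed simp
    finally show "\<bar>f y - f x - (\<Sum>j<d. g x j * (y j - x j))\<bar> \<le> e * enorm d (\<lambda>j. y j - x j)"
      by (simp add: v_def)
  qed
qed

text \<open>Gives meaning to the definite description in \<open>grad\<close>. Testing both
  expansions on a short step along one axis isolates one component.\<close>

lemma has_gradient_unique: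
  assumes x: "x \<in> Rd d" and g: "g \<in> Rd d" "has_gradient d f g x"
    and g': "g' \<in> Rd d" "has_gradient d f g' x"
  shows "g = g'"
proof
  fix i
  show "g i = g' i"
  proof (cases "i < d")
    case False
    then show ?thesis using g(1) g'(1) by (simp add: Rd_def)
  next
    case True
    have "\<bar>g i - g' i\<bar> \<le> e" if e: "e > 0" for e
    proof -
      obtain r where r: "r > 0" and R: "\<And>y. y \<in> Rd d \<Longrightarrow> enorm d (\<lambda>j. y j - x j) < r \<Longrightarrow>
          \<bar>f y - f x - (\<Sum>j<d. g j * (y j - x j))\<bar> \<le> e / 2 * enorm d (\<lambda>j. y j - x j)"
        using g(2)[unfolded has_gradient_def, rule_format, of "e/2"] e by auto
      obtain r' where r': "r' > 0" and R': "\<And>y. y \<in> Rd d \<Longrightarrow> enorm d (\<lambda>j. y j - x j) < r' \<Longrightarrow>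
          \<bar>f y - f x - (\<Sum>j<d. g' j * (y j - x j))\<bar> \<le> e / 2 * enorm d (\<lambda>j. y j - x j)"
        using g'(2)[unfolded has_gradient_def, rule_format, of "e/2"] e by auto
      define s where "s = min r r' / 2"
      have s: "s > 0" "s < r" "s < r'" using r r' by (auto simp: s_def min_def)
      define y where "y = (\<lambda>j. x j + (if j = i then s else 0))"
      have y: "y \<in> Rd d" using x True by (auto simp: y_def Rd_def)
      have diff: "(\<lambda>j. y j - x j) = (\<lambda>j. if j = i then s else 0)" by (auto simp: y_def)
      have norm: "enorm d (\<lambda>j. y j - x j) = s"
        using True s by (simp add: diff enorm_def L2_set_def if_distrib[of "\<lambda>x. x\<^sup>2"] sum.delta cong: if_cong)
      have "(\<Sum>j<d. a j * (y j - x j)) = a i * s" for a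
        using True by (simp add: fun_cong[OF diff] if_distrib sum.delta cong: if_cong)
      then have "\<bar>f y - f x - g i * s\<bar> \<le> e / 2 * s" "\<bar>f y - f x - g' i * s\<bar> \<le> e / 2 * s"
        using R[OF y] R'[OF y] s by (auto simp: norm)
      then have "\<bar>g i * s - g' i * s\<bar> \<le> e * s" by linarith
      then have "\<bar>g i - g' i\<bar> * s \<le> e * s"
        using s by (simp add: left_diff_distrib[symmetric] abs_mult)
      then show ?thesis using s by simp
    qed
    then have "\<bar>g i - g' i\<bar> \<le> 0" by (rule field_le_epsilon) auto
    then show ?thesis by simp
  qed
qed

lemma grad_eq:
  assumes "x \<in> Rd d" "g \<in> Rd d" "has_gradient d f g x"
  shows "grad d f x = g"
  unfolding grad_def using assms has_gradient_unique by blast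

section \<open>The hard objective and its noisy gradients\<close>

text \<open>The two scales are set independently: the size of the gradient is proportional to
  \<open>\<beta>\<close>, its Lipschitz constant to \<open>\<beta> / r\<close>, and the gap to
  \<open>\<beta> * r\<close>.\<close>

definition obj :: "nat \<Rightarrow> nat \<Rightarrow> real \<Rightarrow> real \<Rightarrow> point \<Rightarrow> real" where
  "obj K T \<beta> r x = \<beta> * r * chain K T (\<lambda>j. x j / r)"

definition obj_grad :: "nat \<Rightarrow> nat \<Rightarrow> real \<Rightarrow> real \<Rightarrow> point \<Rightarrow> point" where
  "obj_grad K T \<beta> r x j = \<beta> * chain_grad K T (\<lambda>j. x j / r) j"

text \<open>
  Only the front is made noisy, as it is the only coordinate whose discovery can extend the last
  full window. It is \<open>T\<close>, which is not a coordinate of the chain, once that window ends at \<open>T\<close>.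
\<close>

definition front :: "nat \<Rightarrow> nat \<Rightarrow> nat set \<Rightarrow> nat" where
  "front K T S = Max {j. j \<le> T \<and> {j-K..<j} \<subseteq> S}"

definition obj_oracle :: "nat \<Rightarrow> nat \<Rightarrow> real \<Rightarrow> real \<Rightarrow> real \<Rightarrow> point \<Rightarrow> real \<Rightarrow> point" where
  "obj_oracle K T \<beta> r q x z j =
     obj_grad K T \<beta> r x j * (if j = front K T (supp x) then z / q else 1)"

text \<open>Divided by \<open>q\<close>, the draw has mean 1, which makes \<open>obj_oracle\<close>
  unbiased, and variance \<open>1 / q - 1\<close>.\<close>

definition coin :: "real \<Rightarrow> real measure" where
  "coin q = distr (measure_pmf (bernoulli_pmf q)) borel of_bool"

lemma front_ge: "j \<le> T \<Longrightarrow> {j-K..<j} \<subseteq> S \<Longrightarrow> j \<le> front K T S"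
  unfolding front_def by (rule Max_ge) auto

lemma front_props: "front K T S \<le> T" "{front K T S - K..<front K T S} \<subseteq> S"
proof -
  have "front K T S \<in> {j. j \<le> T \<and> {j-K..<j} \<subseteq> S}"
    unfolding front_def by (rule Max_in) (auto intro: exI[of _ 0])
  then show "front K T S \<le> T" "{front K T S - K..<front K T S} \<subseteq> S" by auto
qed

text \<open>If the front were in \<open>S\<close>, the window ending just after it would be full as
  well, against maximality.\<close>

lemma front_notin: "front K T S < T \<Longrightarrow> front K T S \<notin> S"
proof
  assume a: "front K T S < T" "front K T S \<in> S"
  have "Suc (front K T S) \<le> front K T S"
  proof (rule front_ge)
    have "{Suc (front K T S) - K..<Suc (front K T S)} \<subseteq>
        insert (front K T S) {front K T S - K..<front K T S}" by auto
    also have "\<dots> \<subseteq> S" using a(2) front_props(2) by blast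
    finally show "{Suc (front K T S) - K..<Suc (front K T S)} \<subseteq> S" .
  qed (use a in simp)
  then show False by simp
qed

lemma obj_grad_Rd: "T \<le> d \<Longrightarrow> obj_grad K T \<beta> r x \<in> Rd d"
  by (simp add: obj_grad_def Rd_def chain_grad_def)

lemma obj_oracle_Rd: "T \<le> d \<Longrightarrow> obj_oracle K T \<beta> r q x z \<in> Rd d"
  using obj_grad_Rd[of T d K \<beta> r x] by (simp add: obj_oracle_def Rd_def)

lemma supp_scale: "r \<noteq> 0 \<Longrightarrow> supp (\<lambda>j. x j / r) = supp x"
  by (simp add: supp_def)

lemma obj_oracle_support:
  assumes "r \<noteq> 0" "obj_oracle K T \<beta> r q x z j \<noteq> 0"
  shows "j < T" "j \<in> supp x \<or> ({j-K..<j} \<subseteq> supp x \<and> (j = front K T (supp x) \<longrightarrow> z \<noteq> 0))"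
proof -
  have "chain_grad K T (\<lambda>j. x j / r) j \<noteq> 0"
    using assms by (auto simp: obj_oracle_def obj_grad_def)
  from chain_grad_support[OF this] assms(1)
  have *: "j < T" "j \<in> supp x \<or> {j-K..<j} \<subseteq> supp x"
    by (auto simp: supp_scale) (auto simp: supp_def)
  show "j < T" by (rule *)
  show "j \<in> supp x \<or> ({j-K..<j} \<subseteq> supp x \<and> (j = front K T (supp x) \<longrightarrow> z \<noteq> 0))"
    using * assms(2) by (auto simp: obj_oracle_def)
qed

lemma obj_grad_lipschitz:
  assumes "K \<ge> 1" "r > 0" "\<beta> \<ge> 0" "x \<in> Rd d" "y \<in> Rd d"
  shows "enorm d (\<lambda>j. obj_grad K T \<beta> r x j - obj_grad K T \<beta> r y j)
    \<le> \<beta> * (183 * (real K)\<^sup>2) / r * enorm d (\<lambda>j. x j - y j)"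
proof -
  have "enorm d (\<lambda>j. obj_grad K T \<beta> r x j - obj_grad K T \<beta> r y j) =
      \<beta> * enorm d (\<lambda>j. chain_grad K T (\<lambda>j. x j / r) j - chain_grad K T (\<lambda>j. y j / r) j)"
    using assms(3) by (simp add: obj_grad_def right_diff_distrib[symmetric] enorm_cmult)
  also have "\<dots> \<le> \<beta> * (183 * (real K)\<^sup>2 * enorm d (\<lambda>j. x j / r - y j / r))"
    using assms by (intro mult_left_mono chain_grad_lipschitz) (auto simp: Rd_def)
  also have "(\<lambda>j. x j / r - y j / r) = (\<lambda>j. (1 / r) * (x j - y j))"
    by (simp add: diff_divide_distrib)
  also have "\<beta> * (183 * (real K)\<^sup>2 * enorm d (\<lambda>j. (1 / r) * (x j - y j))) =
      \<beta> * (183 * (real K)\<^sup>2) / r * enorm d (\<lambda>j. x j - y j)"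
    using assms(2) by (subst enorm_cmult) simp
  finally show ?thesis .
qed

lemma obj_has_gradient:
  assumes "K \<ge> 1" "r > 0" "\<beta> \<ge> 0" "T \<le> d" "x \<in> Rd d"
  shows "has_gradient d (obj K T \<beta> r) (obj_grad K T \<beta> r x) x"
proof (rule has_gradient_of_lipschitz)
  fix v s
  have "((\<lambda>s. \<beta> * r * chain K T (\<lambda>j. x j / r + s * (v j / r))) has_real_derivative
      \<beta> * r * (\<Sum>j<T. chain_grad K T (\<lambda>j. x j / r + s * (v j / r)) j * (v j / r))) (at s)"
    by (intro DERIV_cmult chain_line_DERIV)
  moreover have "(\<lambda>j. x j / r + s * (v j / r)) = (\<lambda>j. (x j + s * v j) / r)" for s
    by (simp add: add_divide_distrib)
  moreover have "(\<Sum>j<d. obj_grad K T \<beta> r (\<lambda>j. x j + s * v j) j * v j) =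
      (\<Sum>j<T. obj_grad K T \<beta> r (\<lambda>j. x j + s * v j) j * v j)"
    using assms(4) by (intro sum.mono_neutral_right) (auto simp: obj_grad_def chain_grad_def)
  ultimately show "((\<lambda>s. obj K T \<beta> r (\<lambda>j. x j + s * v j)) has_real_derivative
      (\<Sum>j<d. obj_grad K T \<beta> r (\<lambda>j. x j + s * v j) j * v j)) (at s)"
    using assms(2) by (simp add: obj_def obj_grad_def sum_distrib_left mult.assoc)
next
  fix y assume "y \<in> Rd d"
  then show "enorm d (\<lambda>j. obj_grad K T \<beta> r y j - obj_grad K T \<beta> r x j)
      \<le> \<beta> * (183 * (real K)\<^sup>2) / r * enorm d (\<lambda>j. y j - x j)"
    using assms by (intro obj_grad_lipschitz)
qed (use assms in auto)

lemma grad_obj: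
  assumes "K \<ge> 1" "r > 0" "\<beta> \<ge> 0" "T \<le> d" "x \<in> Rd d"
  shows "grad d (obj K T \<beta> r) x = obj_grad K T \<beta> r x"
  using assms by (intro grad_eq obj_grad_Rd obj_has_gradient)

lemma obj_smooth:
  assumes "K \<ge> 1" "r > 0" "\<beta> \<ge> 0" "T \<le> d" "\<beta> * (183 * (real K)\<^sup>2) / r \<le> L"
  shows "smooth d L (obj K T \<beta> r)"
  unfolding smooth_def
proof (intro conjI ballI)
  fix x assume "x \<in> Rd d"
  then show "\<exists>g. has_gradient d (obj K T \<beta> r) g x"
    using obj_has_gradient assms by blast
next
  fix x y assume xy: "x \<in> Rd d" "y \<in> Rd d"
  have "enorm d (\<lambda>j. obj_grad K T \<beta> r x j - obj_grad K T \<beta> r y j)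
      \<le> \<beta> * (183 * (real K)\<^sup>2) / r * enorm d (\<lambda>j. x j - y j)"
    using assms xy by (intro obj_grad_lipschitz)
  also have "\<dots> \<le> L * enorm d (\<lambda>j. x j - y j)"
    using assms(5) by (intro mult_right_mono) auto
  finally show "enorm d (\<lambda>j. grad d (obj K T \<beta> r) x j - grad d (obj K T \<beta> r) y j)
      \<le> L * enorm d (\<lambda>j. x j - y j)"
    using assms xy by (simp add: grad_obj)
qed

lemma obj_gap:
  assumes "r > 0" "\<beta> \<ge> 0" "4 * \<beta> * r * real T \<le> \<Delta>"
  shows "gap_le d (obj K T \<beta> r) \<Delta>"
proof -
  have ge: "- \<Delta> \<le> obj K T \<beta> r x" for x
  proof -
    have "\<beta> * r * (- 4 * real T) \<le> obj K T \<beta> r x"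
      unfolding obj_def using assms by (intro mult_left_mono chain_ge) auto
    then show ?thesis using assms(3) by (simp add: mult_ac)
  qed
  have "bdd_below (obj K T \<beta> r ` Rd d)" by (rule bdd_belowI2[OF ge])
  moreover have "- \<Delta> \<le> (INF x\<in>Rd d. obj K T \<beta> r x)"
    using Rd_zero[of d] by (intro cINF_greatest ge) blast
  moreover have "obj K T \<beta> r (\<lambda>_. 0) \<le> 0"
    unfolding obj_def using assms chain_zero_le[of K T] by (simp add: mult_nonneg_nonpos)
  ultimately show ?thesis by (simp add: gap_le_def)
qed

lemma obj_grad_large:
  assumes "T \<le> d" "j0 < T" "x j0 = 0" "\<beta> \<ge> 0"
  shows "\<beta>\<^sup>2 / 4 \<le> (enorm d (obj_grad K T \<beta> r x))\<^sup>2"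
proof -
  obtain j where j: "j < T" "chain_grad K T (\<lambda>j. x j / r) j \<le> - 1 / 2"
    using chain_grad_large[of j0 T "\<lambda>j. x j / r" K] assms by auto
  have "(1 / 2)\<^sup>2 \<le> (- chain_grad K T (\<lambda>j. x j / r) j)\<^sup>2"
    using j(2) by (intro power_mono) auto
  then have "\<beta>\<^sup>2 * (1 / 4) \<le> \<beta>\<^sup>2 * (chain_grad K T (\<lambda>j. x j / r) j)\<^sup>2"
    by (intro mult_left_mono) (auto simp: power2_eq_square)
  also have "\<dots> = (obj_grad K T \<beta> r x j)\<^sup>2" by (simp add: obj_grad_def power_mult_distrib)
  also have "\<dots> \<le> (\<Sum>j<d. (obj_grad K T \<beta> r x j)\<^sup>2)"
    using j(1) assms(1) by (intro member_le_sum) auto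
  finally show ?thesis by (simp add: enorm_sq)
qed

section \<open>Bias and variance of the oracle\<close>

lemma prob_space_coin: "prob_space (coin q)"
  unfolding coin_def by (rule prob_space.prob_space_distr[OF prob_space_measure_pmf]) simp

lemma sets_coin [measurable_cong, simp]: "sets (coin q) = sets borel"
  by (simp add: coin_def)

lemma space_coin [simp]: "space (coin q) = UNIV"
  by (simp add: coin_def)

lemma coin_integral:
  assumes "0 \<le> q" "q \<le> 1" and [measurable]: "g \<in> borel_measurable borel"
  shows "integrable (coin q) g" "(\<integral>z. g z \<partial>coin q) = q * g 1 + (1 - q) * (g 0 :: real)"
proof -
  have "finite (set_pmf (bernoulli_pmf q))" by (rule finite_subset[OF subset_UNIV]) simp
  then show "integrable (coin q) g"
    unfolding coin_def by (subst integrable_distr_eq) (auto intro: integrable_measure_pmf_finite)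
  show "(\<integral>z. g z \<partial>coin q) = q * g 1 + (1 - q) * g 0"
    unfolding coin_def using assms by (subst integral_distr) auto
qed

lemma coin_nn_integral:
  assumes "0 \<le> q" "q \<le> 1" and [measurable]: "g \<in> borel_measurable borel"
  shows "(\<integral>\<^sup>+z. g z \<partial>coin q) = ennreal q * g 1 + ennreal (1 - q) * g 0"
  unfolding coin_def using assms by (subst nn_integral_distr) (auto simp: mult.commute)

lemma obj_gradient_oracle:
  assumes "K \<ge> 1" "r > 0" "\<beta> \<ge> 0" "T \<le> d" and q: "0 < q" "q \<le> 1" and v: "\<beta>\<^sup>2 * (1 / q - 1) \<le> v"
  shows "gradient_oracle d (obj K T \<beta> r) v (coin q) (obj_oracle K T \<beta> r q)"
  unfolding gradient_oracle_def
proof (intro conjI ballI allI impI prob_space_coin sets_coin)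
  fix x assume x: "x \<in> Rd d"
  let ?g = "obj_grad K T \<beta> r x" and ?G = "obj_oracle K T \<beta> r q x" and ?J = "front K T (supp x)"
  have grad: "grad d (obj K T \<beta> r) x = ?g" using grad_obj assms x by blast
  have v0: "v \<ge> 0"
  proof -
    have "0 \<le> \<beta>\<^sup>2 * (1 / q - 1)" using q by simp
    then show ?thesis using v by linarith
  qed
  show "?G z \<in> Rd d" for z by (rule obj_oracle_Rd[OF assms(4)])
  fix j
  show "integrable (coin q) (\<lambda>z. ?G z j)"
    unfolding obj_oracle_def using q by (intro coin_integral) auto
  show "(\<integral>z. ?G z j \<partial>coin q) = grad d (obj K T \<beta> r) x j"
    unfolding grad obj_oracle_def using q by (subst coin_integral) (auto simp: algebra_simps)
next
  fix x assume x: "x \<in> Rd d"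
  let ?g = "obj_grad K T \<beta> r x" and ?G = "obj_oracle K T \<beta> r q x" and ?J = "front K T (supp x)"
  have grad: "grad d (obj K T \<beta> r) x = ?g" using grad_obj assms x by blast
  have eq: "(enorm d (\<lambda>j. ?G z j - grad d (obj K T \<beta> r) x j))\<^sup>2 =
      (if ?J < d then (?g ?J)\<^sup>2 else 0) * (z / q - 1)\<^sup>2" for z
  proof -
    have "(enorm d (\<lambda>j. ?G z j - grad d (obj K T \<beta> r) x j))\<^sup>2 =
        (\<Sum>j<d. if j = ?J then (?g ?J)\<^sup>2 * (z / q - 1)\<^sup>2 else 0)"
      unfolding enorm_sq grad
      by (intro sum.cong) (auto simp: obj_oracle_def power_mult_distrib[symmetric] algebra_simps)
    then show ?thesis by (simp add: sum.delta)
  qed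
  show "integrable (coin q) (\<lambda>z. (enorm d (\<lambda>j. ?G z j - grad d (obj K T \<beta> r) x j))\<^sup>2)"
    unfolding eq using q by (intro coin_integral) auto
  \<comment> \<open>A front below \<open>T\<close> is a zero coordinate of \<open>x\<close>, so the
    bound for fresh coordinates applies; at \<open>T\<close> the component is 0.\<close>
  have "\<bar>?g ?J\<bar> \<le> \<beta>"
  proof (cases "?J < T")
    case True
    then have "x ?J = 0" using front_notin[of K T "supp x"] by (simp add: supp_def)
    then show ?thesis
      using chain_grad_fresh_le_one[of "\<lambda>j. x j / r" ?J K T] assms(3)
      by (simp add: obj_grad_def abs_mult mult_left_le)
  qed (simp add: obj_grad_def chain_grad_def assms)
  then have "\<bar>?g ?J\<bar>\<^sup>2 \<le> \<beta>\<^sup>2" by (intro power_mono) auto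
  then have g: "(if ?J < d then (?g ?J)\<^sup>2 else 0) \<le> \<beta>\<^sup>2" by simp
  have "(\<integral>z. (enorm d (\<lambda>j. ?G z j - grad d (obj K T \<beta> r) x j))\<^sup>2 \<partial>coin q) =
      (if ?J < d then (?g ?J)\<^sup>2 else 0) * (q * (1 / q - 1)\<^sup>2 + (1 - q))"
    unfolding eq using q by (subst coin_integral) (simp_all add: algebra_simps)
  also have "q * (1 / q - 1)\<^sup>2 + (1 - q) = 1 / q - 1"
    using q by (simp add: field_simps power2_eq_square)
  also have "(if ?J < d then (?g ?J)\<^sup>2 else 0) * (1 / q - 1) \<le> \<beta>\<^sup>2 * (1 / q - 1)"
    using g q by (intro mult_right_mono) auto
  finally show "(\<integral>z. (enorm d (\<lambda>j. ?G z j - grad d (obj K T \<beta> r) x j))\<^sup>2 \<partial>coin q) \<le> v"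
    using v by linarith
qed

section \<open>Progress of a run\<close>

definition know :: "protocol \<Rightarrow> transcript \<Rightarrow> nat \<Rightarrow> real \<Rightarrow> nat set" where
  "know p tr i s = (\<Union>y\<in>worker_info p tr i s. supp y)"

lemma know_mono: "s \<le> s' \<Longrightarrow> know p tr i s \<subseteq> know p tr i s'"
proof -
  assume "s \<le> s'"
  then have "worker_info p tr i s \<subseteq> worker_info p tr i s'"
    unfolding worker_info_def using order_trans by blast
  then show ?thesis unfolding know_def by (rule UN_mono) simp
qed

lemma supp_worker_view:
  assumes "worker_view p tr i s = (V, W)"
  shows "(\<Union>l. supp (V l)) \<union> (\<Union>l. supp (W l)) \<subseteq> know p tr i s"
proof -
  have V: "V = (\<lambda>k. if real (Suc k) * grad_time p \<le> s then grads tr i k else (\<lambda>_. 0))"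
    and W: "W = (\<lambda>k. if down_time p i (Suc k) \<le> s then downs tr i k else (\<lambda>_. 0))"
    using assms by (auto simp: worker_view_def)
  have "supp (V l) \<subseteq> know p tr i s" for l
  proof (cases "real (Suc l) * grad_time p \<le> s")
    case True
    then have "grads tr i l \<in> worker_info p tr i s" by (auto simp: worker_info_def)
    then show ?thesis using True by (auto simp: know_def V)
  qed (auto simp: V supp_def)
  moreover have "supp (W l) \<subseteq> know p tr i s" for l
  proof (cases "down_time p i (Suc l) \<le> s")
    case True
    then have "downs tr i l \<in> worker_info p tr i s" by (auto simp: worker_info_def)
    then show ?thesis using True by (auto simp: know_def W)
  qed (auto simp: W supp_def)
  ultimately show ?thesis by blast
qed

lemma supp_query:
  assumes "zero_respecting A"
  shows "supp (query A i k (u, worker_view p tr i s)) \<subseteq> know p tr i s"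
    and "supp (to_server A i k (u, worker_view p tr i s)) \<subseteq> know p tr i s"
proof -
  obtain V W where VW: "worker_view p tr i s = (V, W)" by fastforce
  note sub = supp_worker_view[OF VW]
  show "supp (query A i k (u, worker_view p tr i s)) \<subseteq> know p tr i s"
    and "supp (to_server A i k (u, worker_view p tr i s)) \<subseteq> know p tr i s"
    using assms sub unfolding VW zero_respecting_def by (meson order_trans)+
qed

lemma down_time_Suc: "down_time p i (Suc k) = down_time p i k + down_coord_time p * down_size p i k"
  by (simp add: down_time_def algebra_simps)

lemma up_time_Suc: "up_time p i (Suc k) = up_time p i k + up_coord_time p * up_size p i k"
  by (simp add: up_time_def algebra_simps)

lemma down_time_mono: "down_coord_time p > 0 \<Longrightarrow> k \<le> l \<Longrightarrow> down_time p i k \<le> down_time p i l"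
  unfolding down_time_def by (intro mult_left_mono of_nat_mono sum_mono2) auto

section \<open>The flow of knowledge in a run\<close>

locale timed_protocol =
  fixes p :: protocol
  assumes valid: "valid_protocol p"
    and workers_pos: "workers p \<ge> 1"
    and grad_time_pos: "grad_time p > 0"
    and down_time_pos: "down_coord_time p > 0"
    and up_time_pos: "up_coord_time p > 0"

locale run = timed_protocol +
  fixes A :: algorithm and G :: "point \<Rightarrow> real \<Rightarrow> point"
    and u :: seed and \<xi> :: "nat \<times> nat \<Rightarrow> real" and R :: "nat \<times> nat \<Rightarrow> nat set"
    and tr :: transcript
  assumes zr: "zero_respecting A"
    and G_Rd: "\<And>x z. G x z \<in> Rd (dim p)"
    and R: "\<And>i k. i < workers p \<Longrightarrow> R (i, k) \<in> size_subsets (dim p) (down_size p i k)"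
    and is_run: "is_run p A G (u, \<xi>, R) tr"
begin

lemma grads_eq: "i < workers p \<Longrightarrow>
    grads tr i k = G (query A i k (u, worker_view p tr i (real k * grad_time p))) (\<xi> (i, k))"
  and ups_eq: "i < workers p \<Longrightarrow>
    ups tr i k = up_comp p i k (u, to_server A i k (u, worker_view p tr i (up_time p i k)))"
  and downs_eq: "i < workers p \<Longrightarrow> downs tr i k = (\<lambda>j. if j \<in> R (i, k)
     then down_scale p i k j * to_worker A i k (u, server_view p tr (down_time p i k)) j else 0)"
  using is_run by simp_all

lemma know_less_dim:
  assumes "i < workers p" shows "know p tr i s \<subseteq> {..<dim p}"
proof -
  have "supp (grads tr i k) \<subseteq> {..<dim p}" for k
    using G_Rd by (auto simp: grads_eq[OF assms] Rd_def supp_def not_le[symmetric])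
  moreover have "supp (downs tr i k) \<subseteq> {..<dim p}" for k
    using R[OF assms, of k] by (auto simp: downs_eq[OF assms] supp_def size_subsets_def split: if_splits)
  ultimately show ?thesis by (auto simp: know_def worker_info_def)
qed

lemma to_server_Rd:
  assumes "i < workers p"
  shows "to_server A i k (u, worker_view p tr i s) \<in> Rd (dim p)"
proof -
  have "supp (to_server A i k (u, worker_view p tr i s)) \<subseteq> {..<dim p}"
    using supp_query(2)[OF zr] know_less_dim[OF assms] by (rule order_trans)
  then show ?thesis by (fastforce simp: Rd_def supp_def)
qed

lemma ups_mask:
  assumes "i < workers p"
  obtains B a where "B \<subseteq> {..<dim p}" "card B = up_size p i k"
    "ups tr i k = (\<lambda>j. if j \<in> B then a j * to_server A i k (u, worker_view p tr i (up_time p i k)) j else 0)"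
proof -
  have "\<exists>B a. B \<subseteq> {..<dim p} \<and> card B = up_size p i k \<and>
      up_comp p i k (u, x) = (\<lambda>j. if j \<in> B then a j * x j else 0)" if "x \<in> Rd (dim p)" for x
    using valid assms that unfolding valid_protocol_def by blast
  from this[OF to_server_Rd[OF assms, of k "up_time p i k"]] show ?thesis
    using that unfolding ups_eq[OF assms] by blast
qed

lemma supp_ups:
  assumes "i < workers p"
  shows "supp (ups tr i k) \<subseteq> know p tr i (up_time p i k)"
proof -
  obtain B a where "ups tr i k =
      (\<lambda>j. if j \<in> B then a j * to_server A i k (u, worker_view p tr i (up_time p i k)) j else 0)"
    using ups_mask[OF assms] by metis
  then have "supp (ups tr i k) \<subseteq> supp (to_server A i k (u, worker_view p tr i (up_time p i k)))"
    by (auto simp: supp_def)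
  then show ?thesis using supp_query(2)[OF zr] by blast
qed

text \<open>An empty message takes no time, so an induction over time cannot place its input in an
  earlier cell. Being the zero vector, it does no harm.\<close>

lemma ups_zero:
  assumes "i < workers p" "up_size p i k = 0"
  shows "ups tr i k = (\<lambda>_. 0)"
proof -
  obtain B a where B: "B \<subseteq> {..<dim p}" "card B = up_size p i k" "ups tr i k =
      (\<lambda>j. if j \<in> B then a j * to_server A i k (u, worker_view p tr i (up_time p i k)) j else 0)"
    using ups_mask[OF assms(1)] by metis
  then have "B = {}" using assms(2) finite_subset[OF B(1)] by simp
  then show ?thesis by (simp add: B(3))
qed

lemma R_zero: "i < workers p \<Longrightarrow> down_size p i k = 0 \<Longrightarrow> R (i, k) = {}"
  using R[of i k] finite_subset[of "R (i, k)" "{..<dim p}"] by (auto simp: size_subsets_def)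

lemma downs_zero: "i < workers p \<Longrightarrow> down_size p i k = 0 \<Longrightarrow> downs tr i k = (\<lambda>_. 0)"
  by (simp add: downs_eq R_zero)

text \<open>An upload only carries what its sender knew when it started. Hence bounds on the
  knowledge of the workers cover the server too.\<close>

lemma supp_ups_known:
  assumes "i < workers p" "up_time p i (Suc k) \<le> s"
  shows "supp (ups tr i k) \<subseteq> (\<Union>i<workers p. know p tr i s)"
proof -
  have "up_time p i k \<le> s" using assms(2) up_time_pos unfolding up_time_Suc
    by (smt (verit) mult_nonneg_nonneg of_nat_0_le_iff)
  then show ?thesis using supp_ups[OF assms(1), of k] know_mono[of _ s p tr i] assms(1) by blast
qed

lemma supp_server_info: "(\<Union>y\<in>server_info p tr s. supp y) \<subseteq> (\<Union>i<workers p. know p tr i s)"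
proof (rule UN_least)
  fix y assume "y \<in> server_info p tr s"
  then obtain i k where "y = ups tr i k" "i < workers p" "up_time p i (Suc k) \<le> s"
    by (auto simp: server_info_def)
  then show "supp y \<subseteq> (\<Union>i<workers p. know p tr i s)" using supp_ups_known by simp
qed

lemma supp_server_view: "(\<Union>i k. supp (server_view p tr s i k)) \<subseteq> (\<Union>i<workers p. know p tr i s)"
proof -
  have "supp (server_view p tr s i k) \<subseteq> (\<Union>i<workers p. know p tr i s)" for i k
    using supp_ups_known[of i k s]
    by (cases "i < workers p \<and> up_time p i (Suc k) \<le> s") (auto simp: server_view_def supp_def)
  then show ?thesis by blast
qed

text \<open>The subset limits what is new inside the current block; the second set rules out
  coordinates beyond it.\<close>

lemma supp_downs:
  assumes "i < workers p"
  shows "supp (downs tr i k) \<subseteq> R (i, k) \<inter> (\<Union>j<workers p. know p tr j (down_time p i k))"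
proof -
  have 1: "supp (to_worker A i k (u, server_view p tr (down_time p i k))) \<subseteq>
      (\<Union>i' l. supp (server_view p tr (down_time p i k) i' l))"
    using zr by (simp add: zero_respecting_def)
  have 2: "supp (downs tr i k) \<subseteq>
      R (i, k) \<inter> supp (to_worker A i k (u, server_view p tr (down_time p i k)))"
    by (auto simp: downs_eq[OF assms] supp_def)
  have "supp (to_worker A i k (u, server_view p tr (down_time p i k))) \<subseteq>
      (\<Union>j<workers p. know p tr j (down_time p i k))"
    using 1 supp_server_view[of "down_time p i k"] by (rule order_trans)
  then have "R (i, k) \<inter> supp (to_worker A i k (u, server_view p tr (down_time p i k))) \<subseteq>
      R (i, k) \<inter> (\<Union>j<workers p. know p tr j (down_time p i k))"
    by (rule Int_mono[OF order_refl])
  with 2 show ?thesis by (rule order_trans)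
qed

lemma constructible_known:
  assumes "y \<in> constructible p tr t"
  shows "supp y \<subseteq> (\<Union>i<workers p. know p tr i t)"
proof -
  have "supp y \<subseteq> (\<Union>z\<in>server_info p tr t. supp z) \<or> (\<exists>i<workers p. supp y \<subseteq> know p tr i t)"
    using assms by (simp add: constructible_def know_def)
  then show ?thesis using supp_server_info[of t] by (elim disjE) blast+
qed

end

text \<open>
  Time is cut into cells of length \<open>\<delta>\<close>, in each of which a worker starts at most one computation
  and is sent at most one nonempty message, and \<open>m\<close> cells form a phase. The windows and the blocks
  of coordinates have length \<open>8 * Q\<close>.
\<close>

locale schedule = timed_protocol +
  fixes Q m :: nat and \<delta> q :: real
  assumes Q: "Q \<ge> 4" and m: "m \<ge> 1" and \<delta>_pos: "\<delta> > 0"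
    and \<delta>_grad: "\<delta> \<le> grad_time p" and \<delta>_down: "\<delta> \<le> down_coord_time p"
    and phase_down: "32 * (m * \<delta>) \<le> down_coord_time p * dim p"
    and phase_grad: "4 * q * (m * \<delta>) \<le> Q * grad_time p"
    and q: "0 < q" "q \<le> 1"
    and workers_le: "workers p \<le> 2 ^ Q"
begin

definition in_cell :: "nat \<Rightarrow> real \<Rightarrow> bool" where
  "in_cell N s \<longleftrightarrow> N * \<delta> \<le> s \<and> s < Suc N * \<delta>"

definition small :: "nat \<Rightarrow> nat \<Rightarrow> bool" where
  "small i k \<longleftrightarrow> 0 < down_size p i k \<and> 32 * down_size p i k \<le> dim p"

definition msgs :: "nat \<Rightarrow> nat \<Rightarrow> nat set" where
  "msgs i N = {k. small i k \<and> in_cell N (down_time p i k)}"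

definition comps :: "nat \<Rightarrow> nat set" where
  "comps N = {k. in_cell N (k * grad_time p)}"

definition block :: "nat \<Rightarrow> nat set" where
  "block b = {8 * Q * b..<8 * Q * Suc b}"

definition hits :: "nat \<Rightarrow> nat \<Rightarrow> nat \<Rightarrow> outcome \<Rightarrow> nat" where
  "hits i N b \<omega> = (\<Sum>k\<in>msgs i N. card (snd (snd \<omega>) (i, k) \<inter> block b))"

definition wins :: "nat \<Rightarrow> nat \<Rightarrow> outcome \<Rightarrow> nat" where
  "wins i N \<omega> = (\<Sum>k\<in>comps N. of_bool (fst (snd \<omega>) (i, k) \<noteq> 0))"

text \<open>
  The level, and for each worker the coordinates of the current block it was sent and the
  successful draws it made since the level was reached. At the end of a phase the level rises for
  free. This accounts for the messages that are not small, as they take longer than a phase.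
\<close>

primrec state :: "nat \<Rightarrow> outcome \<Rightarrow> nat \<times> (nat \<Rightarrow> nat) \<times> (nat \<Rightarrow> nat)" where
  "state 0 \<omega> = (0, \<lambda>_. 0, \<lambda>_. 0)"
| "state (Suc N) \<omega> = (case state N \<omega> of (b, D, S) \<Rightarrow>
     if Suc N mod m = 0 \<or>
        (\<exists>i<workers p. 4 * Q \<le> D i + hits i N b \<omega> \<or> 4 * Q \<le> S i + wins i N \<omega>)
     then (Suc b, \<lambda>_. 0, \<lambda>_. 0)
     else (b, \<lambda>i. D i + hits i N b \<omega>, \<lambda>i. S i + wins i N \<omega>))"

definition level :: "nat \<Rightarrow> outcome \<Rightarrow> nat" where
  "level N \<omega> = fst (state N \<omega>)"

definition received :: "nat \<Rightarrow> nat \<Rightarrow> outcome \<Rightarrow> nat" where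
  "received i N \<omega> = fst (snd (state N \<omega>)) i"

definition won :: "nat \<Rightarrow> nat \<Rightarrow> outcome \<Rightarrow> nat" where
  "won i N \<omega> = snd (snd (state N \<omega>)) i"

definition advance :: "nat \<Rightarrow> outcome \<Rightarrow> bool" where
  "advance N \<omega> \<longleftrightarrow> Suc N mod m = 0 \<or> (\<exists>i<workers p.
     4 * Q \<le> received i N \<omega> + hits i N (level N \<omega>) \<omega> \<or> 4 * Q \<le> won i N \<omega> + wins i N \<omega>)"

lemma state_0 [simp]: "level 0 \<omega> = 0" "received i 0 \<omega> = 0" "won i 0 \<omega> = 0"
  by (simp_all add: level_def received_def won_def)

lemma state_Suc:
  "level (Suc N) \<omega> = (if advance N \<omega> then Suc (level N \<omega>) else level N \<omega>)"
  "received i (Suc N) \<omega> =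
     (if advance N \<omega> then 0 else received i N \<omega> + hits i N (level N \<omega>) \<omega>)"
  "won i (Suc N) \<omega> = (if advance N \<omega> then 0 else won i N \<omega> + wins i N \<omega>)"
proof -
  have "state (Suc N) \<omega> = (if advance N \<omega> then (Suc (level N \<omega>), \<lambda>_. 0, \<lambda>_. 0)
      else (level N \<omega>, \<lambda>i. received i N \<omega> + hits i N (level N \<omega>) \<omega>, \<lambda>i. won i N \<omega> + wins i N \<omega>))"
    unfolding state.simps case_prod_beta advance_def level_def received_def won_def ..
  then show "level (Suc N) \<omega> = (if advance N \<omega> then Suc (level N \<omega>) else level N \<omega>)"
    "received i (Suc N) \<omega> =
       (if advance N \<omega> then 0 else received i N \<omega> + hits i N (level N \<omega>) \<omega>)"
    "won i (Suc N) \<omega> = (if advance N \<omega> then 0 else won i N \<omega> + wins i N \<omega>)"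
    by (simp_all only: level_def[of "Suc N"] received_def[of _ "Suc N"] won_def[of _ "Suc N"]
          if_distrib[of fst] if_distrib[of snd] fst_conv snd_conv split: if_split) simp_all
qed

text \<open>A counter that reaches \<open>4 * Q\<close> makes the level rise and is reset. Two
  counters below \<open>4 * Q\<close> cannot account for all \<open>8 * Q\<close> coordinates of a
  block.\<close>

lemma counters_less:
  assumes "i < workers p" shows "received i N \<omega> < 4 * Q" "won i N \<omega> < 4 * Q"
  using Q assms by (cases N; auto simp: state_Suc advance_def)+

lemma comps_unique: "k \<in> comps N \<Longrightarrow> l \<in> comps N \<Longrightarrow> k = l"
proof -
  have "\<not> k < l" if "k \<in> comps N" "l \<in> comps N" for k l
  proof
    assume "k < l"
    then have "real (Suc k) * grad_time p \<le> real l * grad_time p"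
      using grad_time_pos by (intro mult_right_mono of_nat_mono) auto
    then show False using that \<delta>_grad by (simp add: comps_def in_cell_def algebra_simps)
  qed
  then show "k \<in> comps N \<Longrightarrow> l \<in> comps N \<Longrightarrow> k = l" by (meson linorder_cases)
qed

lemma msgs_unique: "k \<in> msgs i N \<Longrightarrow> l \<in> msgs i N \<Longrightarrow> k = l"
proof -
  have "\<not> k < l" if "k \<in> msgs i N" "l \<in> msgs i N" for k l
  proof
    assume "k < l"
    then have "down_time p i (Suc k) \<le> down_time p i l"
      using down_time_mono[OF down_time_pos] by simp
    moreover have "down_coord_time p * 1 \<le> down_coord_time p * down_size p i k"
      using that(1) down_time_pos by (intro mult_left_mono) (auto simp: msgs_def small_def)
    ultimately show False using that \<delta>_down by (simp add: msgs_def in_cell_def down_time_Suc algebra_simps)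
  qed
  then show "k \<in> msgs i N \<Longrightarrow> l \<in> msgs i N \<Longrightarrow> k = l" by (meson linorder_cases)
qed

lemma empty_or_singleton:
  assumes "\<And>k l. k \<in> S \<Longrightarrow> l \<in> S \<Longrightarrow> k = l"
  obtains "S = {}" | k where "S = {k}"
proof (cases "S = {}")
  case False
  then obtain k where "k \<in> S" by auto
  have "S = {k}"
  proof
    show "S \<subseteq> {k}"
    proof
      fix l assume "l \<in> S"
      then have "l = k" using \<open>k \<in> S\<close> by (rule assms)
      then show "l \<in> {k}" by simp
    qed
  qed (use \<open>k \<in> S\<close> in simp)
  then show ?thesis by (rule that(2))
qed (rule that(1))

lemma finite_comps: "finite (comps N)" and finite_msgs: "finite (msgs i N)"
proof -
  show "finite (comps N)"
    using comps_unique by (rule empty_or_singleton[of "comps N"]) simp_all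
  show "finite (msgs i N)"
    using msgs_unique by (rule empty_or_singleton[of "msgs i N"]) simp_all
qed

lemma finite_block [simp]: "finite (block b)"
  by (simp add: block_def)

end

section \<open>Confinement of the known coordinates to the blocks reached\<close>

locale scheduled_run = schedule + run +
  fixes T :: nat and \<beta> r :: real
  assumes r: "r \<noteq> 0" and G_eq: "G = obj_oracle (8 * Q) T \<beta> r q"
begin

abbreviation \<omega> :: outcome where "\<omega> \<equiv> (u, \<xi>, R)"

text \<open>Finds are booked when a computation or message starts, because its draw is made then,
  although the vector arrives later. \<open>ls\<close> collects the messages that are not small,
  whose subsets are never counted.\<close>

definition gs :: "nat \<Rightarrow> nat \<Rightarrow> nat set" where
  "gs i N = (\<Union>k\<in>{k. real k * grad_time p < N * \<delta>}. supp (grads tr i k))"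

definition ds :: "nat \<Rightarrow> nat \<Rightarrow> nat set" where
  "ds i N = (\<Union>k\<in>{k. small i k \<and> down_time p i k < N * \<delta>}. supp (downs tr i k))"

definition ls :: "nat \<Rightarrow> nat \<Rightarrow> nat set" where
  "ls i N = (\<Union>k\<in>{k. \<not> small i k \<and> down_time p i k < N * \<delta>}. supp (downs tr i k))"

lemma less_Suc_cell: "s < Suc N * \<delta> \<longleftrightarrow> s < N * \<delta> \<or> in_cell N s"
  using \<delta>_pos by (auto simp: in_cell_def algebra_simps)

lemma gs_Suc: "gs i (Suc N) = gs i N \<union> (\<Union>k\<in>comps N. supp (grads tr i k))"
  unfolding gs_def comps_def less_Suc_cell by blast

lemma ds_Suc: "ds i (Suc N) = ds i N \<union> (\<Union>k\<in>msgs i N. supp (downs tr i k))"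
  unfolding ds_def msgs_def less_Suc_cell by blast

text \<open>A computation or nonempty message takes at least \<open>\<delta>\<close>, so what has
  arrived by a moment of cell \<open>N\<close> was started before that cell. A nonempty message that
  is not small even takes at least a phase, so it was started before the current phase.\<close>

lemma know_cell:
  assumes "i < workers p" "s < Suc N * \<delta>"
  shows "know p tr i s \<subseteq> gs i N \<union> ds i N \<union> ls i (N - N mod m)"
proof
  fix j assume "j \<in> know p tr i s"
  then consider k where "real (Suc k) * grad_time p \<le> s" "j \<in> supp (grads tr i k)"
    | k where "down_time p i (Suc k) \<le> s" "j \<in> supp (downs tr i k)"
    by (auto simp: know_def worker_info_def)
  then show "j \<in> gs i N \<union> ds i N \<union> ls i (N - N mod m)"
  proof cases
    case (1 k)
    have "real k * grad_time p < N * \<delta>"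
      using 1(1) assms(2) \<delta>_grad by (simp add: algebra_simps)
    then show ?thesis using 1(2) by (auto simp: gs_def)
  next
    case (2 k)
    have nz: "down_size p i k \<noteq> 0"
    proof
      assume "down_size p i k = 0"
      then have "downs tr i k = (\<lambda>_. 0)" by (rule downs_zero[OF assms(1)])
      then show False using 2(2) by (simp add: supp_def)
    qed
    show ?thesis
    proof (cases "small i k")
      case True
      have "down_coord_time p * 1 \<le> down_coord_time p * down_size p i k"
        using nz down_time_pos by (intro mult_left_mono) auto
      then have "down_time p i k < N * \<delta>"
        using 2(1) assms(2) \<delta>_down by (simp add: down_time_Suc algebra_simps)
      then show ?thesis using 2(2) True by (auto simp: ds_def)
    next
      case False
      then have "dim p \<le> 32 * down_size p i k" using nz by (auto simp: small_def)
      then have "down_coord_time p * dim p \<le> down_coord_time p * real (32 * down_size p i k)"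
        using down_time_pos by (intro mult_left_mono of_nat_mono) auto
      then have "m * \<delta> \<le> down_coord_time p * down_size p i k"
        using phase_down by simp
      then have "down_time p i k < Suc N * \<delta> - m * \<delta>"
        using 2(1) assms(2) by (simp add: down_time_Suc)
      also have "\<dots> \<le> real (N - N mod m) * \<delta>"
      proof -
        have "Suc N \<le> (N - N mod m) + m"
          using mod_less_divisor[of m N] m mod_le_divisor[of m N] mod_less_eq_dividend[of N m] by linarith
        then have "Suc N * \<delta> \<le> real ((N - N mod m) + m) * \<delta>"
          using \<delta>_pos by (intro mult_right_mono of_nat_mono) auto
        then show ?thesis by (simp only: of_nat_add distrib_right)
      qed
      finally show ?thesis using 2(2) False unfolding ls_def by blast
    qed
  qed
qed

text \<open>The second clause is what the free rise at the end of a phase buys: large messages that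
  can have arrived do not touch the current block, so the count in the third clause concerns draws
  and small messages only. Large messages still on their way are held by the first clause, and the
  next rise turns that bound into the second clause.\<close>

definition confined :: "nat \<Rightarrow> bool" where
  "confined N \<longleftrightarrow> (\<forall>i<workers p.
     gs i N \<union> ds i N \<union> ls i N \<subseteq> {..<8 * Q * Suc (level N \<omega>)} \<and>
     ls i (N - N mod m) \<subseteq> {..<8 * Q * level N \<omega>} \<and>
     card ((gs i N \<union> ds i N) \<inter> block (level N \<omega>)) \<le> received i N \<omega> + won i N \<omega>)"

lemma confined_know:
  assumes "confined N" "i < workers p" "s < Suc N * \<delta>"
  shows "know p tr i s \<subseteq> {..<8 * Q * Suc (level N \<omega>)}"
    and "know p tr i s \<inter> block (level N \<omega>) \<subseteq> (gs i N \<union> ds i N) \<inter> block (level N \<omega>)"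
    and "\<not> block (level N \<omega>) \<subseteq> know p tr i s"
proof -
  let ?b = "level N \<omega>"
  have le: "{..<8 * Q * ?b} \<subseteq> {..<8 * Q * Suc ?b}" by auto
  have disj: "{..<8 * Q * ?b} \<inter> block ?b = {}" by (auto simp: block_def)
  note k = know_cell[OF assms(2,3)]
  note c = assms(1)[unfolded confined_def, rule_format, OF assms(2)]
  have i: "gs i N \<union> ds i N \<subseteq> {..<8 * Q * Suc ?b}" "ls i (N - N mod m) \<subseteq> {..<8 * Q * ?b}"
    "card ((gs i N \<union> ds i N) \<inter> block ?b) \<le> received i N \<omega> + won i N \<omega>"
    using c[THEN conjunct1] c[THEN conjunct2, THEN conjunct1] c[THEN conjunct2, THEN conjunct2]
    by simp_all
  show "know p tr i s \<subseteq> {..<8 * Q * Suc ?b}" 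
    by (rule order_trans[OF k]) (use i(1) order_trans[OF i(2) le] in simp)
  show sub: "know p tr i s \<inter> block ?b \<subseteq> (gs i N \<union> ds i N) \<inter> block ?b" 
  proof
    fix j assume j: "j \<in> know p tr i s \<inter> block ?b"
    then have "j \<notin> ls i (N - N mod m)" using i(2) disj by auto
    then show "j \<in> (gs i N \<union> ds i N) \<inter> block ?b" using j k by auto
  qed
  show "\<not> block ?b \<subseteq> know p tr i s"
  proof
    assume "block ?b \<subseteq> know p tr i s"
    then have "block ?b \<subseteq> know p tr i s \<inter> block ?b" by simp
    then have "block ?b \<subseteq> (gs i N \<union> ds i N) \<inter> block ?b" using sub by (rule order_trans)
    then have "card (block ?b) \<le> card ((gs i N \<union> ds i N) \<inter> block ?b)"
      by (intro card_mono) simp_all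
    moreover have "card (block ?b) = 8 * Q" by (simp add: block_def)
    ultimately show False using i(3) counters_less[OF assms(2), of N \<omega>] by linarith
  qed
qed

text \<open>Nothing beyond the current block is known and the block itself is not known completely,
  so no full window ends at or past its end. Of the block, a gradient then shows only known
  coordinates and the front, the latter only if the draw is nonzero: at most one find per successful
  draw.\<close>

lemma new_grads:
  assumes "confined N" "i < workers p" "k \<in> comps N"
  defines "f \<equiv> front (8 * Q) T (supp (query A i k (u, worker_view p tr i (real k * grad_time p))))"
  shows "supp (grads tr i k) \<subseteq> {..<8 * Q * Suc (level N \<omega>)}"
    and "supp (grads tr i k) \<inter> block (level N \<omega>) \<subseteq>
      (gs i N \<union> ds i N) \<union> (if \<xi> (i, k) \<noteq> 0 then {f} else {})"
proof -
  define x where "x = query A i k (u, worker_view p tr i (real k * grad_time p))"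
  let ?b = "level N \<omega>"
  have s: "real k * grad_time p < Suc N * \<delta>" using assms(3) by (simp add: comps_def in_cell_def)
  note kn = confined_know[OF assms(1,2) s]
  have sx: "supp x \<subseteq> know p tr i (real k * grad_time p)" unfolding x_def by (rule supp_query(1)[OF zr])
  \<comment> \<open>The last member of the window is known, hence inside the block or before it. So
    \<open>j\<close> could only be the very end of the block, and its window would be the whole
    block.\<close>
  have window: "j < 8 * Q * Suc ?b" if "{j - 8*Q..<j} \<subseteq> supp x" for j
  proof (rule ccontr)
    assume "\<not> j < 8 * Q * Suc ?b"
    then have ge: "j \<ge> 8 * Q * Suc ?b" by simp
    then have "j - 1 \<in> {j - 8*Q..<j}" using Q by auto
    then have "j - 1 < 8 * Q * Suc ?b" using that sx kn(1) by blast
    then have "j = 8 * Q * Suc ?b" using ge by linarith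
    then have "block ?b \<subseteq> {j - 8*Q..<j}" by (auto simp: block_def)
    then show False using that sx kn(3) by blast
  qed
  have eq: "grads tr i k = obj_oracle (8*Q) T \<beta> r q x (\<xi> (i, k))"
    by (simp add: grads_eq[OF assms(2)] G_eq x_def)
  show "supp (grads tr i k) \<subseteq> {..<8 * Q * Suc ?b}"
  proof
    fix j assume "j \<in> supp (grads tr i k)"
    then have "j \<in> supp x \<or> {j - 8*Q..<j} \<subseteq> supp x"
      using obj_oracle_support(2)[OF r, of "8*Q" T \<beta> q x "\<xi> (i, k)" j]
      by (auto simp: eq supp_def[of "obj_oracle _ _ _ _ _ _ _"])
    then show "j \<in> {..<8 * Q * Suc ?b}" using sx kn(1) window by auto
  qed
  show "supp (grads tr i k) \<inter> block ?b \<subseteq> (gs i N \<union> ds i N) \<union> (if \<xi> (i, k) \<noteq> 0 then {f} else {})"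
  proof
    fix j assume j: "j \<in> supp (grads tr i k) \<inter> block ?b"
    then have ne: "obj_oracle (8*Q) T \<beta> r q x (\<xi> (i, k)) j \<noteq> 0" by (auto simp: eq supp_def)
    show "j \<in> (gs i N \<union> ds i N) \<union> (if \<xi> (i, k) \<noteq> 0 then {f} else {})"
    proof (cases "j \<in> supp x")
      case True
      then show ?thesis using sx kn(2) j by blast
    next
      case False
      then have win: "{j - 8*Q..<j} \<subseteq> supp x" and z: "j = front (8*Q) T (supp x) \<Longrightarrow> \<xi> (i, k) \<noteq> 0"
        using obj_oracle_support(2)[OF r ne] by auto
      have jT: "j < T" by (rule obj_oracle_support(1)[OF r ne])
      \<comment> \<open>The front is not past the end of the block, so its window reaches back to
        every smaller coordinate of the block; such a \<open>j\<close> would already be in the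
        support of the query.\<close>
      have "j = front (8*Q) T (supp x)"
      proof (rule ccontr)
        assume neq: "j \<noteq> front (8*Q) T (supp x)"
        have "j \<le> front (8*Q) T (supp x)" using jT win by (intro front_ge) auto
        with neq have less: "j < front (8*Q) T (supp x)" by simp
        have "front (8*Q) T (supp x) < 8 * Q * Suc ?b" by (rule window[OF front_props(2)])
        then have "front (8*Q) T (supp x) - 8*Q \<le> j" using j by (auto simp: block_def)
        then have "j \<in> supp x" using less front_props(2)[of "8*Q" T "supp x"] by auto
        then show False using False by simp
      qed
      then show ?thesis using z by (simp add: f_def x_def)
    qed
  qed
qed

lemma new_downs:
  assumes "confined N" "i < workers p" "down_time p i k < Suc N * \<delta>"
  shows "supp (downs tr i k) \<subseteq> {..<8 * Q * Suc (level N \<omega>)}"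
    and "supp (downs tr i k) \<subseteq> R (i, k)"
proof -
  have "(\<Union>j<workers p. know p tr j (down_time p i k)) \<subseteq> {..<8 * Q * Suc (level N \<omega>)}"
    by (intro UN_least confined_know(1)[OF assms(1) _ assms(3)]) simp
  then show "supp (downs tr i k) \<subseteq> {..<8 * Q * Suc (level N \<omega>)}"
    by (rule order_trans[OF order_trans[OF supp_downs[OF assms(2)] Int_lower2]])
  show "supp (downs tr i k) \<subseteq> R (i, k)"
    by (rule order_trans[OF supp_downs[OF assms(2)] Int_lower1])
qed

lemma confined_step:
  assumes I: "confined N" shows "confined (Suc N)"
  unfolding confined_def
proof (intro allI impI)
  fix i assume i: "i < workers p"
  let ?b = "level N \<omega>"
  have old: "gs i N \<union> ds i N \<union> ls i N \<subseteq> {..<8 * Q * Suc ?b}" "ls i (N - N mod m) \<subseteq> {..<8 * Q * ?b}"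
    "card ((gs i N \<union> ds i N) \<inter> block ?b) \<le> received i N \<omega> + won i N \<omega>"
    using I[unfolded confined_def, rule_format, OF i] by simp_all
  have gs: "gs i (Suc N) \<subseteq> {..<8 * Q * Suc ?b}"
    unfolding gs_Suc using old(1) by (intro Un_least UN_least new_grads(1)[OF I i]; simp)
  have ds: "ds i (Suc N) \<subseteq> {..<8 * Q * Suc ?b}" and ls: "ls i (Suc N) \<subseteq> {..<8 * Q * Suc ?b}"
    unfolding ds_def ls_def by (intro UN_least new_downs(1)[OF I i]; simp)+
  have all: "gs i (Suc N) \<union> ds i (Suc N) \<union> ls i (Suc N) \<subseteq> {..<8 * Q * Suc ?b}"
    using gs ds ls by blast
  show "gs i (Suc N) \<union> ds i (Suc N) \<union> ls i (Suc N) \<subseteq> {..<8 * Q * Suc (level (Suc N) \<omega>)} \<and>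
     ls i (Suc N - Suc N mod m) \<subseteq> {..<8 * Q * level (Suc N) \<omega>} \<and>
     card ((gs i (Suc N) \<union> ds i (Suc N)) \<inter> block (level (Suc N) \<omega>))
       \<le> received i (Suc N) \<omega> + won i (Suc N) \<omega>"
  proof (cases "advance N \<omega>")
    \<comment> \<open>The block that now becomes current has not been touched by anyone, so the
      counters may restart at 0.\<close>
    case True
    have lev: "level (Suc N) \<omega> = Suc ?b" using True by (simp add: state_Suc)
    have "real (Suc N - Suc N mod m) * \<delta> \<le> Suc N * \<delta>"
      using \<delta>_pos by (intro mult_right_mono of_nat_mono) auto
    then have "ls i (Suc N - Suc N mod m) \<subseteq> ls i (Suc N)" by (auto simp: ls_def)
    then have "ls i (Suc N - Suc N mod m) \<subseteq> {..<8 * Q * Suc ?b}" using ls by blast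
    moreover have "{..<8 * Q * Suc ?b} \<inter> block (Suc ?b) = {}" by (auto simp: block_def)
    then have "(gs i (Suc N) \<union> ds i (Suc N)) \<inter> block (Suc ?b) = {}" using all by blast
    moreover have "{..<8 * Q * Suc ?b} \<subseteq> {..<8 * Q * Suc (Suc ?b)}" by auto
    then have "gs i (Suc N) \<union> ds i (Suc N) \<union> ls i (Suc N) \<subseteq> {..<8 * Q * Suc (Suc ?b)}"
      by (rule order_trans[OF all])
    ultimately show ?thesis by (simp add: lev)
  next
    case False
    have lev: "level (Suc N) \<omega> = ?b" using False by (simp add: state_Suc)
    have "Suc N mod m \<noteq> 0" using False by (auto simp: advance_def)
    \<comment> \<open>The start of the phase has not moved, so the clause on large messages carries
      over unchanged.\<close>
    then have "Suc N mod m = Suc (N mod m)" by (metis mod_Suc)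
    then have ls': "ls i (Suc N - Suc N mod m) \<subseteq> {..<8 * Q * ?b}" using old(2) by simp
    define f where "f = (\<lambda>k. front (8 * Q) T (supp (query A i k (u, worker_view p tr i (real k * grad_time p)))))"
    let ?W = "{k \<in> comps N. \<xi> (i, k) \<noteq> 0}"
    have "(gs i (Suc N) \<union> ds i (Suc N)) \<inter> block ?b \<subseteq>
        ((gs i N \<union> ds i N) \<inter> block ?b) \<union> f ` ?W \<union> (\<Union>k\<in>msgs i N. R (i, k) \<inter> block ?b)"
    proof
      fix j assume j: "j \<in> (gs i (Suc N) \<union> ds i (Suc N)) \<inter> block ?b"
      then consider "j \<in> gs i N \<union> ds i N" | k where "k \<in> comps N" "j \<in> supp (grads tr i k)"
        | k where "k \<in> msgs i N" "j \<in> supp (downs tr i k)" by (auto simp: gs_Suc ds_Suc)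
      then show "j \<in> ((gs i N \<union> ds i N) \<inter> block ?b) \<union> f ` ?W \<union> (\<Union>k\<in>msgs i N. R (i, k) \<inter> block ?b)"
      proof cases
        case (2 k)
        then have "j \<in> gs i N \<union> ds i N \<union> (if \<xi> (i, k) \<noteq> 0 then {f k} else {})"
          using new_grads(2)[OF I i 2(1)] j unfolding f_def by blast
        then show ?thesis using 2(1) j by (auto split: if_splits)
      next
        case (3 k)
        then have "down_time p i k < Suc N * \<delta>" by (simp add: msgs_def in_cell_def)
        then show ?thesis using new_downs(2)[OF I i] 3 j by blast
      qed (use j in blast)
    qed
    then have "card ((gs i (Suc N) \<union> ds i (Suc N)) \<inter> block ?b) \<le>
        card (((gs i N \<union> ds i N) \<inter> block ?b) \<union> f ` ?W \<union> (\<Union>k\<in>msgs i N. R (i, k) \<inter> block ?b))"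
      using finite_comps finite_msgs by (intro card_mono) auto
    also have "\<dots> \<le> card ((gs i N \<union> ds i N) \<inter> block ?b) + card (f ` ?W) +
        card (\<Union>k\<in>msgs i N. R (i, k) \<inter> block ?b)"
      by (rule order_trans[OF card_Un_le add_right_mono[OF card_Un_le]])
    also have "\<dots> \<le> (received i N \<omega> + won i N \<omega>) + wins i N \<omega> + hits i N ?b \<omega>"
    proof (intro add_mono old(3))
      have "card (f ` ?W) \<le> card ?W" using finite_comps by (intro card_image_le) auto
      also have "\<dots> = wins i N \<omega>"
        using finite_comps by (simp add: wins_def of_bool_def sum.If_cases Collect_conj_eq)
      finally show "card (f ` ?W) \<le> wins i N \<omega>" .
      show "card (\<Union>k\<in>msgs i N. R (i, k) \<inter> block ?b) \<le> hits i N ?b \<omega>"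
        unfolding hits_def snd_conv by (rule card_UN_le[OF finite_msgs])
    qed
    finally have card_le: "card ((gs i (Suc N) \<union> ds i (Suc N)) \<inter> block ?b) \<le>
        (received i N \<omega> + won i N \<omega>) + wins i N \<omega> + hits i N ?b \<omega>" .
    have "received i (Suc N) \<omega> = received i N \<omega> + hits i N ?b \<omega>"
      "won i (Suc N) \<omega> = won i N \<omega> + wins i N \<omega>"
      unfolding state_Suc if_not_P[OF False] by (rule refl)+
    with card_le have "card ((gs i (Suc N) \<union> ds i (Suc N)) \<inter> block ?b)
        \<le> received i (Suc N) \<omega> + won i (Suc N) \<omega>" by linarith
    then show ?thesis unfolding lev by (intro conjI all ls')
  qed
qed

lemma confined_0: "confined 0"
proof -
  have "\<not> down_time p i k < 0" for i k
    using down_time_mono[OF down_time_pos, of 0 k i] by (simp add: down_time_def)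
  then have "gs i 0 = {}" "ds i 0 = {}" "ls i 0 = {}" for i
    using grad_time_pos by (simp_all add: gs_def ds_def ls_def mult_less_0_iff)
  then show ?thesis by (simp add: confined_def)
qed

lemma confined_all: "confined N"
  by (induction N) (rule confined_0, erule confined_step)

lemma constructible_level:
  assumes "y \<in> constructible p tr t" "t < Suc N * \<delta>"
  shows "supp y \<subseteq> {..<8 * Q * Suc (level N \<omega>)}"
proof -
  have "(\<Union>i<workers p. know p tr i t) \<subseteq> {..<8 * Q * Suc (level N \<omega>)}"
    by (intro UN_least confined_know(1)[OF confined_all _ assms(2)]) simp
  then show ?thesis using constructible_known[OF assms(1)] by (rule order_trans[rotated])
qed

end

section \<open>Uniform subsets and fresh draws\<close>

text \<open>The ratio of the binomials is the product of \<open>(P - l) / (d - l)\<close> over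
  \<open>l < w\<close>, and each factor is at most \<open>P / d\<close>. Stated without
  division.\<close>

lemma choose_ratio_le:
  assumes "w \<le> P" "P \<le> d"
  shows "real ((d - w) choose (P - w)) * real d ^ w \<le> real (d choose P) * real P ^ w"
  using assms(1)
proof (induction w)
  case (Suc w)
  define a b where "a = P - Suc w" and "b = d - Suc w"
  have ab: "P - w = Suc a" "d - w = Suc b" using Suc.prems assms(2) by (auto simp: a_def b_def)
  have le: "real (Suc a) * real d \<le> real P * real (Suc b)"
  proof -
    have Pd: "P = Suc a + w" "d = Suc b + w" using ab Suc.prems assms(2) by auto
    have "w * Suc a \<le> w * Suc b" using assms(2) Pd by (intro mult_le_mono2) simp
    then have "Suc a * d \<le> P * Suc b" unfolding Pd by (simp add: algebra_simps)
    then show ?thesis by (simp only: of_nat_mult[symmetric] of_nat_le_iff)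
  qed
  have "real (Suc b choose Suc a) * Suc a = real (Suc b) * (b choose a)"
    by (metis Suc_times_binomial_eq mult.commute of_nat_mult)
  then have "(real (b choose a) * real d) * Suc b = real (Suc b choose Suc a) * (Suc a * real d)"
    by (simp add: mult_ac)
  also have "\<dots> \<le> real (Suc b choose Suc a) * (real P * real (Suc b))"
    using le by (intro mult_left_mono) auto
  finally have "(real (b choose a) * real d) * Suc b \<le> (real (Suc b choose Suc a) * P) * Suc b"
    by (simp add: mult_ac)
  then have step: "real (b choose a) * real d \<le> real (Suc b choose Suc a) * P"
    by (rule mult_right_le_imp_le) simp
  have "real (b choose a) * real d ^ Suc w = (real (b choose a) * real d) * real d ^ w" by simp
  also have "\<dots> \<le> (real (Suc b choose Suc a) * P) * real d ^ w"
    using step by (intro mult_right_mono) auto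
  also have "\<dots> = (real ((d - w) choose (P - w)) * real d ^ w) * P" by (simp add: ab mult_ac)
  also have "\<dots> \<le> (real (d choose P) * real P ^ w) * P"
    using Suc by (intro mult_right_mono) auto
  finally show ?case by (simp add: a_def b_def mult_ac)
qed simp

lemma finite_size_subsets [simp]: "finite (size_subsets d P)"
  by (rule finite_subset[of _ "Pow {..<d}"]) (auto simp: size_subsets_def)

lemma card_size_subsets: "card (size_subsets d P) = d choose P"
  unfolding size_subsets_def using n_subsets[of "{..<d}" P] by simp

lemma card_supersets_le:
  assumes "finite W" "P \<le> d" "d > 0"
  shows "real (card {S \<in> size_subsets d P. W \<subseteq> S}) \<le> real (d choose P) * (real P / real d) ^ card W"
proof (cases "W \<subseteq> {..<d} \<and> card W \<le> P")
  case True
  let ?L = "{S \<in> size_subsets d P. W \<subseteq> S}" and ?U = "{S. S \<subseteq> {..<d} - W \<and> card S = P - card W}"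
  have "inj_on (\<lambda>S. S - W) ?L" by (rule inj_onI) blast
  moreover have "(\<lambda>S. S - W) ` ?L \<subseteq> ?U"
    using assms(1) by (auto simp: size_subsets_def card_Diff_subset)
  moreover have "finite ?U" by simp
  ultimately have "card ?L \<le> card ?U" by (rule card_inj_on_le)
  also have "card ?U = (d - card W) choose (P - card W)"
    using True assms(1) by (subst n_subsets) (auto simp: card_Diff_subset)
  finally have "real (card ?L) * real d ^ card W \<le> real ((d - card W) choose (P - card W)) * real d ^ card W"
    by (intro mult_right_mono) auto
  also have "\<dots> \<le> real (d choose P) * real P ^ card W"
    using True assms(2) by (intro choose_ratio_le) auto
  finally show ?thesis using assms(3) by (simp add: power_divide field_simps)
next
  case False
  have "{S \<in> size_subsets d P. W \<subseteq> S} = {}"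
  proof -
    have "card W \<le> P" "W \<subseteq> {..<d}" if "W \<subseteq> S" "S \<subseteq> {..<d}" "card S = P" for S
      using that card_mono[of S W] finite_subset[of S "{..<d}"] by auto
    then show ?thesis using False by (auto simp: size_subsets_def)
  qed
  then show ?thesis by (simp only: card.empty) simp
qed

text \<open>Sampling without replacement is dominated by independent inclusions of probability
  \<open>P / d\<close>. The factor 2 of an element \<open>c\<close> is 1 plus the indicator of
  \<open>c \<in> S\<close>, so removing \<open>c\<close> from \<open>C\<close> leaves two sums: one
  with \<open>W\<close> unchanged, one with \<open>c\<close> moved into \<open>W\<close>. Hence the
  induction needs the generalization to \<open>W\<close>.\<close>

lemma sum_two_power_hits_le:
  assumes "finite C" "finite W" "C \<inter> W = {}" "P \<le> d" "d > 0"
  shows "(\<Sum>S | S \<in> size_subsets d P \<and> W \<subseteq> S. 2 ^ card (S \<inter> C))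
    \<le> real (d choose P) * (real P / real d) ^ card W * (1 + real P / real d) ^ card C"
  using assms(1-3)
proof (induction C arbitrary: W rule: finite_induct)
  case empty
  then show ?case using card_supersets_le[OF empty(1) assms(4,5)] by simp
next
  case (insert c C)
  let ?A = "\<lambda>W. {S. S \<in> size_subsets d P \<and> W \<subseteq> S}"
  have eq: "(2::real) ^ card (S \<inter> insert c C) = 2 ^ card (S \<inter> C) + (if c \<in> S then 2 ^ card (S \<inter> C) else 0)" for S
    using insert.hyps by (auto simp: Int_insert_right)
  have "(\<Sum>S\<in>?A W. (2::real) ^ card (S \<inter> insert c C)) =
      (\<Sum>S\<in>?A W. 2 ^ card (S \<inter> C)) + (\<Sum>S\<in>{S \<in> ?A W. c \<in> S}. 2 ^ card (S \<inter> C))"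
    unfolding eq sum.distrib by (subst sum.inter_filter[symmetric]) (auto simp: size_subsets_def)
  also have "{S \<in> ?A W. c \<in> S} = ?A (insert c W)" by auto
  also have "(\<Sum>S\<in>?A W. 2 ^ card (S \<inter> C)) + (\<Sum>S\<in>?A (insert c W). 2 ^ card (S \<inter> C)) \<le>
      real (d choose P) * (real P / real d) ^ card W * (1 + real P / real d) ^ card C +
      real (d choose P) * (real P / real d) ^ card (insert c W) * (1 + real P / real d) ^ card C"
    using insert by (intro add_mono insert.IH) auto
  also have "card (insert c W) = Suc (card W)" using insert.prems by simp
  also have "real (d choose P) * (real P / real d) ^ card W * (1 + real P / real d) ^ card C +
      real (d choose P) * (real P / real d) ^ Suc (card W) * (1 + real P / real d) ^ card C =
      real (d choose P) * (real P / real d) ^ card W * (1 + real P / real d) ^ card (insert c C)"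
    using insert.hyps by (simp add: algebra_simps)
  finally show ?case .
qed

lemma nn_integral_hits_le:
  assumes "finite C" "P \<le> d" "d > 0"
  shows "(\<integral>\<^sup>+S. ennreal (2 ^ card (S \<inter> C)) \<partial>uniform_count_measure (size_subsets d P))
    \<le> ennreal (exp (card C * P / d))"
proof -
  have pos: "real (d choose P) > 0" using assms(2) by simp
  have "(\<integral>\<^sup>+S. ennreal (2 ^ card (S \<inter> C)) \<partial>uniform_count_measure (size_subsets d P)) =
      (\<Sum>S\<in>size_subsets d P. ennreal (1 / (d choose P)) * ennreal (2 ^ card (S \<inter> C)))"
    unfolding uniform_count_measure_def card_size_subsets
    by (subst nn_integral_point_measure_finite) simp_all
  also have "\<dots> = (\<Sum>S\<in>size_subsets d P. ennreal (1 / (d choose P) * 2 ^ card (S \<inter> C)))"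
    by (intro sum.cong refl) (simp flip: ennreal_mult)
  also have "\<dots> = ennreal (\<Sum>S\<in>size_subsets d P. 1 / (d choose P) * 2 ^ card (S \<inter> C))"
    by (rule sum_ennreal) simp
  also have "\<dots> = ennreal (1 / (d choose P) * (\<Sum>S\<in>size_subsets d P. 2 ^ card (S \<inter> C)))"
    by (simp only: sum_distrib_left)
  also have "\<dots> \<le> ennreal (exp (card C * P / d))"
  proof (rule ennreal_leI)
    have "(\<Sum>S\<in>size_subsets d P. 2 ^ card (S \<inter> C)) \<le> real (d choose P) * (1 + real P / real d) ^ card C"
      using sum_two_power_hits_le[OF assms(1) finite.emptyI _ assms(2,3)] by simp
    then have "1 / (d choose P) * (\<Sum>S\<in>size_subsets d P. 2 ^ card (S \<inter> C)) \<le> (1 + real P / real d) ^ card C"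
      using pos by (simp add: field_simps)
    also have "\<dots> \<le> exp (real P / real d) ^ card C"
      by (intro power_mono exp_ge_add_one_self) simp
    also have "\<dots> = exp (card C * P / d)" by (simp add: exp_of_nat_mult[symmetric])
    finally show "1 / (d choose P) * (\<Sum>S\<in>size_subsets d P. 2 ^ card (S \<inter> C)) \<le> exp (card C * P / d)" .
  qed
  finally show ?thesis .
qed

text \<open>By independence and Tonelli, the fresh draw can be integrated first with the past
  frozen.\<close>

lemma fresh_nn_integral:
  assumes fresh: "fresh_draw M N X S Y" and "prob_space M" "prob_space N"
    and [measurable]: "X \<in> measurable M N" "Y \<in> measurable M S"
    and f: "f \<in> borel_measurable (N \<Otimes>\<^sub>M S)"
  shows "(\<integral>\<^sup>+\<omega>. f (X \<omega>, Y \<omega>) \<partial>M) = (\<integral>\<^sup>+\<omega>. (\<integral>\<^sup>+x. f (x, Y \<omega>) \<partial>N) \<partial>M)"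
proof -
  interpret M: prob_space M by fact
  interpret N: prob_space N by fact
  interpret S: prob_space "distr M S Y" by (rule M.prob_space_distr) measurable
  interpret P: pair_sigma_finite N "distr M S Y" ..
  have f': "f \<in> borel_measurable (N \<Otimes>\<^sub>M distr M S Y)"
    using f by (simp cong: measurable_cong_sets)
  have "(\<integral>\<^sup>+\<omega>. f (X \<omega>, Y \<omega>) \<partial>M) = integral\<^sup>N (distr M (N \<Otimes>\<^sub>M S) (\<lambda>\<omega>. (X \<omega>, Y \<omega>))) f"
    using f by (subst nn_integral_distr) auto
  also have "\<dots> = integral\<^sup>N (N \<Otimes>\<^sub>M distr M S Y) f"
    using fresh by (simp add: fresh_draw_def)
  also have "\<dots> = (\<integral>\<^sup>+y. (\<integral>\<^sup>+x. f (x, y) \<partial>N) \<partial>distr M S Y)"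
    using P.nn_integral_snd[OF f'] by simp
  also have "\<dots> = (\<integral>\<^sup>+\<omega>. (\<integral>\<^sup>+x. f (x, Y \<omega>) \<partial>N) \<partial>M)"
    using f by (subst nn_integral_distr) (auto intro!: N.borel_measurable_nn_integral_fst)
  finally show ?thesis .
qed

text \<open>All messages in \<open>U\<close> but the last have ended when the last one starts, so
  together they fit into the window; only the last can stick out.\<close>

lemma window_sum_le:
  fixes sz :: "nat \<Rightarrow> nat"
  assumes "finite U" "c > 0" "w \<ge> 0"
    and U: "\<And>k. k \<in> U \<Longrightarrow> s \<le> c * real (\<Sum>l<k. sz l) \<and> c * real (\<Sum>l<k. sz l) < s + w"
    and P: "\<And>k. k \<in> U \<Longrightarrow> real (sz k) \<le> P" "P \<ge> 0"
  shows "c * real (\<Sum>k\<in>U. sz k) \<le> w + c * P"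
proof (cases "U = {}")
  case False
  define a b where "a = Min U" and "b = Max U"
  have ab: "a \<in> U" "b \<in> U" "a \<le> b" using False assms(1) by (auto simp: a_def b_def)
  have "(\<Sum>k\<in>U. sz k) \<le> (\<Sum>k\<in>{a..b}. sz k)"
    using assms(1) by (intro sum_mono2) (auto simp: a_def b_def)
  also have "{a..b} = insert b {a..<b}" using ab(3) by auto
  also have "(\<Sum>k\<in>insert b {a..<b}. sz k) = sz b + (\<Sum>k\<in>{a..<b}. sz k)" by simp
  finally have "real (\<Sum>k\<in>U. sz k) \<le> real (sz b + (\<Sum>k\<in>{a..<b}. sz k))"
    by (rule of_nat_mono)
  then have "c * real (\<Sum>k\<in>U. sz k) \<le> c * (real (sz b) + real (\<Sum>k\<in>{a..<b}. sz k))"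
    using assms(2) by (intro mult_left_mono) (simp_all only: of_nat_add less_imp_le)
  moreover have "(\<Sum>k<b. sz k) = (\<Sum>k<a. sz k) + (\<Sum>k\<in>{a..<b}. sz k)"
    using ab(3) by (simp add: sum.atLeastLessThan_concat lessThan_atLeast0)
  then have "c * real (\<Sum>k\<in>{a..<b}. sz k) = c * real (\<Sum>k<b. sz k) - c * real (\<Sum>k<a. sz k)"
    by (simp add: algebra_simps)
  moreover have "\<dots> \<le> w" using U[OF ab(1)] U[OF ab(2)] by linarith
  moreover have "c * real (sz b) \<le> c * P" using P(1)[OF ab(2)] assms(2) by (intro mult_left_mono) auto
  ultimately show ?thesis by (simp add: distrib_left)
qed (use assms in simp)

section \<open>The level process\<close>

lemma measurable_draw_seed: "fst \<in> measurable (draw_space p X Y) borel"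
  unfolding draw_space_def by measurable

lemma measurable_draw_oracle:
  "(i, k) \<in> X \<Longrightarrow> (\<lambda>\<omega>. fst (snd \<omega>) (i, k)) \<in> borel_measurable (draw_space p X Y)"
  unfolding draw_space_def by measurable

lemma measurable_draw_subset:
  assumes "(i, k) \<in> Y"
  shows "(\<lambda>\<omega>. snd (snd \<omega>) (i, k)) \<in>
    measurable (draw_space p X Y) (count_space (size_subsets (dim p) (down_size p i k)))"
proof -
  let ?F = "\<lambda>(i, k). count_space (size_subsets (dim p) (down_size p i k))"
  have "(\<lambda>R. R (i, k)) \<in> measurable (PiM Y ?F) (?F (i, k))"
    using assms by (rule measurable_component_singleton)
  moreover have "(\<lambda>\<omega>. snd (snd \<omega>)) \<in> measurable (draw_space p X Y) (PiM Y ?F)"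
    unfolding draw_space_def by measurable
  ultimately show ?thesis by (auto intro: measurable_compose)
qed

lemma revealed_measurable:
  assumes "X \<subseteq> I" "Y \<subseteq> J"
  shows "revealed X Y \<in> measurable (draw_space p I J) (draw_space p X Y)"
proof -
  have eq: "revealed X Y = (\<lambda>\<omega>. (fst \<omega>, restrict (fst (snd \<omega>)) X, restrict (snd (snd \<omega>)) Y))"
    by (auto simp: fun_eq_iff)
  show ?thesis unfolding eq draw_space_def
    by (intro measurable_Pair measurable_fst measurable_fst'' measurable_snd''
        measurable_compose[OF _ measurable_restrict_subset[OF assms(1)]]
        measurable_compose[OF _ measurable_restrict_subset[OF assms(2)]]) measurable
qed

section \<open>The level as a function of the draws made so far\<close>

context schedule
begin

text \<open>Index sets whose draws determine \<open>state N\<close>. The sets in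
  \<open>run_law\<close> depend on where in the cell a draw is made, so this is a condition on
  \<open>X\<close> and \<open>Y\<close> rather than one fixed choice.\<close>

definition enough :: "nat \<Rightarrow> (nat \<times> nat) set \<Rightarrow> (nat \<times> nat) set \<Rightarrow> bool" where
  "enough N X Y \<longleftrightarrow> (\<forall>i<workers p. \<forall>k.
     (real k * grad_time p < N * \<delta> \<longrightarrow> (i, k) \<in> X) \<and> (down_time p i k < N * \<delta> \<longrightarrow> (i, k) \<in> Y))"

lemma enough_Suc: "enough (Suc N) X Y \<Longrightarrow> enough N X Y"
proof -
  have "N * \<delta> \<le> Suc N * \<delta>" using \<delta>_pos by (intro mult_right_mono of_nat_mono) auto
  then show "enough (Suc N) X Y \<Longrightarrow> enough N X Y" unfolding enough_def by (meson less_le_trans)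
qed

lemma wins_measurable:
  assumes "enough (Suc N) X Y" "i < workers p"
  shows "wins i N \<in> measurable (draw_space p X Y) (count_space UNIV)"
proof -
  have [measurable]: "(\<lambda>\<omega>. fst (snd \<omega>) (i, k)) \<in> borel_measurable (draw_space p X Y)" if "k \<in> comps N" for k
  proof (rule measurable_draw_oracle)
    show "(i, k) \<in> X" using that assms by (auto simp: comps_def in_cell_def enough_def)
  qed
  show ?thesis unfolding wins_def by measurable
qed

lemma hits_measurable:
  assumes "enough (Suc N) X Y" "i < workers p"
  shows "hits i N b \<in> measurable (draw_space p X Y) (count_space UNIV)"
proof -
  have [measurable]: "(\<lambda>\<omega>. card (snd (snd \<omega>) (i, k) \<inter> block b)) \<in> measurable (draw_space p X Y) (count_space UNIV)"
    if "k \<in> msgs i N" for k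
  proof (rule measurable_compose[OF measurable_draw_subset])
    show "(i, k) \<in> Y" using that assms by (auto simp: msgs_def in_cell_def enough_def)
  qed simp
  show ?thesis unfolding hits_def by measurable
qed

lemma hits_level_measurable:
  assumes "enough (Suc N) X Y" "i < workers p"
    and "level N \<in> measurable (draw_space p X Y) (count_space UNIV)"
  shows "(\<lambda>\<omega>. hits i N (level N \<omega>) \<omega>) \<in> measurable (draw_space p X Y) (count_space UNIV)"
  using hits_measurable[OF assms(1,2)] assms(3) by (rule measurable_compose_countable)

lemma state_measurable:
  assumes "enough N X Y"
  shows "level N \<in> measurable (draw_space p X Y) (count_space UNIV) \<and>
    (\<forall>i<workers p. received i N \<in> measurable (draw_space p X Y) (count_space UNIV) \<and>
      won i N \<in> measurable (draw_space p X Y) (count_space UNIV))"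
  using assms
proof (induction N)
  case 0
  have "level 0 = (\<lambda>_. 0)" "received i 0 = (\<lambda>_. 0)" "won i 0 = (\<lambda>_. 0)" for i by (auto simp: fun_eq_iff)
  then show ?case by simp
next
  case (Suc N)
  note IH = Suc.IH[OF enough_Suc[OF Suc.prems]]
  note [measurable] = IH[THEN conjunct1]
  have [measurable]: "(\<lambda>\<omega>. received i N \<omega> + hits i N (level N \<omega>) \<omega>) \<in> measurable (draw_space p X Y) (count_space UNIV)"
    "(\<lambda>\<omega>. won i N \<omega> + wins i N \<omega>) \<in> measurable (draw_space p X Y) (count_space UNIV)"
    if "i < workers p" for i
  proof -
    note [measurable] = IH[THEN conjunct2, rule_format, OF that, THEN conjunct1]
      IH[THEN conjunct2, rule_format, OF that, THEN conjunct2]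
      hits_level_measurable[OF Suc.prems that IH[THEN conjunct1]] wins_measurable[OF Suc.prems that]
    show "(\<lambda>\<omega>. received i N \<omega> + hits i N (level N \<omega>) \<omega>) \<in> measurable (draw_space p X Y) (count_space UNIV)"
      "(\<lambda>\<omega>. won i N \<omega> + wins i N \<omega>) \<in> measurable (draw_space p X Y) (count_space UNIV)" by measurable
  qed
  have [measurable]: "Measurable.pred (draw_space p X Y) (advance N)"
  proof -
    have "advance N = (\<lambda>\<omega>. Suc N mod m = 0 \<or> (\<exists>i\<in>{..<workers p}.
       4 * Q \<le> received i N \<omega> + hits i N (level N \<omega>) \<omega> \<or> 4 * Q \<le> won i N \<omega> + wins i N \<omega>))"
      by (auto simp: advance_def fun_eq_iff)
    also have "Measurable.pred (draw_space p X Y) \<dots>" by measurable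
    finally show ?thesis .
  qed
  show ?case
    unfolding state_Suc[abs_def] by (intro conjI allI impI) measurable
qed

lemma state_revealed:
  assumes "enough N X Y"
  shows "level N (revealed X Y \<omega>) = level N \<omega> \<and> (\<forall>i<workers p.
    received i N (revealed X Y \<omega>) = received i N \<omega> \<and> won i N (revealed X Y \<omega>) = won i N \<omega>)"
  using assms
proof (induction N)
  case (Suc N)
  obtain u \<xi> R where \<omega>: "\<omega> = (u, \<xi>, R)" by (cases \<omega>)
  note IH = Suc.IH[OF enough_Suc[OF Suc.prems]]
  have hits: "hits i N b (revealed X Y \<omega>) = hits i N b \<omega>" if "i < workers p" for i b
    unfolding hits_def \<omega>
  proof (intro sum.cong refl)
    fix k assume "k \<in> msgs i N"
    then have "(i, k) \<in> Y" using that Suc.prems by (auto simp: msgs_def in_cell_def enough_def)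
    then show "card (snd (snd (revealed X Y (u, \<xi>, R))) (i, k) \<inter> block b) =
        card (snd (snd (u, \<xi>, R)) (i, k) \<inter> block b)" by simp
  qed
  have wins: "wins i N (revealed X Y \<omega>) = wins i N \<omega>" if "i < workers p" for i
    unfolding wins_def \<omega>
  proof (intro sum.cong refl)
    fix k assume "k \<in> comps N"
    then have "(i, k) \<in> X" using that Suc.prems by (auto simp: comps_def in_cell_def enough_def)
    then show "of_bool (fst (snd (revealed X Y (u, \<xi>, R))) (i, k) \<noteq> 0) =
        (of_bool (fst (snd (u, \<xi>, R)) (i, k) \<noteq> 0) :: nat)" by simp
  qed
  have adv: "advance N (revealed X Y \<omega>) = advance N \<omega>"
    unfolding advance_def using IH hits wins by (simp cong: conj_cong)
  show ?case unfolding state_Suc adv using IH hits wins by simp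
qed simp

text \<open>\<open>rate\<close> and \<open>rate'\<close> bound the logarithms of the conditional
  expectations of \<open>2 ^ hits\<close> and \<open>2 ^ wins\<close> in a cell:
  \<open>exp (8 * Q * P / d)\<close> for a subset of size \<open>P\<close>, and
  \<open>1 + q \<le> exp q\<close> for a draw.\<close>

definition rate :: "nat \<Rightarrow> nat \<Rightarrow> real" where
  "rate i N = 8 * Q / dim p * (\<Sum>k\<in>msgs i N. real (down_size p i k))"

definition rate' :: "nat \<Rightarrow> real" where
  "rate' N = q * card (comps N)"

lemma rate_nonneg: "0 \<le> rate i N" and rate'_nonneg: "0 \<le> rate' N"
  using q by (simp_all add: rate_def rate'_def sum_nonneg)

lemma disjoint_cells: "in_cell N s \<Longrightarrow> in_cell N' s \<Longrightarrow> N = N'"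
proof -
  have *: "\<not> N < N'" if "in_cell N s" "in_cell N' s" for N N'
  proof
    assume "N < N'"
    then have "Suc N * \<delta> \<le> N' * \<delta>" using \<delta>_pos by (intro mult_right_mono of_nat_mono) auto
    then show False using that by (simp add: in_cell_def)
  qed
  then show "in_cell N s \<Longrightarrow> in_cell N' s \<Longrightarrow> N = N'" by (meson linorder_cases)
qed

lemma phase_window:
  assumes "in_cell c s" "c \<in> {N - N mod m..N}"
  shows "(N - N mod m) * \<delta> \<le> s" "s < (N - N mod m) * \<delta> + m * \<delta>"
proof -
  have "real (N - N mod m) * \<delta> \<le> real c * \<delta>" using assms(2) \<delta>_pos by (intro mult_right_mono of_nat_mono) auto
  then show "(N - N mod m) * \<delta> \<le> s" using assms(1) by (simp add: in_cell_def)
  have "c \<le> N" "N mod m < m" "N mod m \<le> N" using assms(2) m by simp_all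
  then have "Suc c \<le> (N - N mod m) + m" by linarith
  then have "real (Suc c) * \<delta> \<le> real ((N - N mod m) + m) * \<delta>"
    using \<delta>_pos by (intro mult_right_mono of_nat_mono) auto
  then show "s < (N - N mod m) * \<delta> + m * \<delta>"
    using assms(1) unfolding in_cell_def of_nat_add distrib_right by linarith
qed

lemma dim_pos: "dim p > 0"
proof (rule ccontr)
  assume "\<not> dim p > 0"
  then have "m * \<delta> \<le> 0" using phase_down by (simp add: mult.commute)
  moreover have "m * \<delta> > 0" using m \<delta>_pos by simp
  ultimately show False by linarith
qed

text \<open>By \<open>phase_down\<close>, messages started within a phase have total size at most
  \<open>d / 32\<close>, up to the last one, which is small and adds at most \<open>d / 32\<close>.
  Times \<open>8 * Q / d\<close> this is \<open>Q / 2\<close>.\<close>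

lemma sum_rate_le: "(\<Sum>c\<in>{N - N mod m..N}. rate i c) \<le> Q / 2"
proof -
  let ?C = "{N - N mod m..N}"
  define U where "U = (\<Union>c\<in>?C. msgs i c)"
  have fin: "finite U" unfolding U_def using finite_msgs by blast
  have "(\<Sum>c\<in>?C. \<Sum>k\<in>msgs i c. real (down_size p i k)) = (\<Sum>k\<in>U. real (down_size p i k))"
    unfolding U_def using finite_msgs disjoint_cells
    by (subst sum.UNION_disjoint) (auto simp: msgs_def)
  moreover have "down_coord_time p * real (\<Sum>k\<in>U. down_size p i k) \<le> m * \<delta> + down_coord_time p * (dim p / 32)"
  proof (rule window_sum_le[OF fin down_time_pos])
    show "real m * \<delta> \<ge> 0" using \<delta>_pos by simp
    fix k assume "k \<in> U"
    then obtain c where c: "c \<in> ?C" "small i k" "in_cell c (down_time p i k)"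
      unfolding U_def msgs_def by blast
    from phase_window[OF c(3,1)] show "(N - N mod m) * \<delta> \<le> down_coord_time p * real (sum (down_size p i) {..<k}) \<and>
        down_coord_time p * real (sum (down_size p i) {..<k}) < (N - N mod m) * \<delta> + m * \<delta>"
      by (simp add: down_time_def)
    have "real (32 * down_size p i k) \<le> real (dim p)" using c(2) by (simp only: of_nat_le_iff small_def)
    then show "real (down_size p i k) \<le> dim p / 32" by simp
  qed simp
  moreover have "m * \<delta> \<le> down_coord_time p * (dim p / 32)" using phase_down by simp
  ultimately have "down_coord_time p * (\<Sum>c\<in>?C. \<Sum>k\<in>msgs i c. real (down_size p i k))
      \<le> down_coord_time p * (dim p / 16)" by simp
  then have le: "(\<Sum>c\<in>?C. \<Sum>k\<in>msgs i c. real (down_size p i k)) \<le> dim p / 16"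
    using down_time_pos by (simp only: mult_le_cancel_left_pos)
  have "(\<Sum>c\<in>?C. rate i c) = 8 * Q / dim p * (\<Sum>c\<in>?C. \<Sum>k\<in>msgs i c. real (down_size p i k))"
    by (simp add: rate_def sum_distrib_left)
  also have "\<dots> \<le> 8 * Q / dim p * (dim p / 16)" using le by (intro mult_left_mono) auto
  also have "\<dots> = Q / 2" using dim_pos by simp
  finally show ?thesis .
qed

text \<open>By \<open>phase_grad\<close> the computations that fit into a phase contribute at most
  \<open>Q / 4\<close>. The one that sticks out adds \<open>q \<le> 1 \<le> Q / 4\<close>, which is
  where \<open>Q \<ge> 4\<close> enters.\<close>

lemma sum_rate'_le: "(\<Sum>c\<in>{N - N mod m..N}. rate' c) \<le> Q / 2"
proof -
  let ?C = "{N - N mod m..N}"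
  define U where "U = (\<Union>c\<in>?C. comps c)"
  have fin: "finite U" unfolding U_def using finite_comps by blast
  have "(\<Sum>c\<in>?C. card (comps c)) = card U"
    unfolding U_def using finite_comps disjoint_cells
    by (subst card_UN_disjoint) (auto simp: comps_def)
  moreover have "grad_time p * real (\<Sum>k\<in>U. 1) \<le> m * \<delta> + grad_time p * 1"
  proof (rule window_sum_le[OF fin grad_time_pos])
    show "real m * \<delta> \<ge> 0" using \<delta>_pos by simp
    fix k assume "k \<in> U"
    then obtain c where c: "c \<in> ?C" "in_cell c (k * grad_time p)"
      unfolding U_def comps_def by blast
    from phase_window[OF c(2,1)] show "(N - N mod m) * \<delta> \<le> grad_time p * real (sum (\<lambda>_. 1) {..<k}) \<and>
        grad_time p * real (sum (\<lambda>_. 1) {..<k}) < (N - N mod m) * \<delta> + m * \<delta>"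
      by (simp add: mult.commute)
  qed auto
  ultimately have "grad_time p * real (\<Sum>c\<in>?C. card (comps c)) \<le> m * \<delta> + grad_time p" by simp
  then have "q * (grad_time p * real (\<Sum>c\<in>?C. card (comps c))) \<le> q * (m * \<delta> + grad_time p)"
    using q by (intro mult_left_mono) auto
  moreover have "q * grad_time p \<le> grad_time p" using q grad_time_pos by simp
  moreover have "grad_time p * 4 \<le> grad_time p * Q" using Q grad_time_pos by (intro mult_left_mono) auto
  ultimately have "grad_time p * (q * real (\<Sum>c\<in>?C. card (comps c))) \<le> grad_time p * (Q / 2)"
    using phase_grad by (simp add: algebra_simps)
  then have "q * real (\<Sum>c\<in>?C. card (comps c)) \<le> Q / 2"
    using grad_time_pos by (simp only: mult_le_cancel_left_pos)
  then show ?thesis by (simp add: rate'_def sum_distrib_left)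
qed

end

section \<open>The exponential potential\<close>

locale scheduled_law = schedule +
  fixes M :: "outcome measure"
  assumes law: "run_law p (coin q) M"
begin

sublocale M: prob_space M
  using law by (simp add: run_law_def)

lemma sets_M: "sets M = sets (draw_space p (draw_index p) (draw_index p))"
  using law by (simp add: run_law_def)

lemma measurable_M: "measurable M N = measurable (draw_space p (draw_index p) (draw_index p)) N"
  by (rule measurable_cong_sets[OF sets_M refl])

lemma enough_all: "enough N (draw_index p) (draw_index p)"
  by (auto simp: enough_def draw_index_def)

lemma level_measurable [measurable]: "level N \<in> measurable M (count_space UNIV)"
  unfolding measurable_M using state_measurable[OF enough_all] by blast

lemma counters_measurable:
  assumes "i < workers p"
  shows "received i N \<in> measurable M (count_space UNIV)" "won i N \<in> measurable M (count_space UNIV)"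
  unfolding measurable_M using state_measurable[OF enough_all] assms by blast+

lemma new_counters_measurable:
  assumes "i < workers p"
  shows "(\<lambda>\<omega>. hits i N (level N \<omega>) \<omega>) \<in> measurable M (count_space UNIV)"
    and "wins i N \<in> measurable M (count_space UNIV)"
  unfolding measurable_M
  using hits_level_measurable[OF enough_all assms] wins_measurable[OF enough_all assms]
    state_measurable[OF enough_all] by blast+

lemma next_counters_measurable:
  assumes i: "i < workers p"
  shows "(\<lambda>\<omega>. received i N \<omega> + hits i N (level N \<omega>) \<omega>) \<in> measurable M (count_space UNIV)"
    and "(\<lambda>\<omega>. won i N \<omega> + wins i N \<omega>) \<in> measurable M (count_space UNIV)"
proof -
  note [measurable] = counters_measurable[OF i] new_counters_measurable[OF i]
  show "(\<lambda>\<omega>. received i N \<omega> + hits i N (level N \<omega>) \<omega>) \<in> measurable M (count_space UNIV)"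
    "(\<lambda>\<omega>. won i N \<omega> + wins i N \<omega>) \<in> measurable M (count_space UNIV)" by measurable
qed

text \<open>The cell contains at most one computation of the worker, and its draw is independent of
  all that determines \<open>state N\<close>. Averaging over it multiplies \<open>2 ^ won\<close> by
  exactly \<open>1 + q\<close>.\<close>

lemma expected_wins:
  assumes i: "i < workers p"
  shows "(\<integral>\<^sup>+\<omega>. ennreal (2 ^ (Q * level N \<omega>) * 2 ^ (won i N \<omega> + wins i N \<omega>)) \<partial>M)
    \<le> ennreal (exp (rate' N)) * (\<integral>\<^sup>+\<omega>. ennreal (2 ^ (Q * level N \<omega>) * 2 ^ won i N \<omega>) \<partial>M)"
proof (rule empty_or_singleton[of "comps N", OF comps_unique])
  assume "comps N = {}"
  then have "wins i N \<omega> = 0" "rate' N = 0" for \<omega> by (simp_all add: wins_def rate'_def)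
  then show ?thesis by simp
next
  fix k assume k: "comps N = {k}"
  define X where "X = {(i', k') \<in> draw_index p. real k' * grad_time p \<le> real k * grad_time p} - {(i, k)}"
  define Y where "Y = {(i', k') \<in> draw_index p. down_time p i' k' \<le> real k * grad_time p}"
  have cell: "N * \<delta> \<le> real k * grad_time p" using k by (auto simp: comps_def in_cell_def)
  have en: "enough N X Y"
    unfolding enough_def X_def Y_def draw_index_def using cell by auto
  note st = state_measurable[OF en, THEN conjunct1] state_measurable[OF en, THEN conjunct2, rule_format, OF i, THEN conjunct2]
  have fresh: "fresh_draw M (coin q) (\<lambda>\<omega>. fst (snd \<omega>) (i, k)) (draw_space p X Y) (revealed X Y)"
  proof -
    have eq: "(\<lambda>(u, \<xi>, R). \<xi> (i, k)) = (\<lambda>\<omega> :: outcome. fst (snd \<omega>) (i, k))" by auto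
    show ?thesis
      using law[unfolded run_law_def Let_def, THEN conjunct2, THEN conjunct2, THEN conjunct2,
          THEN conjunct1, rule_format, OF i, of k]
      unfolding eq X_def Y_def .
  qed
  define f :: "real \<times> outcome \<Rightarrow> ennreal" where
    "f = (\<lambda>(x, y). ennreal (2 ^ (Q * level N y) * 2 ^ (won i N y + of_bool (x \<noteq> 0))))"
  have sub: "X \<subseteq> draw_index p" "Y \<subseteq> draw_index p" by (auto simp: X_def Y_def)
  have wins: "wins i N \<omega> = of_bool (fst (snd \<omega>) (i, k) \<noteq> 0)" for \<omega> by (simp add: wins_def k)
  have rev: "level N (revealed X Y \<omega>) = level N \<omega>" "won i N (revealed X Y \<omega>) = won i N \<omega>" for \<omega>
    using state_revealed[OF en] i by simp_all
  have "(\<integral>\<^sup>+\<omega>. ennreal (2 ^ (Q * level N \<omega>) * 2 ^ (won i N \<omega> + wins i N \<omega>)) \<partial>M) =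
      (\<integral>\<^sup>+\<omega>. f (fst (snd \<omega>) (i, k), revealed X Y \<omega>) \<partial>M)"
    by (simp add: f_def wins rev)
  also have "\<dots> = (\<integral>\<^sup>+\<omega>. (\<integral>\<^sup>+x. f (x, revealed X Y \<omega>) \<partial>coin q) \<partial>M)"
  proof (rule fresh_nn_integral[OF fresh M.prob_space_axioms prob_space_coin])
    show "(\<lambda>\<omega>. fst (snd \<omega>) (i, k)) \<in> measurable M (coin q)"
      unfolding measurable_M using i measurable_draw_oracle[of i k "draw_index p" p "draw_index p"]
      by (simp add: draw_index_def cong: measurable_cong_sets)
    show "revealed X Y \<in> measurable M (draw_space p X Y)"
      unfolding measurable_M by (rule revealed_measurable[OF sub])
    note [measurable] = st
    show "f \<in> borel_measurable (coin q \<Otimes>\<^sub>M draw_space p X Y)"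
      unfolding f_def by measurable
  qed
  also have "\<dots> = (\<integral>\<^sup>+\<omega>. ennreal (1 + q) * ennreal (2 ^ (Q * level N \<omega>) * 2 ^ won i N \<omega>) \<partial>M)"
  proof (intro nn_integral_cong)
    fix \<omega>
    let ?a = "2 ^ (Q * level N \<omega>) * 2 ^ won i N \<omega> :: real"
    have "(\<integral>\<^sup>+x. f (x, revealed X Y \<omega>) \<partial>coin q) = ennreal q * ennreal (2 * ?a) + ennreal (1 - q) * ennreal ?a"
      using q by (subst coin_nn_integral) (auto simp: f_def rev mult_ac)
    also have "\<dots> = ennreal (q * (2 * ?a) + (1 - q) * ?a)"
      using q by (simp add: ennreal_mult ennreal_plus)
    also have "q * (2 * ?a) + (1 - q) * ?a = (1 + q) * ?a" by (simp add: algebra_simps)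
    finally show "(\<integral>\<^sup>+x. f (x, revealed X Y \<omega>) \<partial>coin q) = ennreal (1 + q) * ennreal ?a"
      using q by (simp add: ennreal_mult)
  qed
  also have "\<dots> = ennreal (1 + q) * (\<integral>\<^sup>+\<omega>. ennreal (2 ^ (Q * level N \<omega>) * 2 ^ won i N \<omega>) \<partial>M)"
    using counters_measurable[OF i] by (intro nn_integral_cmult) measurable
  also have "\<dots> \<le> ennreal (exp (rate' N)) * (\<integral>\<^sup>+\<omega>. ennreal (2 ^ (Q * level N \<omega>) * 2 ^ won i N \<omega>) \<partial>M)"
    by (intro mult_right_mono ennreal_leI) (simp_all add: rate'_def k)
  finally show ?thesis .
qed

text \<open>The level, and with it the block, is fixed by draws made before the cell. So the subset
  is uniform relative to the block, even if messages to other workers start at the same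
  moment.\<close>

lemma expected_hits:
  assumes i: "i < workers p"
  shows "(\<integral>\<^sup>+\<omega>. ennreal (2 ^ (Q * level N \<omega>) * 2 ^ (received i N \<omega> + hits i N (level N \<omega>) \<omega>)) \<partial>M)
    \<le> ennreal (exp (rate i N)) * (\<integral>\<^sup>+\<omega>. ennreal (2 ^ (Q * level N \<omega>) * 2 ^ received i N \<omega>) \<partial>M)"
proof (rule empty_or_singleton[of "msgs i N", OF msgs_unique])
  assume "msgs i N = {}"
  then have "hits i N b \<omega> = 0" "rate i N = 0" for b \<omega> by (simp_all add: hits_def rate_def)
  then show ?thesis by simp
next
  fix k assume k: "msgs i N = {k}"
  define t where "t = down_time p i k"
  define X where "X = {(i', k') \<in> draw_index p. real k' * grad_time p < t}"
  define Y where "Y = {(i', k') \<in> draw_index p. down_time p i' k' < t}"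
  let ?U = "uniform_count_measure (size_subsets (dim p) (down_size p i k))"
  have cell: "N * \<delta> \<le> t" and small: "small i k" using k by (auto simp: msgs_def in_cell_def t_def)
  have en: "enough N X Y"
    unfolding enough_def X_def Y_def draw_index_def using cell by auto
  note st = state_measurable[OF en, THEN conjunct1] state_measurable[OF en, THEN conjunct2, rule_format, OF i, THEN conjunct1]
  have fresh: "fresh_draw M ?U (\<lambda>\<omega>. snd (snd \<omega>) (i, k)) (draw_space p X Y) (revealed X Y)"
  proof -
    have eq: "(\<lambda>(u, \<xi>, R). R (i, k)) = (\<lambda>\<omega> :: outcome. snd (snd \<omega>) (i, k))" by auto
    show ?thesis
      using law[unfolded run_law_def Let_def, THEN conjunct2, THEN conjunct2, THEN conjunct2,
          THEN conjunct2, rule_format, OF i, of k]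
      unfolding eq X_def Y_def t_def .
  qed
  define f :: "nat set \<times> outcome \<Rightarrow> ennreal" where
    "f = (\<lambda>(x, y). ennreal (2 ^ (Q * level N y) * 2 ^ received i N y) * ennreal (2 ^ card (x \<inter> block (level N y))))"
  have sub: "X \<subseteq> draw_index p" "Y \<subseteq> draw_index p" by (auto simp: X_def Y_def)
  have hits: "hits i N b \<omega> = card (snd (snd \<omega>) (i, k) \<inter> block b)" for b \<omega> by (simp add: hits_def k)
  have rev: "level N (revealed X Y \<omega>) = level N \<omega>" "received i N (revealed X Y \<omega>) = received i N \<omega>" for \<omega>
    using state_revealed[OF en] i by simp_all
  have le_dim: "down_size p i k \<le> dim p" using valid i by (simp add: valid_protocol_def)
  interpret U: prob_space ?U
    using card_size_subsets[of "dim p" "down_size p i k"] le_dim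
    by (intro prob_space_uniform_count_measure) (auto simp: card_gt_0_iff[symmetric])
  have "(\<integral>\<^sup>+\<omega>. ennreal (2 ^ (Q * level N \<omega>) * 2 ^ (received i N \<omega> + hits i N (level N \<omega>) \<omega>)) \<partial>M) =
      (\<integral>\<^sup>+\<omega>. f (snd (snd \<omega>) (i, k), revealed X Y \<omega>) \<partial>M)"
    by (simp add: f_def hits rev power_add mult.assoc flip: ennreal_mult)
  also have "\<dots> = (\<integral>\<^sup>+\<omega>. (\<integral>\<^sup>+x. f (x, revealed X Y \<omega>) \<partial>?U) \<partial>M)"
  proof (rule fresh_nn_integral[OF fresh M.prob_space_axioms U.prob_space_axioms])
    have sets_U: "sets ?U = sets (count_space (size_subsets (dim p) (down_size p i k)))"
      by (simp add: sets_uniform_count_measure)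
    show "(\<lambda>\<omega>. snd (snd \<omega>) (i, k)) \<in> measurable M ?U"
      unfolding measurable_M measurable_cong_sets[OF refl sets_U]
      using i by (intro measurable_draw_subset) (simp add: draw_index_def)
    show "revealed X Y \<in> measurable M (draw_space p X Y)"
      unfolding measurable_M by (rule revealed_measurable[OF sub])
    note [measurable] = st
    have [measurable]: "(\<lambda>z. card (fst z \<inter> block (level N (snd z)))) \<in>
        measurable (?U \<Otimes>\<^sub>M draw_space p X Y) (count_space UNIV)"
    proof (rule measurable_compose_countable[where g = "\<lambda>z. level N (snd z)"])
      show "(\<lambda>z. card (fst z \<inter> block b)) \<in> measurable (?U \<Otimes>\<^sub>M draw_space p X Y) (count_space UNIV)" for b
        by (rule measurable_compose[OF measurable_fst])
           (simp add: measurable_cong_sets[OF sets_U refl])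
    qed measurable
    show "f \<in> borel_measurable (?U \<Otimes>\<^sub>M draw_space p X Y)"
      unfolding f_def case_prod_beta by measurable
  qed
  also have "\<dots> \<le> (\<integral>\<^sup>+\<omega>. ennreal (exp (rate i N)) * ennreal (2 ^ (Q * level N \<omega>) * 2 ^ received i N \<omega>) \<partial>M)"
  proof (intro nn_integral_mono)
    fix \<omega>
    let ?a = "ennreal (2 ^ (Q * level N \<omega>) * 2 ^ received i N \<omega>)"
    have "(\<integral>\<^sup>+x. f (x, revealed X Y \<omega>) \<partial>?U) = ?a * (\<integral>\<^sup>+x. ennreal (2 ^ card (x \<inter> block (level N \<omega>))) \<partial>?U)"
      unfolding f_def case_prod_conv rev
      by (intro nn_integral_cmult) (simp add: measurable_cong_sets[OF sets_uniform_count_measure_count_space refl])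
    also have "\<dots> \<le> ?a * ennreal (exp (card (block (level N \<omega>)) * down_size p i k / dim p))"
      by (intro mult_left_mono nn_integral_hits_le le_dim dim_pos) simp_all
    also have "real (card (block (level N \<omega>)) * down_size p i k) / dim p = rate i N"
      by (simp add: rate_def k block_def)
    finally show "(\<integral>\<^sup>+x. f (x, revealed X Y \<omega>) \<partial>?U) \<le> ennreal (exp (rate i N)) * ?a"
      by (simp add: mult.commute)
  qed
  also have "\<dots> = ennreal (exp (rate i N)) * (\<integral>\<^sup>+\<omega>. ennreal (2 ^ (Q * level N \<omega>) * 2 ^ received i N \<omega>) \<partial>M)"
    using counters_measurable[OF i] by (intro nn_integral_cmult) measurable
  finally show ?thesis .
qed

text \<open>Discounts the expected growth of the counters since the phase began. It restarts with
  the phase and not with the level, so the accumulated exponent stays below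
  \<open>Q / 2\<close>.\<close>

definition decay :: "nat \<Rightarrow> nat \<Rightarrow> real" where
  "decay i N = exp (- (\<Sum>c\<in>{N - N mod m..<N}. rate i c))"

definition decay' :: "nat \<Rightarrow> real" where
  "decay' N = exp (- (\<Sum>c\<in>{N - N mod m..<N}. rate' c))"

definition potential :: "nat \<Rightarrow> outcome \<Rightarrow> real" where
  "potential N \<omega> = 2 ^ (Q * level N \<omega>) * (\<Sum>i<workers p.
     decay i N * 2 ^ received i N \<omega> + decay' N * 2 ^ won i N \<omega>)"

text \<open>The potential with the draws of cell \<open>N\<close> counted but the level not yet
  updated. This separates the probabilistic half of a step from the deterministic one.\<close>

definition next_potential :: "nat \<Rightarrow> outcome \<Rightarrow> real" where
  "next_potential N \<omega> = 2 ^ (Q * level N \<omega>) * (\<Sum>i<workers p.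
     decay i N * exp (- rate i N) * 2 ^ (received i N \<omega> + hits i N (level N \<omega>) \<omega>) +
     decay' N * exp (- rate' N) * 2 ^ (won i N \<omega> + wins i N \<omega>))"

lemma ennreal_weighted_sum:
  fixes a b :: "nat \<Rightarrow> real" and x y :: "nat \<Rightarrow> nat"
  assumes "\<And>i. a i \<ge> 0" "\<And>i. b i \<ge> 0"
  shows "ennreal (2 ^ c * (\<Sum>i<n. a i * 2 ^ x i + b i * 2 ^ y i)) =
    (\<Sum>i<n. ennreal (a i) * ennreal (2 ^ c * 2 ^ x i) + ennreal (b i) * ennreal (2 ^ c * 2 ^ y i))"
proof -
  have "ennreal (2 ^ c * (\<Sum>i<n. a i * 2 ^ x i + b i * 2 ^ y i)) =
      ennreal (\<Sum>i<n. a i * (2 ^ c * 2 ^ x i) + b i * (2 ^ c * 2 ^ y i))"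
    by (simp add: sum_distrib_left algebra_simps)
  also have "\<dots> = (\<Sum>i<n. ennreal (a i * (2 ^ c * 2 ^ x i) + b i * (2 ^ c * 2 ^ y i)))"
    using assms by (intro sum_ennreal[symmetric]) simp
  also have "\<dots> = (\<Sum>i<n. ennreal (a i) * ennreal (2 ^ c * 2 ^ x i) + ennreal (b i) * ennreal (2 ^ c * 2 ^ y i))"
    using assms by (intro sum.cong refl) (simp add: ennreal_plus ennreal_mult)
  finally show ?thesis .
qed

text \<open>Linearity reduces the claim to one counter of one worker, where the new discount cancels
  the expected growth.\<close>

lemma expected_next_potential:
  "(\<integral>\<^sup>+\<omega>. ennreal (next_potential N \<omega>) \<partial>M) \<le> (\<integral>\<^sup>+\<omega>. ennreal (potential N \<omega>) \<partial>M)"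
proof -
  let ?E = "\<lambda>g. \<integral>\<^sup>+\<omega>. ennreal (2 ^ (Q * level N \<omega>) * 2 ^ g \<omega>) \<partial>M"
  have pos: "decay i N \<ge> 0" "decay' N \<ge> 0" for i by (simp_all add: decay_def decay'_def)
  have meas: "(\<lambda>\<omega>. ennreal (2 ^ (Q * level N \<omega>) * 2 ^ g \<omega>)) \<in> borel_measurable M"
    if [measurable]: "g \<in> measurable M (count_space UNIV)" for g :: "outcome \<Rightarrow> nat" by measurable
  have expand: "(\<integral>\<^sup>+\<omega>. (\<Sum>i<workers p. ennreal (a i) * ennreal (2 ^ (Q * level N \<omega>) * 2 ^ x i \<omega>) +
        ennreal (b i) * ennreal (2 ^ (Q * level N \<omega>) * 2 ^ y i \<omega>)) \<partial>M) =
      (\<Sum>i<workers p. ennreal (a i) * ?E (x i) + ennreal (b i) * ?E (y i))"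
    if "\<And>i. i < workers p \<Longrightarrow> x i \<in> measurable M (count_space UNIV)"
       "\<And>i. i < workers p \<Longrightarrow> y i \<in> measurable M (count_space UNIV)" for a b x y
  proof -
    have m: "(\<lambda>\<omega>. ennreal (2 ^ (Q * level N \<omega>) * 2 ^ x i \<omega>)) \<in> borel_measurable M"
      "(\<lambda>\<omega>. ennreal (2 ^ (Q * level N \<omega>) * 2 ^ y i \<omega>)) \<in> borel_measurable M" if "i < workers p" for i
      using meas \<open>\<And>i. i < workers p \<Longrightarrow> x i \<in> _\<close>[OF that] \<open>\<And>i. i < workers p \<Longrightarrow> y i \<in> _\<close>[OF that] by blast+
    have mc: "(\<lambda>\<omega>. ennreal (a i) * ennreal (2 ^ (Q * level N \<omega>) * 2 ^ x i \<omega>)) \<in> borel_measurable M"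
      "(\<lambda>\<omega>. ennreal (b i) * ennreal (2 ^ (Q * level N \<omega>) * 2 ^ y i \<omega>)) \<in> borel_measurable M"
      if "i < workers p" for i
      by (intro borel_measurable_times_ennreal borel_measurable_const m that)+
    show ?thesis
    proof (subst nn_integral_sum)
      fix i assume "i \<in> {..<workers p}"
      then show "(\<lambda>\<omega>. ennreal (a i) * ennreal (2 ^ (Q * level N \<omega>) * 2 ^ x i \<omega>) +
          ennreal (b i) * ennreal (2 ^ (Q * level N \<omega>) * 2 ^ y i \<omega>)) \<in> borel_measurable M"
        by (intro borel_measurable_add mc) simp_all
    next
      show "(\<Sum>i<workers p. \<integral>\<^sup>+\<omega>. ennreal (a i) * ennreal (2 ^ (Q * level N \<omega>) * 2 ^ x i \<omega>) +
          ennreal (b i) * ennreal (2 ^ (Q * level N \<omega>) * 2 ^ y i \<omega>) \<partial>M) =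
        (\<Sum>i<workers p. ennreal (a i) * ?E (x i) + ennreal (b i) * ?E (y i))"
      proof (intro sum.cong refl)
        fix i assume "i \<in> {..<workers p}"
        then have i: "i < workers p" by simp
        show "(\<integral>\<^sup>+\<omega>. ennreal (a i) * ennreal (2 ^ (Q * level N \<omega>) * 2 ^ x i \<omega>) +
            ennreal (b i) * ennreal (2 ^ (Q * level N \<omega>) * 2 ^ y i \<omega>) \<partial>M) =
          ennreal (a i) * ?E (x i) + ennreal (b i) * ?E (y i)"
          unfolding nn_integral_add[OF mc(1)[OF i] mc(2)[OF i]]
            nn_integral_cmult[OF m(1)[OF i]] nn_integral_cmult[OF m(2)[OF i]] ..
      qed
    qed
  qed
  have "(\<integral>\<^sup>+\<omega>. ennreal (next_potential N \<omega>) \<partial>M) =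
      (\<Sum>i<workers p. ennreal (decay i N * exp (- rate i N)) * ?E (\<lambda>\<omega>. received i N \<omega> + hits i N (level N \<omega>) \<omega>) +
        ennreal (decay' N * exp (- rate' N)) * ?E (\<lambda>\<omega>. won i N \<omega> + wins i N \<omega>))"
    unfolding next_potential_def using pos
    by (subst ennreal_weighted_sum)
       (auto intro!: expand next_counters_measurable)
  also have "\<dots> \<le> (\<Sum>i<workers p. ennreal (decay i N) * ?E (received i N) + ennreal (decay' N) * ?E (won i N))"
  proof (intro sum_mono add_mono)
    fix i assume "i \<in> {..<workers p}"
    then have i: "i < workers p" by simp
    have cancel: "ennreal (a * exp (- s)) * (ennreal (exp s) * E) = ennreal a * E" if "a \<ge> 0" for a s :: real and E
    proof -
      have "ennreal (a * exp (- s)) * ennreal (exp s) = ennreal a"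
        using that by (simp flip: ennreal_mult exp_add add: mult.assoc)
      then show ?thesis by (simp flip: mult.assoc)
    qed
    show "ennreal (decay i N * exp (- rate i N)) * ?E (\<lambda>\<omega>. received i N \<omega> + hits i N (level N \<omega>) \<omega>)
        \<le> ennreal (decay i N) * ?E (received i N)"
      using mult_left_mono[OF expected_hits[OF i, of N], of "ennreal (decay i N * exp (- rate i N))"] pos
      by (simp add: cancel)
    show "ennreal (decay' N * exp (- rate' N)) * ?E (\<lambda>\<omega>. won i N \<omega> + wins i N \<omega>)
        \<le> ennreal (decay' N) * ?E (won i N)"
      using mult_left_mono[OF expected_wins[OF i, of N], of "ennreal (decay' N * exp (- rate' N))"] pos
      by (simp add: cancel)
  qed
  also have "\<dots> = (\<integral>\<^sup>+\<omega>. ennreal (potential N \<omega>) \<partial>M)"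
    unfolding potential_def using pos
    by (subst ennreal_weighted_sum)
       (auto intro!: expand[symmetric] counters_measurable)
  finally show ?thesis .
qed

text \<open>The rates of a phase add up to at most \<open>Q / 2\<close>, and
  \<open>exp (1 / 2) \<le> 2\<close>.\<close>

lemma decay_ge:
  "1 / 2 ^ Q \<le> decay i N * exp (- rate i N)" "1 / 2 ^ Q \<le> decay' N * exp (- rate' N)"
proof -
  have half: "exp (real Q / 2) \<le> 2 ^ Q"
  proof -
    have "exp (1 / 2 :: real) ^ 2 = exp 1" by (simp flip: exp_of_nat_mult)
    also have "\<dots> \<le> 2 ^ 2" using exp_le by simp
    finally have "exp (1 / 2 :: real) \<le> 2" by (rule power2_le_imp_le) simp
    then have "exp (1 / 2 :: real) ^ Q \<le> 2 ^ Q" by (intro power_mono) auto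
    then show ?thesis by (simp flip: exp_of_nat_mult)
  qed
  have *: "1 / 2 ^ Q \<le> exp (- s)" if "s \<le> real Q / 2" for s
  proof -
    have "exp s \<le> 2 ^ Q" using half that by (meson exp_le_cancel_iff order_trans)
    then show ?thesis by (simp add: exp_minus inverse_eq_divide frac_le)
  qed
  have split: "{N - N mod m..N} = insert N {N - N mod m..<N}" by auto
  have "decay i N * exp (- rate i N) = exp (- (\<Sum>c\<in>{N - N mod m..N}. rate i c))"
    unfolding decay_def split by (simp add: exp_add[symmetric] exp_diff exp_minus divide_inverse)
  then show "1 / 2 ^ Q \<le> decay i N * exp (- rate i N)" using *[OF sum_rate_le] by simp
  have "decay' N * exp (- rate' N) = exp (- (\<Sum>c\<in>{N - N mod m..N}. rate' c))"
    unfolding decay'_def split by (simp add: exp_add[symmetric] exp_diff exp_minus divide_inverse)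
  then show "1 / 2 ^ Q \<le> decay' N * exp (- rate' N)" using *[OF sum_rate'_le] by simp
qed

lemma decay_le: "decay i N \<le> 1" "decay' N \<le> 1"
  by (simp_all add: decay_def decay'_def sum_nonneg rate_nonneg rate'_nonneg)

lemma decay_nonneg: "decay i N \<ge> 0" "decay' N \<ge> 0"
  by (simp_all add: decay_def decay'_def)

lemma decay_Suc:
  assumes "Suc N mod m \<noteq> 0"
  shows "decay i (Suc N) = decay i N * exp (- rate i N)" "decay' (Suc N) = decay' N * exp (- rate' N)"
proof -
  have "Suc N mod m = Suc (N mod m)" using assms by (metis mod_Suc)
  moreover have "N mod m \<le> N" by simp
  ultimately have "{Suc N - Suc N mod m..<Suc N} = insert N {N - N mod m..<N}" by auto
  then show "decay i (Suc N) = decay i N * exp (- rate i N)" "decay' (Suc N) = decay' N * exp (- rate' N)"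
    unfolding decay_def decay'_def by (simp_all add: exp_diff exp_minus divide_inverse)
qed

text \<open>A rise raises the first factor by \<open>2 ^ Q\<close> and resets the sum to at most
  \<open>2 * n \<le> 2 ^ (2 * Q)\<close>. If a counter caused it, one summand was at least
  \<open>2 ^ (4 * Q) / 2 ^ Q\<close>, which pays for both. The free rise at the end of a phase is
  only backed by the lower bound \<open>2 * n / 2 ^ Q\<close> on the sum, hence the factor
  \<open>2 ^ (2 * Q)\<close>.\<close>

lemma potential_Suc_le:
  "potential (Suc N) \<omega> \<le> (if Suc N mod m = 0 then 2 ^ (2 * Q) else 1) * next_potential N \<omega>"
proof (cases "advance N \<omega>")
  case False
  then have nz: "Suc N mod m \<noteq> 0" by (auto simp: advance_def)
  then show ?thesis
    using False by (simp add: potential_def next_potential_def state_Suc decay_Suc)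
next
  case True
  let ?n = "real (workers p)" and ?A = "2 ^ (Q * level N \<omega>) :: real"
  let ?r = "\<lambda>i. received i N \<omega> + hits i N (level N \<omega>) \<omega>" and ?w = "\<lambda>i. won i N \<omega> + wins i N \<omega>"
  let ?f = "\<lambda>i. decay i N * exp (- rate i N) * 2 ^ ?r i" and ?g = "\<lambda>i. decay' N * exp (- rate' N) * 2 ^ ?w i"
  have fg_ge: "2 ^ e / 2 ^ Q \<le> ?f i" if "e \<le> ?r i" for e i
  proof -
    have "1 / 2 ^ Q * 2 ^ e \<le> ?f i"
      using that decay_nonneg by (intro mult_mono decay_ge power_increasing) auto
    then show ?thesis by simp
  qed
  have gg_ge: "2 ^ e / 2 ^ Q \<le> ?g i" if "e \<le> ?w i" for e i
  proof -
    have "1 / 2 ^ Q * 2 ^ e \<le> ?g i"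
      using that decay_nonneg by (intro mult_mono decay_ge power_increasing) auto
    then show ?thesis by simp
  qed
  have "potential (Suc N) \<omega> = 2 ^ (Q * Suc (level N \<omega>)) * (\<Sum>i<workers p. decay i (Suc N) + decay' (Suc N))"
    using True by (simp add: potential_def state_Suc)
  also have "\<dots> \<le> 2 ^ (Q * Suc (level N \<omega>)) * (\<Sum>i<workers p. 2)"
  proof (intro mult_left_mono sum_mono)
    show "decay i (Suc N) + decay' (Suc N) \<le> 2" for i
      using decay_le(1)[of i "Suc N"] decay_le(2)[of "Suc N"] by linarith
  qed simp
  also have "\<dots> = ?A * 2 ^ Q * (2 * ?n)" by (simp add: power_add)
  finally have upper: "potential (Suc N) \<omega> \<le> ?A * 2 ^ Q * (2 * ?n)" .
  have two: "(2::real) ^ (2 * Q) = 2 ^ Q * 2 ^ Q" by (simp add: mult_2 flip: power_add)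
  show ?thesis
  proof (cases "Suc N mod m = 0")
    case True
    have "?A * (\<Sum>i<workers p. 1 / 2 ^ Q + 1 / 2 ^ Q) \<le> next_potential N \<omega>"
      unfolding next_potential_def using fg_ge[of 0] gg_ge[of 0]
      by (intro mult_left_mono sum_mono add_mono) simp_all
    then have "2 ^ (2 * Q) * (?A * (2 * ?n / 2 ^ Q)) \<le> 2 ^ (2 * Q) * next_potential N \<omega>"
      by (intro mult_left_mono) (simp_all add: mult.commute)
    moreover have "2 ^ (2 * Q) * (?A * (2 * ?n / 2 ^ Q)) = ?A * 2 ^ Q * (2 * ?n)"
      by (simp add: two)
    ultimately show ?thesis using upper True by simp
  next
    case False
    then obtain i where i: "i < workers p" "4 * Q \<le> ?r i \<or> 4 * Q \<le> ?w i"
      using \<open>advance N \<omega>\<close> by (auto simp: advance_def)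
    have nonneg: "?f i \<ge> 0" "?g i \<ge> 0" for i using decay_nonneg by simp_all
    have "2 ^ (4 * Q) / 2 ^ Q \<le> ?f i + ?g i"
      using i(2) fg_ge[of "4 * Q" i] gg_ge[of "4 * Q" i] nonneg[of i] by linarith
    also have "\<dots> \<le> (\<Sum>i<workers p. ?f i + ?g i)"
      using i(1) nonneg by (intro member_le_sum) (simp_all add: add_nonneg_nonneg)
    finally have sum: "2 ^ (4 * Q) / 2 ^ Q \<le> (\<Sum>i<workers p. ?f i + ?g i)" .
    have "2 * ?n \<le> 2 ^ Q * 2 ^ Q"
    proof (intro mult_mono)
      show "(2::real) \<le> 2 ^ Q" using Q power_increasing[of 1 Q "2::real"] by simp
      have "real (workers p) \<le> real (2 ^ Q)" using workers_le by (rule of_nat_mono)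
      then show "?n \<le> 2 ^ Q" by simp
    qed simp_all
    then have "2 ^ Q * (2 * ?n) \<le> 2 ^ Q * (2 ^ Q * 2 ^ Q)" by (intro mult_left_mono) auto
    also have "\<dots> = (2::real) ^ (4 * Q) / 2 ^ Q"
    proof -
      have "4 * Q = Q + Q + Q + Q" by simp
      then have "(2::real) ^ (4 * Q) = 2 ^ Q * 2 ^ Q * 2 ^ Q * 2 ^ Q" by (simp only: power_add)
      then show ?thesis by simp
    qed
    also note sum
    finally have "?A * (2 ^ Q * (2 * ?n)) \<le> next_potential N \<omega>"
      unfolding next_potential_def by (intro mult_left_mono) auto
    then show ?thesis using upper False by (simp add: mult.assoc)
  qed
qed

lemma expected_potential:
  "(\<integral>\<^sup>+\<omega>. ennreal (potential N \<omega>) \<partial>M) \<le> ennreal (2 * workers p * 2 ^ (2 * Q * (N div m)))"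
proof (induction N)
  case 0
  have "potential 0 \<omega> = 2 * workers p" for \<omega>
    by (simp add: potential_def decay_def decay'_def)
  then show ?case by (simp add: M.emeasure_space_1)
next
  case (Suc N)
  let ?c = "if Suc N mod m = 0 then 2 ^ (2 * Q) else 1 :: real"
  have meas: "(\<lambda>\<omega>. ennreal (next_potential N \<omega>)) \<in> borel_measurable M"
  proof -
    have [measurable]: "(\<lambda>\<omega>. real (2 ^ (received i N \<omega> + hits i N (level N \<omega>) \<omega>))) \<in> borel_measurable M"
      "(\<lambda>\<omega>. real (2 ^ (won i N \<omega> + wins i N \<omega>))) \<in> borel_measurable M" if i: "i < workers p" for i
    proof -
      note [measurable] = next_counters_measurable[OF i]
      show "(\<lambda>\<omega>. real (2 ^ (received i N \<omega> + hits i N (level N \<omega>) \<omega>))) \<in> borel_measurable M"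
        "(\<lambda>\<omega>. real (2 ^ (won i N \<omega> + wins i N \<omega>))) \<in> borel_measurable M" by measurable
    qed
    have eq: "next_potential N \<omega> = 2 ^ (Q * level N \<omega>) * (\<Sum>i<workers p.
       decay i N * exp (- rate i N) * real (2 ^ (received i N \<omega> + hits i N (level N \<omega>) \<omega>)) +
       decay' N * exp (- rate' N) * real (2 ^ (won i N \<omega> + wins i N \<omega>)))" for \<omega>
      by (simp add: next_potential_def)
    show ?thesis unfolding eq by measurable
  qed
  have "(\<integral>\<^sup>+\<omega>. ennreal (potential (Suc N) \<omega>) \<partial>M) \<le> (\<integral>\<^sup>+\<omega>. ennreal ?c * ennreal (next_potential N \<omega>) \<partial>M)"
  proof (intro nn_integral_mono)
    fix \<omega>
    have "ennreal (potential (Suc N) \<omega>) \<le> ennreal (?c * next_potential N \<omega>)"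
      by (intro ennreal_leI potential_Suc_le)
    then show "ennreal (potential (Suc N) \<omega>) \<le> ennreal ?c * ennreal (next_potential N \<omega>)"
      by (simp add: ennreal_mult')
  qed
  also have "\<dots> = ennreal ?c * (\<integral>\<^sup>+\<omega>. ennreal (next_potential N \<omega>) \<partial>M)"
    using meas by (rule nn_integral_cmult)
  also have "\<dots> \<le> ennreal ?c * ennreal (2 * workers p * 2 ^ (2 * Q * (N div m)))"
    by (intro mult_left_mono order_trans[OF expected_next_potential Suc.IH]) simp
  also have "\<dots> = ennreal (?c * (2 * workers p * 2 ^ (2 * Q * (N div m))))"
    by (simp add: ennreal_mult')
  also have "?c * (2 * workers p * 2 ^ (2 * Q * (N div m))) = 2 * workers p * 2 ^ (2 * Q * (Suc N div m))"
    by (simp add: div_Suc power_add)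
  finally show ?case .
qed

text \<open>Markov's inequality: at level \<open>B\<close> the potential is at least
  \<open>2 ^ (Q * B) * (2 * n / 2 ^ Q)\<close>. Of the two spare levels in the assumption, one pays
  for this discount and the other makes the probability at most \<open>1 / 2 ^ Q\<close>.\<close>

lemma level_tail:
  assumes "2 * (N div m) + 2 \<le> B"
  shows "M.prob {\<omega> \<in> space M. B \<le> level N \<omega>} \<le> 1 / 2"
proof -
  let ?E = "{\<omega> \<in> space M. B \<le> level N \<omega>}" and ?n = "real (workers p)"
  have n: "?n > 0" using workers_pos by simp
  let ?c = "2 ^ (Q * B) * (2 * ?n / 2 ^ Q)"
  have low: "?c \<le> potential N \<omega>" if "B \<le> level N \<omega>" for \<omega>
  proof -
    have d: "1 / 2 ^ Q \<le> decay i N * 2 ^ received i N \<omega>" "1 / 2 ^ Q \<le> decay' N * 2 ^ won i N \<omega>" for i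
    proof -
      have "decay i N * exp (- rate i N) \<le> decay i N * 2 ^ received i N \<omega>"
        "decay' N * exp (- rate' N) \<le> decay' N * 2 ^ won i N \<omega>"
        using rate_nonneg rate'_nonneg decay_nonneg
        by (intro mult_left_mono order_trans[OF _ one_le_power]; simp)+
      then show "1 / 2 ^ Q \<le> decay i N * 2 ^ received i N \<omega>" "1 / 2 ^ Q \<le> decay' N * 2 ^ won i N \<omega>"
        using decay_ge(1)[of i N] decay_ge(2)[of N] by linarith+
    qed
    have "2 ^ (Q * B) * (\<Sum>i<workers p. 1 / 2 ^ Q + 1 / 2 ^ Q) \<le> potential N \<omega>"
      unfolding potential_def using that
      by (intro mult_mono sum_mono add_mono d power_increasing sum_nonneg) simp_all
    then show ?thesis by (simp add: mult.commute)
  qed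
  have E [measurable]: "?E \<in> sets M" by measurable
  have "ennreal ?c * emeasure M ?E = (\<integral>\<^sup>+\<omega>. ennreal ?c * indicator ?E \<omega> \<partial>M)"
    by (simp add: nn_integral_cmult_indicator)
  also have "\<dots> \<le> (\<integral>\<^sup>+\<omega>. ennreal (potential N \<omega>) \<partial>M)"
    using low by (intro nn_integral_mono) (auto split: split_indicator intro: ennreal_leI)
  also note expected_potential
  also have "ennreal ?c * emeasure M ?E = ennreal (?c * M.prob ?E)"
    unfolding M.emeasure_eq_measure using n by (intro ennreal_mult'[symmetric]) simp
  finally have "ennreal (?c * M.prob ?E) \<le> ennreal (2 * workers p * 2 ^ (2 * Q * (N div m)))" .
  then have "?c * M.prob ?E \<le> 2 * workers p * 2 ^ (2 * Q * (N div m))" by (subst (asm) ennreal_le_iff) auto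
  then have "2 * ?n * (2 ^ (Q * B) * M.prob ?E) \<le> 2 * ?n * (2 ^ (2 * Q * (N div m)) * 2 ^ Q)"
    by (simp add: field_simps)
  then have le: "2 ^ (Q * B) * M.prob ?E \<le> 2 ^ (2 * Q * (N div m)) * 2 ^ Q"
    using n by (subst (asm) mult_le_cancel_left_pos) auto
  have "(2::real) * (2 ^ (2 * Q * (N div m)) * 2 ^ Q) \<le> 2 ^ Q * (2 ^ (2 * Q * (N div m)) * 2 ^ Q)"
    using Q power_increasing[of 1 Q "2::real"] by (intro mult_right_mono) auto
  also have "\<dots> = 2 ^ (Q * (2 * (N div m) + 2))" by (simp add: power_add[symmetric] algebra_simps)
  also have "\<dots> \<le> 2 ^ (Q * B)" using assms by (intro power_increasing mult_le_mono2) auto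
  finally have "2 * (2 ^ (Q * B) * M.prob ?E) \<le> 2 ^ (Q * B)" using le by linarith
  then have "2 ^ (Q * B) * (2 * M.prob ?E) \<le> 2 ^ (Q * B) * (1::real)" by simp
  then have "2 * M.prob ?E \<le> 1" by (subst (asm) mult_le_cancel_left_pos) auto
  then show ?thesis by simp
qed

end

section \<open>Measurability of the gradient bound\<close>

lemma chain_functions_measurable [measurable]:
  "gate \<in> borel_measurable borel" "gate' \<in> borel_measurable borel"
  "gain \<in> borel_measurable borel" "gain' \<in> borel_measurable borel"
proof -
  have [measurable]: "psq \<in> borel_measurable borel"
    unfolding psq_def[abs_def] by measurable
  show "gate \<in> borel_measurable borel" "gate' \<in> borel_measurable borel"
    unfolding gate_def[abs_def] gate'_def[abs_def] by measurable
  show "gain \<in> borel_measurable borel"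
    unfolding gain_def[abs_def] by (intro borel_measurable_continuous_onI continuous_intros)
  show "gain' \<in> borel_measurable borel"
    unfolding gain'_def[abs_def] by measurable
qed

text \<open>Replaces \<open>Max\<close> by finitely many window conditions, each a condition on
  finitely many coordinates, as needed for measurability.\<close>

lemma front_eq_iff:
  "j = front K T S \<longleftrightarrow> j \<le> T \<and> {j-K..<j} \<subseteq> S \<and> (\<forall>l\<in>{j<..T}. \<not> {l-K..<l} \<subseteq> S)"
proof
  assume "j = front K T S"
  then show "j \<le> T \<and> {j-K..<j} \<subseteq> S \<and> (\<forall>l\<in>{j<..T}. \<not> {l-K..<l} \<subseteq> S)"
    using front_props[of K T S] front_ge[of _ T K S] by force
next
  assume *: "j \<le> T \<and> {j-K..<j} \<subseteq> S \<and> (\<forall>l\<in>{j<..T}. \<not> {l-K..<l} \<subseteq> S)"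
  then have "j \<le> front K T S" by (intro front_ge) auto
  moreover have "\<not> j < front K T S" using * front_props[of K T S] by auto
  ultimately show "j = front K T S" by simp
qed

lemma obj_oracle_measurable:
  "(\<lambda>w. obj_oracle K T \<beta> r q (fst w) (snd w)) \<in> borel_measurable (borel \<Otimes>\<^sub>M borel)"
proof (rule measurable_coordinatewise_then_product)
  fix j
  have [measurable]: "(\<lambda>w. fst w i :: real) \<in> borel_measurable ((borel :: point measure) \<Otimes>\<^sub>M (borel :: real measure))" for i
    by (rule measurable_compose[OF measurable_fst measurable_product_coordinates])
  have [measurable]: "Measurable.pred ((borel :: point measure) \<Otimes>\<^sub>M (borel :: real measure)) (\<lambda>w. {a..<b} \<subseteq> supp (fst w))" for a b
  proof -
    have eq: "{a..<b} \<subseteq> supp (fst w) \<longleftrightarrow> (\<forall>i\<in>{a..<b}. fst w i \<noteq> 0)" for w :: "point \<times> real"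
      by (auto simp: supp_def)
    show ?thesis unfolding eq by measurable
  qed
  have [measurable]: "Measurable.pred ((borel :: point measure) \<Otimes>\<^sub>M (borel :: real measure)) (\<lambda>w. j = front K T (supp (fst w)))"
    unfolding front_eq_iff by measurable
  have [measurable]: "(\<lambda>w. chain_grad K T (\<lambda>j. fst w j / r) j) \<in>
      borel_measurable ((borel :: point measure) \<Otimes>\<^sub>M (borel :: real measure))"
    unfolding chain_grad_def by measurable
  show "(\<lambda>w. obj_oracle K T \<beta> r q (fst w) (snd w) j) \<in>
      borel_measurable ((borel :: point measure) \<Otimes>\<^sub>M (borel :: real measure))"
    unfolding obj_oracle_def obj_grad_def by measurable
qed

section \<open>Measurability of the transcript and of the infimum\<close>

locale measured_run = timed_protocol +
  fixes A :: algorithm and G :: "point \<Rightarrow> real \<Rightarrow> point"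
    and M :: "outcome measure" and T :: "outcome \<Rightarrow> transcript"
  assumes A_meas: "measurable_algorithm A"
    and zr: "zero_respecting A"
    and G_Rd: "\<And>x z. G x z \<in> Rd (dim p)"
    and G_meas: "(\<lambda>w. G (fst w) (snd w)) \<in> borel_measurable (borel \<Otimes>\<^sub>M borel)"
    and sets_M: "sets M = sets (draw_space p (draw_index p) (draw_index p))"
    and runs: "\<And>\<omega>. \<omega> \<in> space M \<Longrightarrow> is_run p A G \<omega> (T \<omega>)"
begin

lemma run_at:
  assumes "\<omega> \<in> space M"
  shows "run p A G (fst \<omega>) (fst (snd \<omega>)) (snd (snd \<omega>)) (T \<omega>)"
proof unfold_locales
  show "is_run p A G (fst \<omega>, fst (snd \<omega>), snd (snd \<omega>)) (T \<omega>)" using runs[OF assms] by simp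
  have \<omega>: "\<omega> \<in> space (draw_space p (draw_index p) (draw_index p))"
    using assms sets_eq_imp_space_eq[OF sets_M] by simp
  show "snd (snd \<omega>) (i, k) \<in> size_subsets (dim p) (down_size p i k)" if "i < workers p" for i k
    using measurable_space[OF measurable_draw_subset \<omega>, of i k] that by (simp add: draw_index_def)
qed (use zr G_Rd in auto)

lemma measurable_M: "measurable M N = measurable (draw_space p (draw_index p) (draw_index p)) N"
  by (rule measurable_cong_sets[OF sets_M refl])

lemma seed_measurable [measurable]: "fst \<in> borel_measurable M"
  unfolding measurable_M by (rule measurable_draw_seed)

text \<open>\<open>T\<close> is any pointwise choice of runs, so its measurability has to be drawn
  from the run equations. In cells no longer than any computation or nonempty message, uploads
  included, a view only contains zero vectors and vectors whose production started in an earlier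
  cell.\<close>

lemma transcript_measurable_step:
  fixes \<delta> :: real and N :: nat
  assumes \<delta>: "\<delta> > 0" "\<delta> \<le> grad_time p" "\<delta> \<le> down_coord_time p" "\<delta> \<le> up_coord_time p"
  shows "\<forall>i<workers p. \<forall>k.
     (real k * grad_time p < N * \<delta> \<longrightarrow> (\<lambda>\<omega>. grads (T \<omega>) i k) \<in> borel_measurable M) \<and>
     (up_time p i k < N * \<delta> \<longrightarrow> (\<lambda>\<omega>. ups (T \<omega>) i k) \<in> borel_measurable M) \<and>
     (down_time p i k < N * \<delta> \<longrightarrow> (\<lambda>\<omega>. downs (T \<omega>) i k) \<in> borel_measurable M)"
proof (induction N)
  case 0
  have "up_time p i k \<ge> 0" "down_time p i k \<ge> 0" for i k
    using up_time_pos down_time_pos by (simp_all add: up_time_def down_time_def sum_nonneg)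
  then show ?case using grad_time_pos by (simp add: not_less[symmetric] mult_less_0_iff)
next
  case (Suc N)
  have cell: "s < N * \<delta>" if "s + a \<le> t" "t < Suc N * \<delta>" "\<delta> \<le> a" for s a t
    using that by (simp add: algebra_simps)
  have V: "(\<lambda>\<omega>. fst (worker_view p (T \<omega>) i t)) \<in> borel_measurable M"
    if i: "i < workers p" and t: "t < Suc N * \<delta>" for i t
    unfolding worker_view_def fst_conv
  proof (rule measurable_coordinatewise_then_product)
    fix k
    show "(\<lambda>\<omega>. if real (Suc k) * grad_time p \<le> t then grads (T \<omega>) i k else (\<lambda>_. 0)) \<in> borel_measurable M"
    proof (cases "real (Suc k) * grad_time p \<le> t")
      case True
      then have "real k * grad_time p < N * \<delta>"
        using t \<delta>(2) by (intro cell[of _ "grad_time p" t]) (simp_all add: algebra_simps)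
      then show ?thesis using Suc i True by simp
    qed simp
  qed
  have W: "(\<lambda>\<omega>. snd (worker_view p (T \<omega>) i t)) \<in> borel_measurable M"
    if i: "i < workers p" and t: "t < Suc N * \<delta>" for i t
    unfolding worker_view_def snd_conv
  proof (rule measurable_coordinatewise_then_product)
    fix k
    show "(\<lambda>\<omega>. if down_time p i (Suc k) \<le> t then downs (T \<omega>) i k else (\<lambda>_. 0)) \<in> borel_measurable M"
    proof (cases "down_time p i (Suc k) \<le> t")
      case True
      show ?thesis
      proof (cases "down_size p i k = 0")
        case zero: True
        have "(\<lambda>\<omega>. downs (T \<omega>) i k) \<in> borel_measurable M \<longleftrightarrow> (\<lambda>\<omega>. (\<lambda>_. 0) :: point) \<in> borel_measurable M"
          by (rule measurable_cong) (rule run.downs_zero[OF run_at i zero])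
        then show ?thesis using True by simp
      next
        case False
        then have "down_coord_time p * 1 \<le> down_coord_time p * down_size p i k"
          using down_time_pos by (intro mult_left_mono) auto
        then have "down_time p i k < N * \<delta>"
          using t True \<delta>(3) by (intro cell[of _ "down_coord_time p * down_size p i k" t])
            (simp_all add: down_time_Suc)
        then show ?thesis using Suc i True by simp
      qed
    qed simp
  qed
  have view: "(\<lambda>\<omega>. (fst \<omega>, worker_view p (T \<omega>) i t)) \<in> borel_measurable M"
    if "i < workers p" "t < Suc N * \<delta>" for i t
  proof -
    note [measurable] = V[OF that] W[OF that]
    have "(\<lambda>\<omega>. (fst \<omega>, fst (worker_view p (T \<omega>) i t), snd (worker_view p (T \<omega>) i t))) \<in> borel_measurable M"
      by (intro borel_measurable_Pair) measurable
    then show ?thesis by simp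
  qed
  have server: "(\<lambda>\<omega>. (fst \<omega>, server_view p (T \<omega>) t)) \<in> borel_measurable M"
    if t: "t < Suc N * \<delta>" for t
  proof (intro borel_measurable_Pair seed_measurable, rule measurable_coordinatewise_then_product,
      rule measurable_coordinatewise_then_product)
    fix i k
    show "(\<lambda>\<omega>. server_view p (T \<omega>) t i k) \<in> borel_measurable M"
    proof (cases "i < workers p \<and> up_time p i (Suc k) \<le> t")
      case True
      show ?thesis
      proof (cases "up_size p i k = 0")
        case zero: True
        have "(\<lambda>\<omega>. ups (T \<omega>) i k) \<in> borel_measurable M \<longleftrightarrow> (\<lambda>\<omega>. (\<lambda>_. 0) :: point) \<in> borel_measurable M"
          using True zero by (intro measurable_cong) (auto intro: run.ups_zero[OF run_at])
        then show ?thesis using True by (simp add: server_view_def)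
      next
        case False
        then have "up_coord_time p * 1 \<le> up_coord_time p * up_size p i k"
          using up_time_pos by (intro mult_left_mono) auto
        then have "up_time p i k < N * \<delta>"
          using t True \<delta>(4) by (intro cell[of _ "up_coord_time p * up_size p i k" t])
            (simp_all add: up_time_Suc)
        then show ?thesis using Suc True by (simp add: server_view_def)
      qed
    next
      case False
      then have "server_view p (T \<omega>) t i k = (\<lambda>_. 0)" for \<omega> by (auto simp: server_view_def)
      then show ?thesis by simp
    qed
  qed
  have alg: "query A i k \<in> borel_measurable borel" "to_server A i k \<in> borel_measurable borel"
    "to_worker A i k \<in> borel_measurable borel" for i k
    using A_meas by (simp_all add: measurable_algorithm_def)
  show ?case
  proof (intro allI impI conjI)
    fix i k assume i: "i < workers p"
    have ik: "(i, k) \<in> draw_index p" using i by (simp add: draw_index_def)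
    show "(\<lambda>\<omega>. grads (T \<omega>) i k) \<in> borel_measurable M" if t: "real k * grad_time p < Suc N * \<delta>"
    proof -
      have "(\<lambda>\<omega>. query A i k (fst \<omega>, worker_view p (T \<omega>) i (real k * grad_time p))) \<in> borel_measurable M"
        by (rule measurable_compose[OF view[OF i t] alg(1)])
      moreover have "(\<lambda>\<omega>. fst (snd \<omega>) (i, k)) \<in> borel_measurable M"
        unfolding measurable_M by (rule measurable_draw_oracle[OF ik])
      ultimately have "(\<lambda>\<omega>. (query A i k (fst \<omega>, worker_view p (T \<omega>) i (real k * grad_time p)), fst (snd \<omega>) (i, k)))
          \<in> measurable M (borel \<Otimes>\<^sub>M borel)" by (rule measurable_Pair)
      from measurable_compose[OF this G_meas] have
        "(\<lambda>\<omega>. G (query A i k (fst \<omega>, worker_view p (T \<omega>) i (real k * grad_time p))) (fst (snd \<omega>) (i, k)))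
          \<in> borel_measurable M" by simp
      then show ?thesis
        by (subst measurable_cong[OF run.grads_eq[OF run_at i]])
    qed
    show "(\<lambda>\<omega>. ups (T \<omega>) i k) \<in> borel_measurable M" if t: "up_time p i k < Suc N * \<delta>"
    proof -
      have "(\<lambda>\<omega>. to_server A i k (fst \<omega>, worker_view p (T \<omega>) i (up_time p i k))) \<in> borel_measurable M"
        by (rule measurable_compose[OF view[OF i t] alg(2)])
      then have "(\<lambda>\<omega>. (fst \<omega>, to_server A i k (fst \<omega>, worker_view p (T \<omega>) i (up_time p i k)))) \<in> borel_measurable M"
        by (intro borel_measurable_Pair seed_measurable)
      moreover have "up_comp p i k \<in> borel_measurable borel"
        using valid i by (simp add: valid_protocol_def)
      ultimately have "(\<lambda>\<omega>. up_comp p i k (fst \<omega>, to_server A i k (fst \<omega>, worker_view p (T \<omega>) i (up_time p i k))))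
          \<in> borel_measurable M" by (rule measurable_compose)
      then show ?thesis
        by (subst measurable_cong[OF run.ups_eq[OF run_at i]])
    qed
    show "(\<lambda>\<omega>. downs (T \<omega>) i k) \<in> borel_measurable M" if t: "down_time p i k < Suc N * \<delta>"
    proof -
      have tw: "(\<lambda>\<omega>. to_worker A i k (fst \<omega>, server_view p (T \<omega>) (down_time p i k))) \<in> borel_measurable M"
        by (rule measurable_compose[OF server[OF t] alg(3)])
      have [measurable]: "(\<lambda>\<omega>. to_worker A i k (fst \<omega>, server_view p (T \<omega>) (down_time p i k)) j) \<in> borel_measurable M" for j
        by (rule measurable_compose[OF tw measurable_product_coordinates])
      have sub: "(\<lambda>\<omega>. snd (snd \<omega>) (i, k)) \<in> measurable M (count_space (size_subsets (dim p) (down_size p i k)))"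
        unfolding measurable_M by (rule measurable_draw_subset[OF ik])
      have [measurable]: "Measurable.pred M (\<lambda>\<omega>. j \<in> snd (snd \<omega>) (i, k))" for j
        by (rule measurable_compose[OF sub]) simp
      have "(\<lambda>\<omega> j. if j \<in> snd (snd \<omega>) (i, k) then down_scale p i k j *
          to_worker A i k (fst \<omega>, server_view p (T \<omega>) (down_time p i k)) j else 0) \<in> borel_measurable M"
        by (rule measurable_coordinatewise_then_product) measurable
      then show ?thesis
        by (subst measurable_cong[OF run.downs_eq[OF run_at i]])
    qed
  qed
qed

lemma transcript_measurable:
  assumes i: "i < workers p"
  shows "(\<lambda>\<omega>. grads (T \<omega>) i k) \<in> borel_measurable M"
    and "(\<lambda>\<omega>. ups (T \<omega>) i k) \<in> borel_measurable M"
    and "(\<lambda>\<omega>. downs (T \<omega>) i k) \<in> borel_measurable M"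
proof -
  define \<delta> where "\<delta> = min (grad_time p) (min (down_coord_time p) (up_coord_time p))"
  have \<delta>: "\<delta> > 0" "\<delta> \<le> grad_time p" "\<delta> \<le> down_coord_time p" "\<delta> \<le> up_coord_time p"
    using grad_time_pos down_time_pos up_time_pos by (auto simp: \<delta>_def)
  have N: "\<exists>N::nat. s < N * \<delta>" for s
    using reals_Archimedean3[OF \<delta>(1)] by blast
  note step = transcript_measurable_step[OF \<delta>, rule_format, OF i]
  show "(\<lambda>\<omega>. grads (T \<omega>) i k) \<in> borel_measurable M" using N step by blast
  show "(\<lambda>\<omega>. ups (T \<omega>) i k) \<in> borel_measurable M" using N step by blast
  show "(\<lambda>\<omega>. downs (T \<omega>) i k) \<in> borel_measurable M" using N step by blast
qed

text \<open>The knowledge of the server (index 0) and of worker \<open>i\<close> (index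
  \<open>Suc i\<close>), as one element of a finite set. The constructible points depend on the
  outcome only through it, so an infimum over them is measurable for an arbitrary
  \<open>F\<close>.\<close>

definition code :: "real \<Rightarrow> outcome \<Rightarrow> (nat \<times> nat) set" where
  "code t \<omega> = {0} \<times> ((\<Union>y\<in>server_info p (T \<omega>) t. supp y) \<inter> {..<dim p}) \<union>
     (SIGMA i:Suc ` {..<workers p}. know p (T \<omega>) (i - 1) t \<inter> {..<dim p})"

lemma code_measurable:
  "code t \<in> measurable M (count_space (Pow ({..workers p} \<times> {..<dim p})))"
proof -
  let ?F = "{..workers p} \<times> {..<dim p}"
  have coord: "(\<lambda>\<omega>. grads (T \<omega>) i k j) \<in> borel_measurable M"
    "(\<lambda>\<omega>. ups (T \<omega>) i k j) \<in> borel_measurable M"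
    "(\<lambda>\<omega>. downs (T \<omega>) i k j) \<in> borel_measurable M" if "i < workers p" for i k j
    by (rule measurable_compose[OF transcript_measurable(1)[OF that] measurable_product_coordinates])
      (rule measurable_compose[OF transcript_measurable(2)[OF that] measurable_product_coordinates],
       rule measurable_compose[OF transcript_measurable(3)[OF that] measurable_product_coordinates])
  have server: "Measurable.pred M (\<lambda>\<omega>. j \<in> (\<Union>y\<in>server_info p (T \<omega>) t. supp y))" for j
  proof -
    have eq: "j \<in> (\<Union>y\<in>server_info p (T \<omega>) t. supp y) \<longleftrightarrow>
        (\<exists>i\<in>{..<workers p}. \<exists>k. up_time p i (Suc k) \<le> t \<and> ups (T \<omega>) i k j \<noteq> 0)" for \<omega>
      by (auto simp: server_info_def supp_def)
    note [measurable] = coord(2)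
    show ?thesis unfolding eq by measurable
  qed
  have worker: "Measurable.pred M (\<lambda>\<omega>. j \<in> know p (T \<omega>) i t)" if i: "i < workers p" for i j
  proof -
    have eq: "j \<in> know p (T \<omega>) i t \<longleftrightarrow>
        (\<exists>k. real (Suc k) * grad_time p \<le> t \<and> grads (T \<omega>) i k j \<noteq> 0) \<or>
        (\<exists>k. down_time p i (Suc k) \<le> t \<and> downs (T \<omega>) i k j \<noteq> 0)" for \<omega>
      unfolding know_def worker_info_def supp_def by blast
    note [measurable] = coord(1,3)[OF i]
    show ?thesis unfolding eq by measurable
  qed
  have mem: "Measurable.pred M (\<lambda>\<omega>. z \<in> code t \<omega>)" for z
  proof -
    obtain l j where z: "z = (l, j)" by (cases z)
    show ?thesis
    proof (cases l)
      case 0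
      have "z \<in> code t \<omega> \<longleftrightarrow> j < dim p \<and> j \<in> (\<Union>y\<in>server_info p (T \<omega>) t. supp y)" for \<omega>
        by (auto simp: z 0 code_def)
      then show ?thesis using server[of j] by simp
    next
      case (Suc i)
      have "z \<in> code t \<omega> \<longleftrightarrow> i < workers p \<and> j < dim p \<and> j \<in> know p (T \<omega>) i t" for \<omega>
        by (auto simp: z Suc code_def)
      then show ?thesis using worker[of i j] by (cases "i < workers p") simp_all
    qed
  qed
  show ?thesis
  proof (subst measurable_count_space_eq2)
    show "finite (Pow ?F)" by simp
    have sub: "code t \<omega> \<subseteq> ?F" for \<omega> by (auto simp: code_def)
    show "code t \<in> space M \<rightarrow> Pow ?F \<and> (\<forall>a\<in>Pow ?F. code t -` {a} \<inter> space M \<in> sets M)"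
    proof (intro conjI ballI)
      fix a assume a: "a \<in> Pow ?F"
      have eq: "code t -` {a} \<inter> space M = {\<omega> \<in> space M. \<forall>z\<in>?F. (z \<in> code t \<omega>) = (z \<in> a)}"
      proof -
        have "(code t \<omega> = a) = (\<forall>z\<in>?F. (z \<in> code t \<omega>) = (z \<in> a))" for \<omega>
        proof
          assume *: "\<forall>z\<in>?F. (z \<in> code t \<omega>) = (z \<in> a)"
          show "code t \<omega> = a"
          proof (rule set_eqI)
            show "(z \<in> code t \<omega>) = (z \<in> a)" for z
              using * sub[of \<omega>] a by (cases "z \<in> ?F") blast+
          qed
        qed simp
        then show ?thesis by (simp add: vimage_def Int_def conj_commute)
      qed
      have "{\<omega> \<in> space M. (z \<in> code t \<omega>) = (z \<in> a)} \<in> sets M" for z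
      proof -
        have m: "{\<omega> \<in> space M. z \<in> code t \<omega>} \<in> sets M"
          by (rule predE[OF mem[of z]])
        show ?thesis
        proof (cases "z \<in> a")
          case True
          then show ?thesis using m by simp
        next
          case False
          then show ?thesis using sets.sets_Collect_neg[OF m] by simp
        qed
      qed
      then show "code t -` {a} \<inter> space M \<in> sets M"
        unfolding eq by (rule sets.sets_Collect_finite_All) simp_all
    qed (use sub in auto)
  qed
qed

lemma INF_constructible_measurable:
  fixes F :: "point \<Rightarrow> real"
  shows "(\<lambda>\<omega>. INF y\<in>constructible p (T \<omega>) t. F y) \<in> borel_measurable M"
proof -
  define S where "S = (\<lambda>C. {x \<in> Rd (dim p). supp x \<subseteq> {j. (0, j) \<in> C} \<or>
     (\<exists>i<workers p. supp x \<subseteq> {j. (Suc i, j) \<in> C})})"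
  have eq: "constructible p (T \<omega>) t = S (code t \<omega>)" for \<omega>
  proof -
    have bound: "supp x \<subseteq> {..<dim p}" if "x \<in> Rd (dim p)" for x
      using that by (auto simp: Rd_def supp_def not_le[symmetric])
    have "{j. (0, j) \<in> code t \<omega>} = (\<Union>y\<in>server_info p (T \<omega>) t. supp y) \<inter> {..<dim p}"
      by (auto simp: code_def)
    moreover have "{j. (Suc i, j) \<in> code t \<omega>} = know p (T \<omega>) i t \<inter> {..<dim p}" if "i < workers p" for i
      using that by (auto simp: code_def)
    ultimately show ?thesis
      unfolding constructible_def S_def know_def[symmetric]
      by (intro Collect_cong conj_cong refl) (simp add: bound cong: conj_cong)
  qed
  show ?thesis unfolding eq
    by (rule measurable_compose[OF code_measurable]) simp
qed

text \<open>The Bochner integral of a non-integrable function is 0, so integrability is essential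
  here. The zero vector is always constructible, which bounds the infimum by the constant
  \<open>F (\<lambda>_. 0)\<close>.\<close>

lemma expectation_INF_ge:
  fixes F :: "point \<Rightarrow> real"
  assumes "prob_space M" and F: "\<And>y. F y \<ge> 0" and c: "c \<ge> 0"
    and E: "E \<in> sets M" and low: "\<And>\<omega> y. \<omega> \<in> E \<Longrightarrow> y \<in> constructible p (T \<omega>) t \<Longrightarrow> c \<le> F y"
  shows "c * measure M E \<le> (\<integral>\<omega>. (INF y\<in>constructible p (T \<omega>) t. F y) \<partial>M)"
proof -
  interpret prob_space M by fact
  have zero: "(\<lambda>_. 0) \<in> constructible p (T \<omega>) t" for \<omega>
    by (simp add: constructible_def supp_def)
  have bdd: "bdd_below (F ` constructible p (T \<omega>) t)" for \<omega> by (rule bdd_belowI2[OF F])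
  have nonneg: "0 \<le> (INF y\<in>constructible p (T \<omega>) t. F y)" for \<omega>
    using zero[of \<omega>] F by (intro cINF_greatest) auto
  have upper: "(INF y\<in>constructible p (T \<omega>) t. F y) \<le> F (\<lambda>_. 0)" for \<omega>
    by (rule cINF_lower[OF bdd zero])
  have int: "integrable M (\<lambda>\<omega>. INF y\<in>constructible p (T \<omega>) t. F y)"
    using nonneg upper by (intro integrable_const_bound[where B = "F (\<lambda>_. 0)"] INF_constructible_measurable) auto
  have "c * measure M E = (\<integral>\<omega>. c * indicator E \<omega> \<partial>M)" using E by simp
  also have "\<dots> \<le> (\<integral>\<omega>. (INF y\<in>constructible p (T \<omega>) t. F y) \<partial>M)"
  proof (rule integral_mono[OF _ int])
    show "integrable M (\<lambda>\<omega>. c * indicator E \<omega>)"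
      using E by (intro integrable_mult_right integrable_real_indicator) (auto simp: emeasure_eq_measure)
    fix \<omega> assume "\<omega> \<in> space M"
    show "c * indicator E \<omega> \<le> (INF y\<in>constructible p (T \<omega>) t. F y)"
    proof (cases "\<omega> \<in> E")
      case True
      then have "c \<le> (INF y\<in>constructible p (T \<omega>) t. F y)"
        using zero[of \<omega>] low by (intro cINF_greatest) auto
      then show ?thesis using True by simp
    qed (use nonneg in simp)
  qed
  finally show ?thesis .
qed

end

section \<open>The lower bound\<close>

text \<open>\<open>8 * Q * B\<close> is the last coordinate of the chain; below level
  \<open>B\<close> it lies past every block reached. The bound \<open>\<beta>\<^sup>2 / 4\<close>
  then holds with probability at least 1/2.\<close>

lemma (in schedule) expected_gradient_ge:
  fixes B :: nat
  assumes A: "measurable_algorithm A" "zero_respecting A"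
    and r_pos: "r > 0" and \<beta>: "\<beta> \<ge> 0" and dim: "8 * Q * B + 1 \<le> dim p" and B: "B \<ge> 3"
    and law: "run_law p (coin q) M"
    and runs: "\<And>\<omega>. \<omega> \<in> space M \<Longrightarrow> is_run p A (obj_oracle (8 * Q) (8 * Q * B + 1) \<beta> r q) \<omega> (T \<omega>)"
    and t: "16 * t \<le> B * (m * \<delta>)"
  shows "\<beta>\<^sup>2 / 8 \<le> (\<integral>\<omega>. (INF y\<in>constructible p (T \<omega>) t.
    (enorm (dim p) (grad (dim p) (obj (8 * Q) (8 * Q * B + 1) \<beta> r) y))\<^sup>2) \<partial>M)"
proof -
  let ?T = "8 * Q * B + 1"
  interpret scheduled_law p Q m \<delta> q M
    by unfold_locales (rule law)
  interpret measured_run p A "obj_oracle (8 * Q) ?T \<beta> r q" M T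
    using A dim runs sets_M by unfold_locales (auto intro: obj_oracle_Rd obj_oracle_measurable)
  \<comment> \<open>The cell that contains \<open>t\<close>; negative times fall back to cell
    0.\<close>
  define N where "N = nat \<lfloor>t / \<delta>\<rfloor>"
  have tN: "t < Suc N * \<delta>"
  proof -
    have "t / \<delta> < Suc N" unfolding N_def by linarith
    then show ?thesis using \<delta>_pos by (simp only: pos_divide_less_eq)
  qed
  have "2 * (N div m) + 2 \<le> B"
  proof (cases "t \<ge> 0")
    case True
    have "real (N div m) \<le> real N / real m" by (rule of_nat_div_le_of_nat)
    also have "\<dots> \<le> (t / \<delta>) / m"
    proof (rule divide_right_mono)
      show "real N \<le> t / \<delta>" unfolding N_def using True \<delta>_pos by simp
    qed simp
    also have "\<dots> \<le> B / 16"
      using t m \<delta>_pos by (simp add: field_simps)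
    finally have "16 * (N div m) \<le> B" by linarith
    then show ?thesis using B by linarith
  next
    case False
    then have "t / \<delta> < 0" using \<delta>_pos by (simp add: divide_neg_pos)
    then have "N = 0" unfolding N_def by simp
    then show ?thesis using B by simp
  qed
  then have tail: "M.prob {\<omega> \<in> space M. B \<le> level N \<omega>} \<le> 1 / 2" by (rule level_tail)
  let ?E = "{\<omega> \<in> space M. level N \<omega> < B}"
  have E: "?E \<in> sets M" by measurable
  have "?E = space M - {\<omega> \<in> space M. B \<le> level N \<omega>}" by auto
  then have "M.prob ?E = 1 - M.prob {\<omega> \<in> space M. B \<le> level N \<omega>}"
    using M.prob_compl[of "{\<omega> \<in> space M. B \<le> level N \<omega>}"] by simp
  then have "1 / 2 \<le> M.prob ?E" using tail by simp
  then have "\<beta>\<^sup>2 / 4 * (1 / 2) \<le> \<beta>\<^sup>2 / 4 * M.prob ?E" by (intro mult_left_mono) auto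
  also have "\<dots> \<le> (\<integral>\<omega>. (INF y\<in>constructible p (T \<omega>) t.
    (enorm (dim p) (grad (dim p) (obj (8 * Q) ?T \<beta> r) y))\<^sup>2) \<partial>M)"
  proof (rule expectation_INF_ge[OF M.prob_space_axioms _ _ E])
    fix \<omega> y assume \<omega>: "\<omega> \<in> ?E" and y: "y \<in> constructible p (T \<omega>) t"
    interpret run p A "obj_oracle (8 * Q) ?T \<beta> r q" "fst \<omega>" "fst (snd \<omega>)" "snd (snd \<omega>)" "T \<omega>"
      using \<omega> by (intro run_at) simp
    interpret scheduled_run p Q m \<delta> q A "obj_oracle (8 * Q) ?T \<beta> r q"
      "fst \<omega>" "fst (snd \<omega>)" "snd (snd \<omega>)" "T \<omega>" ?T \<beta> r
      using r_pos by unfold_locales auto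
    have "supp y \<subseteq> {..<8 * Q * Suc (level N \<omega>)}"
      using constructible_level[OF y tN] by simp
    moreover have "8 * Q * Suc (level N \<omega>) \<le> 8 * Q * B"
      using \<omega> by (intro mult_le_mono2) simp
    ultimately have "8 * Q * B \<notin> supp y" by (metis lessThan_iff not_le subsetD)
    then have "y (8 * Q * B) = 0" by (simp add: supp_def)
    then have "\<beta>\<^sup>2 / 4 \<le> (enorm (dim p) (obj_grad (8 * Q) ?T \<beta> r y))\<^sup>2"
      using dim \<beta> by (intro obj_grad_large[of ?T _ "8 * Q * B"]) auto
    moreover have "y \<in> Rd (dim p)" using y by (simp add: constructible_def)
    then have "grad (dim p) (obj (8 * Q) ?T \<beta> r) y = obj_grad (8 * Q) ?T \<beta> r y"
      using Q r_pos \<beta> dim by (intro grad_obj) auto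
    ultimately show "\<beta>\<^sup>2 / 4 \<le> (enorm (dim p) (grad (dim p) (obj (8 * Q) ?T \<beta> r) y))\<^sup>2" by simp
  qed simp_all
  finally show ?thesis by simp
qed

text \<open>The witness is \<open>k + 4\<close> with the least \<open>k\<close> such that
  \<open>n \<le> 2 ^ k\<close>. Since \<open>ln (n + 1) \<ge> 2 / 3\<close>, the additive constants
  are absorbed: \<open>5 + 3 / 2 * l \<le> 9 * l\<close>.\<close>

lemma block_exponent_exists:
  fixes n :: nat
  assumes "n \<ge> 1"
  shows "\<exists>Q. Q \<ge> 4 \<and> n \<le> 2 ^ Q \<and> ln (real n + 1) \<le> real Q \<and> real Q \<le> 9 * ln (real n + 1)"
proof -
  let ?l = "ln (real n + 1)"
  have l: "2 / 3 \<le> ?l"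
  proof -
    have "ln 2 \<le> ?l" using assms by simp
    then show ?thesis using ln2_ge_two_thirds by linarith
  qed
  define k where "k = (LEAST k. n \<le> 2 ^ k)"
  have "n \<le> 2 ^ n" using less_exp[of n] by simp
  then have k: "n \<le> 2 ^ k" unfolding k_def by (rule LeastI)
  have "real k \<le> 1 + 3 / 2 * ?l"
  proof (cases k)
    case (Suc j)
    then have "\<not> n \<le> 2 ^ j" using not_less_Least[of j "\<lambda>k. n \<le> 2 ^ k"] by (simp add: k_def)
    then have "real (2 ^ j) \<le> real n" by (intro of_nat_mono) simp
    then have "(2::real) ^ j \<le> real n + 1" unfolding of_nat_power of_nat_numeral by linarith
    then have "ln ((2::real) ^ j) \<le> ?l" by (subst ln_le_cancel_iff) auto
    then have "real j * ln 2 \<le> ?l" by (simp add: ln_realpow)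
    moreover have "real j * (2 / 3) \<le> real j * ln 2" by (intro mult_left_mono ln2_ge_two_thirds) simp
    ultimately show ?thesis using Suc by simp
  qed (use l in simp)
  moreover have "?l \<le> real k + 1"
  proof -
    have "real n \<le> real (2 ^ k)" using k by (rule of_nat_mono)
    then have "real n + 1 \<le> 2 ^ Suc k"
      using one_le_power[of "2::real" k] unfolding of_nat_power of_nat_numeral power_Suc by linarith
    then have "?l \<le> ln (2 ^ Suc k)" by (subst ln_le_cancel_iff) auto
    also have "\<dots> = real (Suc k) * ln 2" by (simp add: ln_realpow del: power_Suc)
    also have "\<dots> \<le> real (Suc k) * 1" using ln_2_less_1 by (intro mult_left_mono) auto
    finally show ?thesis by simp
  qed
  moreover have "n \<le> 2 ^ (k + 4)"
    by (rule order_trans[OF k]) (rule power_increasing; simp)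
  ultimately show ?thesis using l by (intro exI[of _ "k + 4"]) simp
qed

theorem theorem4p2:
  shows "\<exists>c1 c2 c3 :: real. c1 > 0 \<and> c2 > 0 \<and> c3 > 0 \<and>
    (\<forall>(n :: nat) (d :: nat) (L :: real) (\<Delta> :: real) (\<epsilon> :: real) (\<sigma> :: real)
        (\<tau>s :: real) (\<tau>w :: real) (h :: real) p A.
      n \<ge> 1 \<longrightarrow> d \<ge> 1 \<longrightarrow>
      L > 0 \<longrightarrow> \<Delta> > 0 \<longrightarrow> \<epsilon> > 0 \<longrightarrow> \<sigma> > 0 \<longrightarrow> \<tau>s > 0 \<longrightarrow> \<tau>w > 0 \<longrightarrow> h > 0 \<longrightarrow>
      c1 * \<epsilon> * ln (real n + 1) ^ 4 < L * \<Delta> \<longrightarrow>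
      real d \<ge> c3 * (L * \<Delta> / (ln (real n + 1) ^ 3 * \<epsilon>)) \<longrightarrow>
      workers p = n \<longrightarrow> dim p = d \<longrightarrow>
      grad_time p = h \<longrightarrow> down_coord_time p = \<tau>s \<longrightarrow> up_coord_time p = \<tau>w \<longrightarrow>
      valid_protocol p \<longrightarrow> measurable_algorithm A \<longrightarrow> zero_respecting A \<longrightarrow>
      (\<exists>f D G.
        smooth d L f \<and> gap_le d f \<Delta> \<and> gradient_oracle d f (\<sigma>\<^sup>2) D G \<and>
        (\<forall>M T. run_law p D M \<longrightarrow> (\<forall>\<omega>\<in>space M. is_run p A G \<omega> (T \<omega>)) \<longrightarrow>
          (\<forall>t \<le> c2 * (1 / ln (real n + 1) ^ 3 * (L * \<Delta> / \<epsilon>)) *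
                 min (1 / ln (real n + 1) * (\<tau>s * real d))
                     (max h (1 / ln (real n + 1) ^ 3 * (h * \<sigma>\<^sup>2 / \<epsilon>))).
            (\<integral>\<omega>. (INF y\<in>constructible p (T \<omega>) t. (enorm d (grad d f y))\<^sup>2) \<partial>M) > \<epsilon>))))"
proof -
  \<comment> \<open>Its size is dictated by the gap, where
    \<open>749568 * 6561 * c0 \<le> 2 / 3\<close> is needed. The constant \<open>6 / c0\<close>
    ensures enough blocks, and \<open>81 * c0\<close> is the one in the bound on the chain length
    \<open>T\<close>.\<close>
  define c0 :: real where "c0 = 1 / 10 ^ 10"
  have c0: "c0 > 0" by (simp add: c0_def)
  show ?thesis
  proof (rule exI[of _ "6 / c0"], rule exI[of _ "c0 / 10 ^ 4"], rule exI[of _ "81 * c0"],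
      intro conjI allI impI)
    show "6 / c0 > 0" "c0 / 10 ^ 4 > 0" "81 * c0 > 0" using c0 by simp_all
    fix n d :: nat and L \<Delta> \<epsilon> \<sigma> \<tau>s \<tau>w h :: real and p A
    assume n: "n \<ge> 1" and d: "d \<ge> 1" and L: "L > 0" and \<Delta>: "\<Delta> > 0" and \<epsilon>: "\<epsilon> > 0" and \<sigma>: "\<sigma> > 0"
      and \<tau>s: "\<tau>s > 0" and \<tau>w: "\<tau>w > 0" and h: "h > 0"
      and gap: "6 / c0 * \<epsilon> * ln (real n + 1) ^ 4 < L * \<Delta>"
      and dim: "real d \<ge> 81 * c0 * (L * \<Delta> / (ln (real n + 1) ^ 3 * \<epsilon>))"
      and p: "workers p = n" "dim p = d" "grad_time p = h" "down_coord_time p = \<tau>s" "up_coord_time p = \<tau>w"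
      and valid: "valid_protocol p" and A: "measurable_algorithm A" "zero_respecting A"
    define l where "l = ln (real n + 1)"
    have l: "2 / 3 \<le> l"
    proof -
      have "ln 2 \<le> l" using n by (simp add: l_def)
      then show ?thesis using ln2_ge_two_thirds by linarith
    qed
    obtain Q where expo: "Q \<ge> 4" "n \<le> 2 ^ Q" "l \<le> real Q" "real Q \<le> 9 * l"
      using block_exponent_exists[OF n] unfolding l_def by blast
    \<comment> \<open>The chain has length of order \<open>l * Y\<close>, that is
      \<open>L * \<Delta> / (\<epsilon> * l ^ 3)\<close>, and a block has length of order
      \<open>l\<close>. So \<open>Y\<close> is the number of blocks up to a constant.\<close>
    define Y where "Y = L * \<Delta> / (\<epsilon> * l ^ 4)"
    have Y0: "Y > 0" using L \<Delta> \<epsilon> l by (simp add: Y_def)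
    have LD: "L * \<Delta> = \<epsilon> * l ^ 4 * Y" using \<epsilon> l by (simp add: Y_def)
    have Y: "6 < c0 * Y"
      using gap \<epsilon> l c0 unfolding Y_def l_def[symmetric] by (simp add: field_simps)
    define B where "B = nat \<lfloor>c0 * Y\<rfloor>"
    have B: "real B \<le> c0 * Y" "c0 * Y / 2 \<le> real B" "B \<ge> 3"
      unfolding B_def using Y by linarith+
    define T where "T = 8 * Q * B + 1"
    have T_le: "real T \<le> 81 * c0 * (l * Y)"
    proof -
      have "1 \<le> Q * B" using expo(1) B(3) by simp
      then have "T \<le> 9 * (Q * B)" by (simp add: T_def)
      then have "real T \<le> 9 * (real Q * real B)" by (simp flip: of_nat_mult)
      also have "\<dots> \<le> 9 * ((9 * l) * (c0 * Y))"
        using expo(4) B(1) l by (intro mult_left_mono mult_mono) auto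
      finally show ?thesis by (simp add: mult_ac)
    qed
    have T_dim: "T \<le> d"
    proof -
      have "L * \<Delta> / (l ^ 3 * \<epsilon>) = l * Y" using \<epsilon> l by (simp add: Y_def field_simps power_numeral_reduce)
      then have "real T \<le> real d" using T_le dim unfolding l_def[symmetric] by simp
      then show ?thesis by simp
    qed
    \<comment> \<open>Then \<open>\<beta>\<^sup>2 / 8 = 2 * \<epsilon>\<close>, which makes the
      final inequality strict.\<close>
    define \<beta> where "\<beta> = 4 * sqrt \<epsilon>"
    have \<beta>: "\<beta> > 0" "\<beta>\<^sup>2 = 16 * \<epsilon>" using \<epsilon> by (simp_all add: \<beta>_def power_mult_distrib)
    \<comment> \<open>The value at which the Lipschitz constant of the gradient is bounded by
      exactly \<open>L\<close>.\<close>
    define r where "r = \<beta> * (183 * (real (8 * Q))\<^sup>2) / L"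
    have r: "r > 0" using \<beta> L expo(1) by (simp add: r_def)
    \<comment> \<open>Solves
      \<open>\<beta>\<^sup>2 * (1 / q - 1) = \<sigma>\<^sup>2\<close>.\<close>
    define q where "q = 1 / (1 + \<sigma>\<^sup>2 / (16 * \<epsilon>))"
    have den: "1 + \<sigma>\<^sup>2 / (16 * \<epsilon>) \<ge> 1" using \<epsilon> by simp
    have prob: "0 < q" "q \<le> 1" "1 / q = 1 + \<sigma>\<^sup>2 / (16 * \<epsilon>)" using den by (simp_all add: q_def)
    have smooth: "smooth d L (obj (8 * Q) T \<beta> r)"
      using expo(1) r \<beta>(1) T_dim L by (intro obj_smooth) (auto simp: r_def)
    have gap: "gap_le d (obj (8 * Q) T \<beta> r) \<Delta>"
    proof (rule obj_gap)
      \<comment> \<open>\<open>749568 = 4 * 16 * 183 * 8\<^sup>2\<close>; the factor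
        \<open>6561 = 9\<^sup>2 * 81\<close> below comes from the bounds on \<open>Q\<close> and
        \<open>T\<close>.\<close>
      have "4 * \<beta> * r * real T * L = 749568 * \<epsilon> * ((real Q)\<^sup>2 * real T)"
        using L \<beta>(2) by (simp add: r_def power_mult_distrib power2_eq_square)
      also have "\<dots> \<le> 749568 * \<epsilon> * ((9 * l)\<^sup>2 * (81 * c0 * (l * Y)))"
        using expo(4) T_le \<epsilon> l by (intro mult_left_mono mult_mono power_mono) auto
      also have "\<dots> = (749568 * 6561 * c0) * (\<epsilon> * l ^ 3 * Y)"
        by (simp add: power2_eq_square power3_eq_cube)
      also have "\<dots> \<le> l * (\<epsilon> * l ^ 3 * Y)"
      proof (rule mult_right_mono)
        show "749568 * 6561 * c0 \<le> l" using l by (simp add: c0_def)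
        show "0 \<le> \<epsilon> * l ^ 3 * Y" using \<epsilon> l Y0 by simp
      qed
      also have "\<dots> = L * \<Delta>" by (simp add: LD power_numeral_reduce)
      finally show "4 * \<beta> * r * real T \<le> \<Delta>" using L by (simp add: mult.commute)
    qed (use r \<beta> in auto)
    have grad_oracle: "gradient_oracle d (obj (8 * Q) T \<beta> r) (\<sigma>\<^sup>2) (coin q) (obj_oracle (8 * Q) T \<beta> r q)"
      using expo(1) r \<beta> T_dim prob \<epsilon> by (intro obj_gradient_oracle) auto
    \<comment> \<open>The longest phase that \<open>phase_down\<close> and \<open>phase_grad\<close>
      permit. It is then cut into equal cells no longer than \<open>h\<close> and
      \<open>\<tau>s\<close>.\<close>
    define len where "len = min (\<tau>s * d / 32) (h * Q / (4 * q))"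
    define m where "m = nat \<lceil>len / min h \<tau>s\<rceil>"
    define \<delta> where "\<delta> = len / m"
    have len: "len > 0" using \<tau>s d h expo(1) prob by (simp add: len_def)
    have ratio: "len / min h \<tau>s > 0" using len h \<tau>s by simp
    have m: "m \<ge> 1" unfolding m_def using ratio by linarith
    have m\<delta>: "m * \<delta> = len" using m by (simp add: \<delta>_def)
    have \<delta>_le: "\<delta> \<le> min h \<tau>s"
    proof -
      have "len / min h \<tau>s \<le> m" unfolding m_def by linarith
      moreover have "min h \<tau>s > 0" using h \<tau>s by simp
      ultimately have "len \<le> m * min h \<tau>s" by (simp only: pos_divide_le_eq)
      moreover have "real m > 0" using m by simp
      ultimately show ?thesis unfolding \<delta>_def by (simp only: pos_divide_le_eq mult.commute)
    qed
    interpret schedule p Q m \<delta> q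
    proof unfold_locales
      show "32 * (m * \<delta>) \<le> down_coord_time p * dim p" unfolding m\<delta> p by (simp add: len_def)
      have "len \<le> h * Q / (4 * q)" by (simp add: len_def)
      then have "4 * q * len \<le> Q * h" using prob by (simp add: field_simps)
      then show "4 * q * (m * \<delta>) \<le> Q * grad_time p" unfolding m\<delta> p .
      show "\<delta> > 0" using len m by (simp add: \<delta>_def)
    qed (use valid n \<tau>s \<tau>w h expo m \<delta>_le prob in \<open>simp_all add: p\<close>)
    show "\<exists>f D G. smooth d L f \<and> gap_le d f \<Delta> \<and> gradient_oracle d f (\<sigma>\<^sup>2) D G \<and>
        (\<forall>M T. run_law p D M \<longrightarrow> (\<forall>\<omega>\<in>space M. is_run p A G \<omega> (T \<omega>)) \<longrightarrow>
          (\<forall>t \<le> c0 / 10 ^ 4 * (1 / ln (real n + 1) ^ 3 * (L * \<Delta> / \<epsilon>)) *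
                 min (1 / ln (real n + 1) * (\<tau>s * real d))
                     (max h (1 / ln (real n + 1) ^ 3 * (h * \<sigma>\<^sup>2 / \<epsilon>))).
            (\<integral>\<omega>. (INF y\<in>constructible p (T \<omega>) t. (enorm d (grad d f y))\<^sup>2) \<partial>M) > \<epsilon>))"
    proof (rule exI[of _ "obj (8 * Q) T \<beta> r"], rule exI[of _ "coin q"],
        rule exI[of _ "obj_oracle (8 * Q) T \<beta> r q"], intro conjI allI impI)
      show "smooth d L (obj (8 * Q) T \<beta> r)" "gap_le d (obj (8 * Q) T \<beta> r) \<Delta>"
        "gradient_oracle d (obj (8 * Q) T \<beta> r) (\<sigma>\<^sup>2) (coin q) (obj_oracle (8 * Q) T \<beta> r q)"
        by fact+
      fix M Tr t
      assume law: "run_law p (coin q) M"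
        and runs: "\<forall>\<omega>\<in>space M. is_run p A (obj_oracle (8 * Q) T \<beta> r q) \<omega> (Tr \<omega>)"
        and t: "t \<le> c0 / 10 ^ 4 * (1 / ln (real n + 1) ^ 3 * (L * \<Delta> / \<epsilon>)) *
           min (1 / ln (real n + 1) * (\<tau>s * real d)) (max h (1 / ln (real n + 1) ^ 3 * (h * \<sigma>\<^sup>2 / \<epsilon>)))"
      have "1 / l ^ 3 * (L * \<Delta> / \<epsilon>) = l * Y" using \<epsilon> l by (simp add: Y_def field_simps power_numeral_reduce)
      then have t': "t \<le> c0 / 10 ^ 4 * (l * Y) * min (1 / l * (\<tau>s * d)) (max h (1 / l ^ 3 * (h * \<sigma>\<^sup>2 / \<epsilon>)))"
        using t unfolding l_def[symmetric] by simp
      have coeff: "c0 / 10 ^ 4 * (l * Y) \<ge> 0" using c0 l Y0 by simp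
      have "16 * t \<le> B * (\<tau>s * d / 32)"
      proof -
        have "t \<le> c0 / 10 ^ 4 * (l * Y) * (1 / l * (\<tau>s * d))"
          using t' mult_left_mono[OF min.cobounded1 coeff] by (rule order_trans)
        also have "\<dots> = c0 * Y / 10 ^ 4 * (\<tau>s * d)" using l by simp
        \<comment> \<open>\<open>1024 = 16 * 32 * 2\<close>, the last factor for rounding
          \<open>c0 * Y\<close> down to \<open>B\<close>. This and \<open>6912 = 16 * 54 * 8\<close>
          below are what the \<open>10 ^ 4\<close> in the time bound absorbs.\<close>
        finally have "16 * t \<le> (c0 * Y / 2) * (\<tau>s * d / 32) * (1024 / 10 ^ 4)" by simp
        also have "\<dots> \<le> (c0 * Y / 2) * (\<tau>s * d / 32) * 1"
          using c0 Y0 \<tau>s by (intro mult_left_mono) auto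
        also have "\<dots> \<le> B * (\<tau>s * d / 32)" using B(2) \<tau>s by (simp only: mult_1_right) (intro mult_right_mono, auto)
        finally show ?thesis .
      qed
      moreover have "16 * t \<le> B * (h * Q / (4 * q))"
      proof -
        have l3: "8 / 27 \<le> l ^ 3" using power_mono[OF l, of 3] by (simp add: power3_eq_cube)
        \<comment> \<open>\<open>54 = 16 * 27 / 8\<close>, from
          \<open>\<sigma>\<^sup>2 / (16 * \<epsilon>) \<le> 1 / q\<close> and
          \<open>1 / l ^ 3 \<le> 27 / 8\<close>.\<close>
        have max_le: "max h (1 / l ^ 3 * (h * \<sigma>\<^sup>2 / \<epsilon>)) \<le> 54 * (h / q)"
        proof (rule max.boundedI)
          have "h * 1 \<le> h * (54 * (1 / q))" using h prob(3) den by (intro mult_left_mono) auto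
          then show "h \<le> 54 * (h / q)" by (simp add: mult.commute)
          have "1 / l ^ 3 \<le> 27 / 8" using l3 l by (simp add: divide_le_eq)
          then have "1 / l ^ 3 * (h * \<sigma>\<^sup>2 / \<epsilon>) \<le> 27 / 8 * (h * \<sigma>\<^sup>2 / \<epsilon>)"
            using h \<epsilon> by (intro mult_right_mono) auto
          also have "\<dots> = 54 * (h * (\<sigma>\<^sup>2 / (16 * \<epsilon>)))" by simp
          also have "\<dots> \<le> 54 * (h * (1 / q))" using prob(3) h by (intro mult_left_mono) auto
          finally show "1 / l ^ 3 * (h * \<sigma>\<^sup>2 / \<epsilon>) \<le> 54 * (h / q)" by simp
        qed
        have hq: "h / q > 0" using h prob by simp
        have "t \<le> c0 / 10 ^ 4 * (l * Y) * (54 * (h / q))"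
          using t' mult_left_mono[OF order_trans[OF min.cobounded2 max_le] coeff] by (rule order_trans)
        then have "16 * t \<le> (c0 * Y / 2) * (h * l / (4 * q)) * (6912 / 10 ^ 4)"
          by (simp add: algebra_simps)
        also have "\<dots> \<le> (c0 * Y / 2) * (h * l / (4 * q)) * 1"
          using c0 Y0 h l prob by (intro mult_left_mono) auto
        also have "\<dots> \<le> B * (h * Q / (4 * q))"
          using B(2) expo(3) h prob l c0 Y0 unfolding mult_1_right
          by (intro mult_mono divide_right_mono mult_left_mono) auto
        finally show ?thesis .
      qed
      ultimately have "16 * t \<le> B * len"
        using B(3) unfolding len_def by (simp add: min_def)
      then have "16 * t \<le> B * (m * \<delta>)" by (simp only: m\<delta>)
      then have "\<beta>\<^sup>2 / 8 \<le> (\<integral>\<omega>. (INF y\<in>constructible p (Tr \<omega>) t.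
          (enorm (dim p) (grad (dim p) (obj (8 * Q) T \<beta> r) y))\<^sup>2) \<partial>M)"
        using A r \<beta>(1) T_dim B(3) law runs unfolding T_def p
        by (intro expected_gradient_ge[unfolded p]) auto
      then show "(\<integral>\<omega>. (INF y\<in>constructible p (Tr \<omega>) t. (enorm d (grad d (obj (8 * Q) T \<beta> r) y))\<^sup>2) \<partial>M) > \<epsilon>"
        using \<beta>(2) \<epsilon> by (simp add: p)
    qed
  qed
qed

end
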